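(* Let $p$ be a prime or $p=1$, let $m\ge0$ be an integer, $\mathfrak m=m\cdot(\infty)$ on $X=X_0^*(p)$, and let $F\in H_0^+(\Gamma_0^*(p))$ be a harmonic Maass form of weight $0$ with holomorphic part $F^+=\sum_{n\gg-\infty}c_F^+(n)q_\infty^n$. Assume that $c_F^+(n)=0$ for all $n\le -m$ and that $c_F^+(0)=0$. Then there is a (well defined) linear map $\mathrm{tr}_F:J_{\mathfrak m}(X)\to\mathbb C$ given by $$[D]_{\mathfrak m}\mapsto \mathrm{tr}_F(D):=\sum_{a\in\mathrm{supp}(D)\setminus\{\infty\}}n_a\cdot F(a)$$ for divisors $D=\sum_a n_a\cdot(a)$ in $\mathrm{Div}^0(X)$.
   Context: $\Gamma_0^*(p)\subset\mathrm{PSL}_2(\mathbb R)$ is the group generated by (the image of) $\Gamma_0(p)$ and the Fricke involution $\tau\mapsto-1/(p\tau)$; $X=X_0^*(p)$ is the compact modular curve $\Gamma_0^*(p)\backslash(\mathbb H\cup P^1(\mathbb Q))$ with its model over $\mathbb Q$. It has exactly one cusp $\infty$, with local parameter $q_\infty=e^{2\pi i\tau}$. $J_{\mathfrak m}(X)$ denotes the $\mathbb Q$-rational points of the generalized Jacobian, i.e. $\mathrm{Div}^0(X)/P_{\mathfrak m}(X)$, where $\mathrm{Div}^0(X)$ is the group of degree zero divisors defined over $\mathbb Q$ and $P_{\mathfrak m}(X)=\{\mathrm{div}(f): f\in\mathbb Q(X)^\times,\ q_\infty^{-\mathrm{ord}_\infty(f)}f=1+O(q_\infty^m)\}$; $[D]_{\mathfrak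 m}$ is the class of $D$. $H_0^+(\Gamma_0^*(p))$ is the space of harmonic Maass forms of weight $0$: smooth $\Gamma_0^*(p)$-invariant functions $F:\mathbb H\to\mathbb C$ annihilated by the hyperbolic Laplacian, for which there is a polynomial $P\in\mathbb C[q_\infty^{-1}]$ with $F-P=O(e^{-\varepsilon\,\mathrm{Im}(\tau)})$ for some $\varepsilon>0$ as $\mathrm{Im}(\tau)\to\infty$. Such $F$ has a unique decomposition $F=F^++F^-$ with $F^+=\sum_{n\gg-\infty}c_F^+(n)q_\infty^n$ (the holomorphic part) and $F^-=\sum_{n>0}c_F^-(-n)\,\overline{q_\infty}^{\,n}$. *)

theory Defs
  imports
    "HOL-Complex_Analysis.Complex_Analysis"
    "HOL-Algebra.Generated_Groups"
    "HOL-Algebra.Free_Abelian_Groups"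
    "HOL-Library.Landau_Symbols"
begin

definition upper_half_plane :: "complex set" where
  "upper_half_plane = {z. Im z > 0}"

definition SL2R :: "(real^2^2) monoid" where
  "SL2R = \<lparr>carrier = {A. det A = 1}, monoid.mult = (**), one = mat 1\<rparr>"

definition Gamma0 :: "nat \<Rightarrow> (real^2^2) set" where
  "Gamma0 p = {A. det A = 1 \<and> (\<forall>i j. A$i$j \<in> \<int>) \<and> (\<exists>k\<in>\<int>. A$2$1 = real p * k)}"

text \<open>The determinant-one matrix of \<open>\<tau> \<mapsto> - 1 / (p \<tau>)\<close>.\<close>

definition fricke :: "nat \<Rightarrow> real^2^2" where
  "fricke p = vector [vector [0, - 1 / sqrt (real p)], vector [sqrt (real p), 0]]"

text \<open>
  We work with the full preimage in \<open>SL\<^sub>2(\<real>)\<close> of the group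
  \<open>\<Gamma>\<^sub>0\<^sup>*(p) \<subseteq> PSL\<^sub>2(\<real>)\<close>; it contains \<open>-1\<close> because \<open>\<Gamma>\<^sub>0(p)\<close> does.
  Only the ramification index below has to take the sign into account.
\<close>

definition Gamma0star :: "nat \<Rightarrow> (real^2^2) set" where
  "Gamma0star p = generate SL2R (Gamma0 p \<union> {fricke p})"

definition mob :: "real^2^2 \<Rightarrow> complex \<Rightarrow> complex" where
  "mob A z = (of_real (A$1$1) * z + of_real (A$1$2)) / (of_real (A$2$1) * z + of_real (A$2$2))"

datatype 'a proj_line = Aff 'a | Infty

fun proj_mob :: "real^2^2 \<Rightarrow> complex proj_line \<Rightarrow> complex proj_line" where
  "proj_mob A (Aff z) =
     (if of_real (A$2$1) * z + of_real (A$2$2) = 0 then Infty else Aff (mob A z))"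
| "proj_mob A Infty =
     (if A$2$1 = 0 then Infty else Aff (of_real (A$1$1) / of_real (A$2$1)))"

definition extended_half_plane :: "complex proj_line set" where
  "extended_half_plane = Aff ` upper_half_plane \<union> (Aff ` \<rat> \<union> {Infty})"

type_synonym point = "complex proj_line set"

definition orbit :: "nat \<Rightarrow> complex proj_line \<Rightarrow> point" where
  "orbit p x = {proj_mob A x | A. A \<in> Gamma0star p}"

definition X0star :: "nat \<Rightarrow> point set" where
  "X0star p = orbit p ` extended_half_plane"

definition cusp :: "nat \<Rightarrow> point" where
  "cusp p = orbit p Infty"

text \<open>A representative in the upper half plane, for the points other than the cusp.\<close>

definition rep :: "point \<Rightarrow> complex" where
  "rep a = (SOME z. z \<in> upper_half_plane \<and> Aff z \<in> a)"

text \<open>The order of the stabilizer in \<open>PSL\<^sub>2(\<real>)\<close>, i.e. modulo sign.\<close>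

definition ram_index :: "nat \<Rightarrow> complex \<Rightarrow> nat" where
  "ram_index p z = card ((\<lambda>A. {A, - A}) ` {A \<in> Gamma0star p. mob A z = z})"

definition q_inf :: "complex \<Rightarrow> complex" where
  "q_inf \<tau> = exp (2 * of_real pi * \<i> * \<tau>)"

abbreviation at_i_inf :: "complex filter" where
  "at_i_inf \<equiv> filtercomap Im at_top"

definition has_q_expansion :: "(complex \<Rightarrow> complex) \<Rightarrow> complex fls \<Rightarrow> bool" where
  "has_q_expansion f L \<longleftrightarrow>
     fls_conv_radius L > 0 \<and> (\<forall>\<^sub>F \<tau> in at_i_inf. f \<tau> = eval_fls L (q_inf \<tau>))"

definition q_expansion :: "(complex \<Rightarrow> complex) \<Rightarrow> complex fls" where
  "q_expansion f = (THE L. has_q_expansion f L)"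

definition Gamma_invariant :: "nat \<Rightarrow> (complex \<Rightarrow> complex) \<Rightarrow> bool" where
  "Gamma_invariant p f \<longleftrightarrow>
     (\<forall>A\<in>Gamma0star p. \<forall>\<tau>\<in>upper_half_plane. f (mob A \<tau>) = f \<tau>)"

text \<open>
  The model over \<open>\<rat>\<close> is the canonical one: its function field consists of the
  meromorphic modular functions whose \<open>q\<^sub>\<infinity>\<close>-expansion has rational coefficients.
  Since there is only one cusp, meromorphy at infinity is the only cuspidal condition.
  As usual for \<open>nicely_meromorphic_on\<close>, the values at poles are normalized to 0 and
  removable singularities are removed, so that invariance can be stated pointwise.
\<close>

definition function_field :: "nat \<Rightarrow> (complex \<Rightarrow> complex) set" where
  "function_field p = {f. f nicely_meromorphic_on upper_half_plane \<and> Gamma_invariant p f \<and>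
     (\<exists>L. has_q_expansion f L \<and> (\<forall>n. fls_nth L n \<in> \<rat>))}"

definition function_field_units :: "nat \<Rightarrow> (complex \<Rightarrow> complex) set" where
  "function_field_units p = {f \<in> function_field p. \<exists>\<tau>\<in>upper_half_plane. f \<tau> \<noteq> 0}"

definition ord_cusp :: "(complex \<Rightarrow> complex) \<Rightarrow> int" where
  "ord_cusp f = fls_subdegree (q_expansion f)"

text \<open>
  A local parameter at the image of \<open>z\<close> is \<open>((\<tau> - z) / (\<tau> - cnj z))\<^sup>e\<close>,
  where \<open>e\<close> is the ramification index; hence the (exact) division.
\<close>

definition ord_at :: "nat \<Rightarrow> (complex \<Rightarrow> complex) \<Rightarrow> point \<Rightarrow> int" where
  "ord_at p f a =
     (if a = cusp p then ord_cusp f else zorder f (rep a) div int (ram_index p (rep a)))"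

definition value_at :: "nat \<Rightarrow> (complex \<Rightarrow> complex) \<Rightarrow> point \<Rightarrow> complex proj_line" where
  "value_at p f a =
     (if a = cusp p
      then (if ord_cusp f < 0 then Infty else Aff (fls_nth (q_expansion f) 0))
      else (if is_pole f (rep a) then Infty else Aff (f (rep a))))"

definition field_automorphism :: "(complex \<Rightarrow> complex) \<Rightarrow> bool" where
  "field_automorphism \<sigma> \<longleftrightarrow>
     bij \<sigma> \<and> (\<forall>x y. \<sigma> (x + y) = \<sigma> x + \<sigma> y) \<and> (\<forall>x y. \<sigma> (x * y) = \<sigma> x * \<sigma> y)"

text \<open>
  \<open>b = \<sigma>(a)\<close> for the action of \<open>Aut(\<complex>)\<close> on the complex points of the rational model:
  \<open>f(\<sigma>(a)) = \<sigma>(f(a))\<close> for all rational functions \<open>f\<close> defined over \<open>\<rat>\<close>.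
\<close>

definition conjugate_pt :: "nat \<Rightarrow> (complex \<Rightarrow> complex) \<Rightarrow> point \<Rightarrow> point \<Rightarrow> bool" where
  "conjugate_pt p \<sigma> a b \<longleftrightarrow>
     (\<forall>f\<in>function_field p. value_at p f b = map_proj_line \<sigma> (value_at p f a))"

definition defined_over_Q :: "nat \<Rightarrow> (point \<Rightarrow>\<^sub>0 int) \<Rightarrow> bool" where
  "defined_over_Q p D \<longleftrightarrow>
     (\<forall>\<sigma>. field_automorphism \<sigma> \<longrightarrow> (\<forall>a\<in>X0star p. \<forall>b\<in>X0star p.
        conjugate_pt p \<sigma> a b \<longrightarrow> Poly_Mapping.lookup D b = Poly_Mapping.lookup D a))"

definition divisor_degree :: "(point \<Rightarrow>\<^sub>0 int) \<Rightarrow> int" where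
  "divisor_degree D = (\<Sum>a\<in>Poly_Mapping.keys D. Poly_Mapping.lookup D a)"

definition Div0 :: "nat \<Rightarrow> (point \<Rightarrow>\<^sub>0 int) monoid" where
  "Div0 p = (free_Abelian_group (X0star p))
     \<lparr>carrier := {D \<in> carrier (free_Abelian_group (X0star p)).
                   defined_over_Q p D \<and> divisor_degree D = 0}\<rparr>"

definition principal_divisor :: "nat \<Rightarrow> (complex \<Rightarrow> complex) \<Rightarrow> (point \<Rightarrow>\<^sub>0 int)" where
  "principal_divisor p f = Abs_poly_mapping (\<lambda>a. if a \<in> X0star p then ord_at p f a else 0)"

definition principal_mod :: "nat \<Rightarrow> nat \<Rightarrow> (point \<Rightarrow>\<^sub>0 int) set" where
  "principal_mod p m = {principal_divisor p f | f. f \<in> function_field_units p \<and>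
     (\<lambda>\<tau>. q_inf \<tau> powi (- ord_cusp f) * f \<tau> - 1) \<in> O[at_i_inf](\<lambda>\<tau>. q_inf \<tau> ^ m)}"

definition generalized_jacobian :: "nat \<Rightarrow> nat \<Rightarrow> (point \<Rightarrow>\<^sub>0 int) set monoid" where
  "generalized_jacobian p m = Div0 p Mod principal_mod p m"

definition divisor_class :: "nat \<Rightarrow> nat \<Rightarrow> (point \<Rightarrow>\<^sub>0 int) \<Rightarrow> (point \<Rightarrow>\<^sub>0 int) set" where
  "divisor_class p m D = principal_mod p m #>\<^bsub>Div0 p\<^esub> D"

definition complex_add_group :: "complex monoid" where
  "complex_add_group = \<lparr>carrier = UNIV, monoid.mult = (+), one = 0\<rparr>"

definition dir_deriv :: "complex \<Rightarrow> (complex \<Rightarrow> complex) \<Rightarrow> complex \<Rightarrow> complex" where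
  "dir_deriv v F = (\<lambda>z. frechet_derivative F (at z) v)"

text \<open>The derivatives are real (Frechet) ones, and \<open>S\<close> is meant to be open.\<close>

primrec Ck_on :: "nat \<Rightarrow> complex set \<Rightarrow> (complex \<Rightarrow> complex) \<Rightarrow> bool" where
  "Ck_on 0 S F \<longleftrightarrow> continuous_on S F"
| "Ck_on (Suc k) S F \<longleftrightarrow> (\<forall>z\<in>S. F differentiable at z) \<and> (\<forall>v. Ck_on k S (dir_deriv v F))"

definition smooth_on :: "complex set \<Rightarrow> (complex \<Rightarrow> complex) \<Rightarrow> bool" where
  "smooth_on S F \<longleftrightarrow> (\<forall>k. Ck_on k S F)"

definition hyperbolic_laplacian :: "(complex \<Rightarrow> complex) \<Rightarrow> complex \<Rightarrow> complex" where
  "hyperbolic_laplacian F z =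
     - of_real ((Im z)\<^sup>2) * (dir_deriv 1 (dir_deriv 1 F) z + dir_deriv \<i> (dir_deriv \<i> F) z)"

definition harmonic_maass_forms :: "nat \<Rightarrow> (complex \<Rightarrow> complex) set" where
  "harmonic_maass_forms p = {F. smooth_on upper_half_plane F \<and> Gamma_invariant p F \<and>
     (\<forall>z\<in>upper_half_plane. hyperbolic_laplacian F z = 0) \<and>
     (\<exists>P :: complex poly. \<exists>\<epsilon>>0.
        (\<lambda>\<tau>. F \<tau> - poly P (inverse (q_inf \<tau>)))
          \<in> O[at_i_inf](\<lambda>\<tau>. of_real (exp (- \<epsilon> * Im \<tau>))))}"

text \<open>
  The decomposition \<open>F = F\<^sup>+ + F\<^sup>-\<close>: the coefficient of \<open>q\<^sup>n\<close> in \<open>F\<^sup>+\<close> is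
  \<open>fls_nth Fp n\<close>, that of \<open>cnj q ^ n\<close> in \<open>F\<^sup>-\<close> is \<open>fps_nth Fm n\<close> for \<open>n > 0\<close>.
\<close>

definition maass_expansion :: "(complex \<Rightarrow> complex) \<Rightarrow> complex fls \<Rightarrow> complex fps \<Rightarrow> bool" where
  "maass_expansion F Fp Fm \<longleftrightarrow>
     fls_conv_radius Fp \<ge> 1 \<and> fps_conv_radius Fm \<ge> 1 \<and> fps_nth Fm 0 = 0 \<and>
     (\<forall>\<tau>\<in>upper_half_plane. F \<tau> = eval_fls Fp (q_inf \<tau>) + eval_fps Fm (cnj (q_inf \<tau>)))"

definition is_holomorphic_part :: "(complex \<Rightarrow> complex) \<Rightarrow> complex fls \<Rightarrow> bool" where
  "is_holomorphic_part F Fp \<longleftrightarrow> (\<exists>Fm. maass_expansion F Fp Fm)"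

definition divisor_trace :: "nat \<Rightarrow> (complex \<Rightarrow> complex) \<Rightarrow> (point \<Rightarrow>\<^sub>0 int) \<Rightarrow> complex" where
  "divisor_trace p F D = (\<Sum>a\<in>Poly_Mapping.keys D - {cusp p}. of_int (Poly_Mapping.lookup D a) * F (rep a))"

end

theory Submission
  imports Defs
begin

text \<open>
  Let \<open>h\<close> be a nonconstant modular function vanishing at the cusp. Summing \<open>F\<close> over the fibre of
  \<open>1 / h\<close> above \<open>s\<close>, with multiplicities, gives a function \<open>G(s)\<close> on the plane. By the argument
  principle, \<open>G\<close> is locally a holomorphic plus an antiholomorphic function, because \<open>F\<close> is. Near
  \<open>s = \<infinity>\<close> the fibre consists of points close to the zeros of \<open>h\<close> in the upper half plane and of
  points close to the cusp; the latter contribute a polynomial \<open>\<Sum> R\<^sub>i s\<^sup>i\<close> up to \<open>o(1)\<close>, where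
  \<open>R\<^sub>i\<close> is the residue of \<open>F\<^sup>+ h\<^sup>i h' / h\<close> at \<open>q = 0\<close>. By the maximum principle \<open>G\<close> is equal to
  this polynomial plus the sum of \<open>F\<close> over the zeros of \<open>h\<close>.

  For a function \<open>f\<close> with \<open>q\<^sup>-\<^sup>k f = 1 + O(q\<^sup>m)\<close> this is applied to \<open>h = f\<close> or \<open>h = 1 / f\<close> at
  \<open>s = 0\<close> if \<open>k \<noteq> 0\<close>; the vanishing of the coefficients of \<open>F\<^sup>+\<close> gives \<open>R\<^sub>0 = 0\<close>. If \<open>k = 0\<close>, one
  takes \<open>h = f - f(\<infinity>)\<close>; then \<open>R\<^sub>i = 0\<close> for \<open>i \<ge> 1\<close>, so \<open>G\<close> is constant, and its values at
  \<open>s = 0\<close> and \<open>s = - 1 / f(\<infinity>)\<close> are the sums of \<open>F\<close> over the poles and over the zeros of \<open>f\<close>.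
\<close>

no_notation fps_nth (infixl \<open>$\<close> 75)
  \<comment> \<open>it would make every matrix entry \<open>A $ i $ j\<close> ambiguous\<close>


section \<open>Fibre sums of holomorphic functions\<close>

text \<open>On a compact curve one could pair \<open>F\<close> with \<open>df / f\<close> by Stokes'
  theorem. Here the curve is only a set of orbits, and since \<open>F\<close> is not holomorphic the
  residue theorem does not apply to \<open>F df / f\<close> either. Pushing \<open>F\<close> forward
  along a modular function replaces the curve by the plane, where the maximum principle is
  elementary. The push-forward is taken along \<open>1 / h\<close> because \<open>h\<close> vanishes
  at the single cusp: fibres above bounded \<open>s\<close> stay away from the cusp, and the growth
  of \<open>F\<close> there is felt only as polynomial growth at \<open>s = \<infinity>\<close>. Two
  points shape the work on the curve. The parts \<open>F^+\<close> and \<open>F^-\<close> are in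
  general not separately invariant, so they are summed only over small discs, whose orbits are kept
  disjoint by proper discontinuity and a height bound. And at elliptic points a zero in \<tau>
  counts with weight \<open>1 / e\<close>, whereas sums over discs carry the order of the
  stabilizer; counting orbits matches the two. Reduction theory supplies the compactness that the
  curve would give.\<close>

lemma locally_Re_holomorphic_le_limit:
  fixes v :: "complex \<Rightarrow> real"
  assumes loc: "\<And>s. \<exists>e>0. \<exists>k. k holomorphic_on ball s e \<and> (\<forall>x\<in>ball s e. v x = Re (k x))"
    and lim: "(v \<longlongrightarrow> L) at_infinity"
  shows "v s \<le> L"
proof (rule ccontr)
  assume "\<not> v s \<le> L"
  then have gt: "v s > L" by simp
  have cont: "continuous_on UNIV v"
  proof (rule continuous_at_imp_continuous_on, rule ballI)
    fix x
    obtain e k where ek: "e > 0" "k holomorphic_on ball x e" "\<forall>y\<in>ball x e. v y = Re (k y)"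
      using loc by blast
    have "continuous_on (ball x e) (\<lambda>y. Re (k y))"
      by (intro continuous_intros holomorphic_on_imp_continuous_on ek)
    then have "continuous_on (ball x e) v"
      by (rule continuous_on_eq) (use ek(3) in auto)
    then show "isCont v x" using ek(1) by (simp add: continuous_on_eq_continuous_at)
  qed
  have "eventually (\<lambda>x. v x < v s) at_infinity"
    using order_tendstoD(2)[OF lim gt] .
  then obtain b where b: "\<And>x. norm x \<ge> b \<Longrightarrow> v x < v s"
    by (auto simp: eventually_at_infinity)
  have "norm s < b" using b[of s] by force
  with norm_ge_zero[of s] have "0 < b" by linarith
  then have ne: "cball 0 b \<noteq> ({} :: complex set)" by simp
  obtain s1 where s1: "s1 \<in> cball 0 b" "\<And>x. x \<in> cball 0 b \<Longrightarrow> v x \<le> v s1"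
    using continuous_attains_sup[OF compact_cball ne continuous_on_subset[OF cont]] by blast
  have "v s \<le> v s1" using s1(2)[of s] \<open>norm s < b\<close> by simp
  have mx: "v x \<le> v s1" for x
    using s1(2)[of x] b[of x] \<open>v s \<le> v s1\<close> by (cases "norm x \<le> b") auto
  let ?M = "{x. v x = v s1}"
  have "closed ?M"
    using continuous_closed_vimage[OF closed_singleton, of v "v s1"] cont
    by (simp add: vimage_def continuous_on_eq_continuous_at)
  moreover have "open ?M"
  proof (rule openI)
    fix x assume "x \<in> ?M"
    obtain e k where ek: "e > 0" "k holomorphic_on ball x e" "\<forall>y\<in>ball x e. v y = Re (k y)"
      using loc by blast
    \<comment> \<open>The modulus of \<open>exp k\<close> is \<open>exp (Re k)\<close>, that is
      \<open>exp v\<close>, so a maximum of \<open>v\<close> at the centre is a maximum of a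
      holomorphic modulus.\<close>
    have "(\<lambda>y. exp (k y)) constant_on ball x e"
    proof (rule maximum_modulus_principle[where U = "ball x e" and \<xi> = x])
      show "(\<lambda>y. exp (k y)) holomorphic_on ball x e" by (intro holomorphic_intros ek)
      show "norm (exp (k z)) \<le> norm (exp (k x))" if "z \<in> ball x e" for z
        using ek that mx[of z] \<open>x \<in> ?M\<close> by simp
    qed (use ek in auto)
    then obtain c where c: "\<And>y. y \<in> ball x e \<Longrightarrow> exp (k y) = c" unfolding constant_on_def by blast
    have "v y = v x" if "y \<in> ball x e" for y
    proof -
      have "norm (exp (k y)) = norm (exp (k x))" using c that ek(1) by simp
      then show ?thesis using ek that by simp
    qed
    then have "ball x e \<subseteq> ?M" using \<open>x \<in> ?M\<close> by (metis (mono_tags) mem_Collect_eq subsetI)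
    then show "\<exists>e>0. ball x e \<subseteq> ?M" using ek(1) by blast
  qed
  ultimately have "?M = {} \<or> ?M = UNIV" using clopen by metis
  moreover have "s1 \<in> ?M" by simp
  \<comment> \<open>\<open>?M\<close> is now the whole plane, but at radius \<open>b\<close> the
    bound coming from the limit already holds, so \<open>v\<close> lies there below
    \<open>v s\<close> and hence below its maximum.\<close>
  ultimately have "of_real b \<in> ?M" by (metis UNIV_I empty_iff)
  then have "v (of_real b) = v s1" by simp
  moreover have "v (of_real b) < v s" by (rule b) (use \<open>0 < b\<close> in simp)
  ultimately show False using \<open>v s \<le> v s1\<close> by linarith
qed

lemma locally_Re_holomorphic_eq_limit:
  fixes v :: "complex \<Rightarrow> real"
  assumes loc: "\<And>s. \<exists>e>0. \<exists>k. k holomorphic_on ball s e \<and> (\<forall>x\<in>ball s e. v x = Re (k x))"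
    and lim: "(v \<longlongrightarrow> L) at_infinity"
  shows "v s = L"
proof (rule antisym)
  show "v s \<le> L" by (rule locally_Re_holomorphic_le_limit[OF loc lim])
  have "- v s \<le> - L"
  proof (rule locally_Re_holomorphic_le_limit[where v = "\<lambda>x. - v x"])
    fix s
    obtain e k where ek: "e > 0" "k holomorphic_on ball s e" "\<forall>y\<in>ball s e. v y = Re (k y)"
      using loc by blast
    then show "\<exists>e>0. \<exists>k. k holomorphic_on ball s e \<and> (\<forall>x\<in>ball s e. - v x = Re (k x))"
      by (intro exI[of _ e] conjI exI[of _ "\<lambda>x. - k x"]) (auto intro!: holomorphic_intros)
  next
    show "((\<lambda>x. - v x) \<longlongrightarrow> - L) at_infinity" by (intro tendsto_intros lim)
  qed
  then show "L \<le> v s" by simp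
qed

text \<open>Real and imaginary part of \<open>P + cnj Q\<close> are the real parts of the
  holomorphic functions \<open>P + Q\<close> and \<open>- \<i> * (P - Q)\<close>, which reduces the
  claim to the real case.\<close>

lemma locally_harmonic_eq_limit:
  fixes v :: "complex \<Rightarrow> complex"
  assumes loc: "\<And>s. \<exists>e>0. \<exists>P Q. P holomorphic_on ball s e \<and> Q holomorphic_on ball s e \<and>
                  (\<forall>x\<in>ball s e. v x = P x + cnj (Q x))"
    and lim: "(v \<longlongrightarrow> L) at_infinity"
  shows "v s = L"
proof (rule complex_eqI)
  show "Re (v s) = Re L"
  proof (rule locally_Re_holomorphic_eq_limit[where v = "\<lambda>x. Re (v x)"])
    fix s
    obtain e P Q where *: "e > 0" "P holomorphic_on ball s e" "Q holomorphic_on ball s e"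
      "\<forall>x\<in>ball s e. v x = P x + cnj (Q x)" using loc by blast
    then show "\<exists>e>0. \<exists>k. k holomorphic_on ball s e \<and> (\<forall>x\<in>ball s e. Re (v x) = Re (k x))"
      by (intro exI[of _ e] conjI exI[of _ "\<lambda>x. P x + Q x"]) (auto intro!: holomorphic_intros)
  next
    show "((\<lambda>x. Re (v x)) \<longlongrightarrow> Re L) at_infinity" by (intro tendsto_intros lim)
  qed
  show "Im (v s) = Im L"
  proof (rule locally_Re_holomorphic_eq_limit[where v = "\<lambda>x. Im (v x)"])
    fix s
    obtain e P Q where *: "e > 0" "P holomorphic_on ball s e" "Q holomorphic_on ball s e"
      "\<forall>x\<in>ball s e. v x = P x + cnj (Q x)" using loc by blast
    then show "\<exists>e>0. \<exists>k. k holomorphic_on ball s e \<and> (\<forall>x\<in>ball s e. Im (v x) = Re (k x))"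
      by (intro exI[of _ e] conjI exI[of _ "\<lambda>x. - \<i> * (P x - Q x)"]) (auto intro!: holomorphic_intros)
  next
    show "((\<lambda>x. Im (v x)) \<longlongrightarrow> Im L) at_infinity" by (intro tendsto_intros lim)
  qed
qed

section \<open>Argument principle, and fibres near the cusp\<close>

text \<open>The parameter occurs only in the kernel \<open>1 / (h - w)\<close>, whose denominator
  has no zero on the circle for |w| < \<mu>, so one differentiates under the integral. The density
  \<open>c\<close> will be \<open>A h'\<close>, or \<open>A h' / h\<close> for an \<open>A\<close>
  that may be singular inside the circle; continuity on the circle covers both.\<close>

lemma contour_integral_Cauchy_kernel_holomorphic:
  assumes c: "continuous_on (sphere z0 r) c" and h: "continuous_on (sphere z0 r) h" and r: "0 < r"
    and \<mu>: "\<And>z. z \<in> sphere z0 r \<Longrightarrow> norm (h z) \<ge> \<mu>"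
  shows "(\<lambda>w. contour_integral (circlepath z0 r) (\<lambda>x. c x / (h x - w))) holomorphic_on ball 0 \<mu>"
proof -
  let ?g = "circlepath z0 r"
  have img: "?g t \<in> sphere z0 r" for t
    using r by (simp add: circlepath dist_norm norm_mult)
  have cg: "continuous_on S ?g" for S unfolding circlepath by (intro continuous_intros)
  have cc: "continuous_on S (\<lambda>t. c (?g t))" for S
    by (rule continuous_on_compose2[OF c cg]) (use img in auto)
  have ch: "continuous_on S (\<lambda>t. h (?g t))" for S
    by (rule continuous_on_compose2[OF h cg]) (use img in auto)
  define d where "d = (\<lambda>t::real. c (?g t) * (2 * pi * \<i> * r * exp (2 * of_real pi * \<i> * t)))"
  have cd: "continuous_on S d" for S
    unfolding d_def by (intro continuous_intros cc)
  have nz: "h (?g t) - w \<noteq> 0" if "w \<in> ball 0 \<mu>" for t w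
    using \<mu>[OF img[of t]] that by auto
  have "(\<lambda>w. integral (cbox 0 1) (\<lambda>t. d t / (h (?g t) - w))) holomorphic_on ball 0 \<mu>"
  proof (rule leibniz_rule_holomorphic[where fx = "\<lambda>w t. d t / (h (?g t) - w)^2"])
    fix w t assume "w \<in> ball (0::complex) \<mu>" "t \<in> cbox (0::real) 1"
    then show "((\<lambda>w. d t / (h (?g t) - w)) has_field_derivative d t / (h (?g t) - w)\<^sup>2) (at w within ball 0 \<mu>)"
      using nz[of w t] by (auto intro!: derivative_eq_intros simp: power2_eq_square)
  next
    fix w :: complex assume "w \<in> ball 0 \<mu>"
    then show "(\<lambda>t. d t / (h (?g t) - w)) integrable_on cbox 0 1"
      using nz by (intro integrable_continuous continuous_intros cd ch) auto
  next
    show "continuous_on (ball 0 \<mu> \<times> cbox 0 1) (\<lambda>(w, t). d t / (h (?g t) - w)\<^sup>2)"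
      unfolding split_beta
      using nz by (intro continuous_intros continuous_on_compose2[OF cd[of UNIV]] continuous_on_compose2[OF ch[of UNIV]]) auto
  qed auto
  moreover have "contour_integral ?g (\<lambda>x. c x / (h x - w)) = integral (cbox 0 1) (\<lambda>t. d t / (h (?g t) - w))" for w
    unfolding contour_integral_integral d_def box_real
    by (intro integral_cong) (simp add: vector_derivative_circlepath mult_ac)
  ultimately show ?thesis by simp
qed

text \<open>The argument principle for \<open>h - w\<close> with weight \<open>A\<close>. The circle
  does not depend on \<open>w\<close>, so by the preceding lemma the fibre sum is holomorphic in
  \<open>w\<close>, also where points of the fibre collide.\<close>

lemma fibre_sum_eq_contour_integral:
  assumes h: "h holomorphic_on ball z0 R" and A: "A holomorphic_on ball z0 R" and r: "0 < r" "r < R"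
    and \<mu>: "\<And>z. z \<in> sphere z0 r \<Longrightarrow> norm (h z) \<ge> \<mu>" and w: "norm w < \<mu>"
  shows "finite {z \<in> ball z0 r. h z = w}" (is ?fin)
    and "(\<Sum>z | z \<in> ball z0 r \<and> h z = w. of_int (zorder (\<lambda>x. h x - w) z) * A z) =
         contour_integral (circlepath z0 r) (\<lambda>x. (A x * deriv h x) / (h x - w)) / (2 * pi * \<i>)" (is ?eq)
proof -
  \<comment> \<open>A radius strictly between \<open>r\<close> and \<open>R\<close>: the closed disc
    of radius \<open>R'\<close> is compact inside the domain, so infinitely many zeros there would
    accumulate and force \<open>h = w\<close> everywhere, against the lower bound on the
    circle.\<close>
  define R' where "R' = (r + R) / 2"
  have R': "r < R'" "R' < R" using r by (auto simp: R'_def)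
  define f where "f = (\<lambda>x. h x - w)"
  have fh: "f holomorphic_on ball z0 R" unfolding f_def by (intro holomorphic_intros h)
  have nz: "f z \<noteq> 0" if "z \<in> sphere z0 r" for z using \<mu>[OF that] w by (auto simp: f_def)
  have p: "z0 + of_real r \<in> sphere z0 r" using r by (simp add: dist_norm)
  have "finite {z \<in> cball z0 R'. f z = 0}"
  proof (rule ccontr)
    assume "infinite {z \<in> cball z0 R'. f z = 0}"
    then obtain l where l: "l \<in> cball z0 R'" "l islimpt {z \<in> cball z0 R'. f z = 0}"
      using compact_eq_Bolzano_Weierstrass[of "cball z0 R'"] by (metis (no_types, lifting) compact_cball mem_Collect_eq subsetI)
    have "f (z0 + of_real r) = 0"
      by (rule analytic_continuation[OF fh, of "{z \<in> cball z0 R'. f z = 0}" l])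
         (use l R' r in \<open>auto simp: dist_norm\<close>)
    then show False using nz[OF p] by simp
  qed
  then have fin': "finite {z \<in> ball z0 R'. f z = 0}" by (rule rev_finite_subset) auto
  then have "finite {z \<in> ball z0 r. f z = 0}" by (rule rev_finite_subset) (use R' in auto)
  then show ?fin by (simp add: f_def)
  have pz: "{w \<in> ball z0 R'. f w = 0 \<or> w \<in> {}} = {z \<in> ball z0 R'. f z = 0}" by auto
  have "contour_integral (circlepath z0 r) (\<lambda>x. deriv f x * A x / f x) = 2 * pi * \<i> *
          (\<Sum>p\<in>{w \<in> ball z0 R'. f w = 0 \<or> w \<in> {}}. winding_number (circlepath z0 r) p * A p * zorder f p)"
  proof (rule argument_principle)
    show "f holomorphic_on ball z0 R' - {}" using fh by (rule holomorphic_on_subset) (use R' in auto)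
    show "A holomorphic_on ball z0 R'" using A by (rule holomorphic_on_subset) (use R' in auto)
    show "path_image (circlepath z0 r) \<subseteq> ball z0 R' - {w \<in> ball z0 R'. f w = 0 \<or> w \<in> {}}"
      using r R' nz by auto
    show "\<forall>z. z \<notin> ball z0 R' \<longrightarrow> winding_number (circlepath z0 r) z = 0"
    proof (intro allI impI)
      fix z assume "z \<notin> ball z0 R'"
      then show "winding_number (circlepath z0 r) z = 0"
        by (intro winding_number_zero_outside[where s = "cball z0 r"]) (use r R' in auto)
    qed
  qed (use fin' pz in auto)
  also have "(\<Sum>p\<in>{w \<in> ball z0 R'. f w = 0 \<or> w \<in> {}}. winding_number (circlepath z0 r) p * A p * zorder f p) =
       (\<Sum>p\<in>{z \<in> ball z0 r. f z = 0}. of_int (zorder f p) * A p)"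
  proof (rule sum.mono_neutral_cong_right)
    show "\<forall>i\<in>{w \<in> ball z0 R'. f w = 0 \<or> w \<in> {}} - {z \<in> ball z0 r. f z = 0}.
             winding_number (circlepath z0 r) i * A i * zorder f i = 0"
    proof
      fix i assume i: "i \<in> {w \<in> ball z0 R'. f w = 0 \<or> w \<in> {}} - {z \<in> ball z0 r. f z = 0}"
      then have "i \<notin> cball z0 r" using nz[of i] by auto
      then have "winding_number (circlepath z0 r) i = 0"
        by (intro winding_number_zero_outside[where s = "cball z0 r"]) (use r in auto)
      then show "winding_number (circlepath z0 r) i * A i * zorder f i = 0" by simp
    qed
    show "winding_number (circlepath z0 r) x * A x * zorder f x = of_int (zorder f x) * A x"
      if "x \<in> {z \<in> ball z0 r. f z = 0}" for x
      using that winding_number_circlepath[of x z0 r] by (simp add: dist_norm norm_minus_commute)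
  qed (use fin' pz R' in auto)
  also have "contour_integral (circlepath z0 r) (\<lambda>x. deriv f x * A x / f x) =
     contour_integral (circlepath z0 r) (\<lambda>x. (A x * deriv h x) / (h x - w))"
  proof (rule contour_integral_cong)
    fix x assume x: "x \<in> path_image (circlepath z0 r)"
    have "h field_differentiable at x"
      using h x r by (intro holomorphic_on_imp_differentiable_at[OF h]) (auto simp: dist_norm)
    then have "deriv f x = deriv h x" unfolding f_def by simp
    then show "deriv f x * A x / f x = A x * deriv h x / (h x - w)" by (simp add: f_def)
  qed auto
  finally show ?eq by (simp add: f_def field_simps)
qed

text \<open>
  The function \<open>A h\<^sup>m\<close> has no pole at 0, and on the fibre above \<open>w\<close> the factor \<open>h\<^sup>m\<close> is the constant
  \<open>w\<^sup>m\<close>. Expanding \<open>1 / (h - w)\<close> as a finite geometric sum in the resulting contour integral gives the residues.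
\<close>

lemma punctured_fibre_sum_tendsto:
  fixes H Fp :: "complex fls" and R r :: real
  defines "h \<equiv> eval_fls H" and "A \<equiv> eval_fls Fp"
  defines "Rs \<equiv> \<lambda>i. fls_residue (Fp * H ^ i * fls_deriv H / H)"
  assumes rad: "fls_conv_radius H \<ge> ereal R" "fls_conv_radius Fp \<ge> ereal R" and r: "0 < r" "r < R"
    and H: "fls_subdegree H \<ge> 1" and nz: "\<And>z. z \<noteq> 0 \<Longrightarrow> norm z < R \<Longrightarrow> h z \<noteq> 0"
    and Fp: "\<And>n. n \<le> - int m \<Longrightarrow> fls_nth Fp n = 0"
  shows "((\<lambda>s. (\<Sum>q | q \<in> ball 0 r - {0} \<and> h q = inverse s. of_int (zorder (\<lambda>x. h x - inverse s) q) * A q)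
            - (\<Sum>i=1..m. Rs i * s ^ i)) \<longlongrightarrow> Rs 0) at_infinity"
proof -
  have H0: "H \<noteq> 0" using H by auto
  have hol_h: "h holomorphic_on ball 0 R"
    unfolding h_def using rad H by (intro holomorphic_on_eval_fls) (auto intro!: less_le_trans[OF _ rad(1)])
  define B where "B = eval_fls (Fp * H ^ m)"
  have sdB: "fls_subdegree (Fp * H ^ m) \<ge> 0"
  proof (cases "Fp = 0")
    case False
    have "fls_subdegree Fp \<ge> 1 - int m"
      by (rule fls_subdegree_geI[OF False]) (use Fp in auto)
    moreover have "int m * fls_subdegree H \<ge> int m * 1" by (rule mult_left_mono) (use H in auto)
    ultimately show ?thesis using False H0 by (simp add: fls_subdegree_pow)
  qed auto
  have radHm: "fls_conv_radius (H ^ m) \<ge> ereal R"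
    using rad(1) fls_conv_radius_power[of H m] by (rule order_trans)
  have hol_B: "B holomorphic_on ball 0 R"
    unfolding B_def using sdB
    by (intro holomorphic_on_eval_fls) (auto intro!: less_le_trans[OF _ fls_conv_radius_mult_ge[OF rad(2) radHm]])
  have Beq: "B z = A z * h z ^ m" if "z \<noteq> 0" "norm z < R" for z
  proof -
    have l: "ereal (norm z) < ereal R" using that by simp
    have "ereal (norm z) < fls_conv_radius H" "ereal (norm z) < fls_conv_radius Fp"
      "ereal (norm z) < fls_conv_radius (H ^ m)"
      by (rule less_le_trans[OF l rad(1)] less_le_trans[OF l rad(2)] less_le_trans[OF l radHm])+
    then show ?thesis unfolding B_def A_def h_def using that
      by (simp add: eval_fls_mult eval_fls_power)
  qed
  have hol_A: "A holomorphic_on ball 0 R - {0}"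
    unfolding A_def using rad by (intro holomorphic_on_eval_fls) (auto intro!: less_le_trans[OF _ rad(2)])
  have h0: "h 0 = 0" unfolding h_def eval_fls_at_0 using H by auto
  let ?g = "circlepath 0 r"
  obtain \<mu> where \<mu>: "\<mu> > 0" "\<And>z. z \<in> sphere 0 r \<Longrightarrow> norm (h z) \<ge> \<mu>"
  proof -
    have "compact (sphere (0::complex) r)" "sphere (0::complex) r \<noteq> {}" using r by auto
    moreover have "continuous_on (sphere 0 r) (\<lambda>z. norm (h z))"
      by (intro continuous_intros holomorphic_on_imp_continuous_on holomorphic_on_subset[OF hol_h]) (use r in auto)
    ultimately obtain z where z: "z \<in> sphere 0 r" "\<And>y. y \<in> sphere 0 r \<Longrightarrow> norm (h z) \<le> norm (h y)"
      using continuous_attains_inf by metis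
    show ?thesis by (rule that[of "norm (h z)"]) (use z nz[of z] r in auto)
  qed
  \<comment> \<open>The remainder of the geometric sum. Its density \<open>A h' / h\<close> is
    continuous on the circle whatever the pole of \<open>A\<close> at 0, so \<open>E\<close> is
    holomorphic near 0 and \<open>w * E w\<close> vanishes in the limit.\<close>
  define E where "E = (\<lambda>w. contour_integral ?g (\<lambda>x. (A x * deriv h x / h x) / (h x - w)) / (2 * pi * \<i>))"
  have dh: "deriv h holomorphic_on ball 0 R" by (intro holomorphic_intros hol_h) auto
  have sub: "sphere 0 r \<subseteq> ball 0 R - {0::complex}" using r by auto
  have cA: "continuous_on (sphere 0 r) A" "continuous_on (sphere 0 r) h" "continuous_on (sphere 0 r) (deriv h)"
    using hol_A hol_h dh sub
    by (meson continuous_on_subset holomorphic_on_imp_continuous_on Diff_subset subset_trans)+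
  have hnz: "h x \<noteq> 0" if "x \<in> sphere 0 r" for x using \<mu>(2)[OF that] \<mu>(1) by auto
  have holE: "E holomorphic_on ball 0 \<mu>"
    unfolding E_def by (intro holomorphic_intros contour_integral_Cauchy_kernel_holomorphic continuous_intros cA)
      (use r \<mu> hnz in auto)
  have Rs: "contour_integral ?g (\<lambda>x. A x * h x ^ i * deriv h x / h x) / (2 * pi * \<i>) = Rs i" for i
  proof -
    let ?F = "\<lambda>x. A x * h x ^ i * deriv h x / h x"
    have "(?F has_contour_integral 2 * pi * \<i> * residue ?F 0) ?g"
      by (rule base_residue[where s = "ball 0 R"])
         (use r nz in \<open>auto intro!: holomorphic_intros hol_A holomorphic_on_subset[OF hol_h] holomorphic_on_subset[OF dh]\<close>)
    then have "contour_integral ?g ?F = 2 * pi * \<i> * residue ?F 0" by (rule contour_integral_unique)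
    also have "residue ?F 0 = Rs i"
    proof -
      have "0 < ereal R" using r by simp
      from less_le_trans[OF this rad(1)] less_le_trans[OF this rad(2)]
      have "h has_laurent_expansion H" "A has_laurent_expansion Fp"
        by (auto simp: h_def A_def intro: laurent_expansion_intros)
      then have "?F has_laurent_expansion (Fp * H ^ i * fls_deriv H / H)"
        by (intro laurent_expansion_intros)
      then show ?thesis unfolding Rs_def by (rule has_laurent_expansion_residue_0)
    qed
    finally show ?thesis by simp
  qed
  \<comment> \<open>Dividing by \<open>w ^ m\<close> turns the powers \<open>w ^ (m - i)\<close>
    into \<open>inverse w ^ i\<close>, that is \<open>s ^ i\<close>, and the factor
    \<open>w ^ Suc m\<close> of the remainder into \<open>w\<close>.\<close>
  have key: "(\<Sum>q | q \<in> ball 0 r - {0} \<and> h q = w. of_int (zorder (\<lambda>x. h x - w) q) * A q) =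
      (\<Sum>i\<le>m. Rs i * inverse w ^ i) + w * E w" if w: "w \<noteq> 0" "norm w < \<mu>" for w
  proof -
    have "(\<Sum>q | q \<in> ball 0 r - {0} \<and> h q = w. of_int (zorder (\<lambda>x. h x - w) q) * A q) * w ^ m =
      (\<Sum>q | q \<in> ball 0 r \<and> h q = w. of_int (zorder (\<lambda>x. h x - w) q) * B q)"
      unfolding sum_distrib_right
    proof (rule sum.cong)
      fix q assume "q \<in> {q. q \<in> ball 0 r \<and> h q = w}"
      then have "q \<noteq> 0" "norm q < R" "h q = w" using h0 w r by auto
      then show "of_int (zorder (\<lambda>x. h x - w) q) * A q * w ^ m = of_int (zorder (\<lambda>x. h x - w) q) * B q"
        using Beq[of q] by simp
    qed (use h0 w in auto)
    also have "\<dots> = contour_integral ?g (\<lambda>x. (B x * deriv h x) / (h x - w)) / (2 * pi * \<i>)"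
      by (rule fibre_sum_eq_contour_integral(2)[OF hol_h hol_B r \<mu>(2) w(2)])
    also have "contour_integral ?g (\<lambda>x. (B x * deriv h x) / (h x - w)) =
        contour_integral ?g (\<lambda>x. (\<Sum>j\<le>m. w ^ j * (A x * h x ^ (m - j) * deriv h x / h x))
            + w ^ Suc m * ((A x * deriv h x / h x) / (h x - w)))"
    proof (rule contour_integral_cong)
      fix x assume "x \<in> path_image ?g"
      then have x: "x \<in> sphere 0 r" using r by simp
      then have x0: "x \<noteq> 0" "norm x < R" using r by auto
      have nw: "h x \<noteq> w" using \<mu>(2)[OF x] w by auto
      have *: "(\<Sum>j\<le>m. w ^ j * h x ^ (m - j)) * (h x - w) = h x ^ Suc m - w ^ Suc m"
        using power_diff_sumr2[of w "Suc m" "h x"] by (simp add: lessThan_Suc_atMost algebra_simps)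
      have "h x ^ Suc m / (h x - w) = (\<Sum>j\<le>m. w ^ j * h x ^ (m - j)) + w ^ Suc m / (h x - w)"
        using * nw by (simp add: field_simps)
      then have "(A x * deriv h x / h x) * (h x ^ Suc m / (h x - w)) =
         (A x * deriv h x / h x) * ((\<Sum>j\<le>m. w ^ j * h x ^ (m - j)) + w ^ Suc m / (h x - w))"
        by simp
      then show "B x * deriv h x / (h x - w) = (\<Sum>j\<le>m. w ^ j * (A x * h x ^ (m - j) * deriv h x / h x))
            + w ^ Suc m * ((A x * deriv h x / h x) / (h x - w))"
        using Beq[OF x0] hnz[OF x] by (simp add: sum_distrib_left distrib_left mult_ac)
    qed simp
    also have "\<dots> = (\<Sum>j\<le>m. w ^ j * contour_integral ?g (\<lambda>x. A x * h x ^ (m - j) * deriv h x / h x))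
            + w ^ Suc m * contour_integral ?g (\<lambda>x. (A x * deriv h x / h x) / (h x - w))"
    proof -
      have i1: "(\<lambda>x. A x * h x ^ (m - j) * deriv h x / h x) contour_integrable_on ?g" for j
        by (intro contour_integrable_continuous_circlepath continuous_intros) (use cA r hnz in auto)
      have i2: "(\<lambda>x. (A x * deriv h x / h x) / (h x - w)) contour_integrable_on ?g"
        by (intro contour_integrable_continuous_circlepath continuous_intros) (use cA r hnz \<mu> w in force)+
      show ?thesis
        by (subst contour_integral_add contour_integral_sum contour_integral_lmul;
            (intro contour_integrable_sum contour_integrable_lmul i1 i2 finite_atMost)?)+ simp
    qed
    also have "\<dots> / (2 * pi * \<i>) = (\<Sum>j\<le>m. w ^ j * Rs (m - j)) + w ^ Suc m * E w"
      unfolding Rs[symmetric] E_def by (simp add: add_divide_distrib sum_divide_distrib)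
    also have "(\<Sum>j\<le>m. w ^ j * Rs (m - j)) = (\<Sum>i\<le>m. w ^ (m - i) * Rs i)"
      by (subst sum.nat_diff_reindex[symmetric, where n = "Suc m", unfolded lessThan_Suc_atMost]) (auto intro: sum.cong)
    also have "\<dots> = w ^ m * (\<Sum>i\<le>m. Rs i * inverse w ^ i)"
      unfolding sum_distrib_left using w(1)
      by (intro sum.cong) (auto simp: power_diff field_simps)
    finally have "(\<Sum>q | q \<in> ball 0 r - {0} \<and> h q = w. of_int (zorder (\<lambda>x. h x - w) q) * A q) * w ^ m =
       ((\<Sum>i\<le>m. Rs i * inverse w ^ i) + w * E w) * w ^ m" by (simp add: algebra_simps)
    then show ?thesis using w(1) by simp
  qed
  have "(E \<longlongrightarrow> E 0) (at 0)"
    using holomorphic_on_imp_continuous_on[OF holE] \<mu>(1)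
    by (simp add: continuous_on_eq_continuous_at isCont_def)
  moreover have inf: "filterlim inverse (at 0) (at_infinity :: complex filter)"
    using filterlim_inverse_at_iff[of "\<lambda>x::complex. x" at_infinity] by (simp add: filterlim_ident)
  ultimately have "((\<lambda>s. E (inverse s)) \<longlongrightarrow> E 0) at_infinity"
    by (rule filterlim_compose)
  then have "((\<lambda>s. inverse s * E (inverse s)) \<longlongrightarrow> 0 * E 0) at_infinity"
    by (intro tendsto_mult tendsto_inverse_0)
  then have lim: "((\<lambda>s. Rs 0 + inverse s * E (inverse s)) \<longlongrightarrow> Rs 0) at_infinity"
    using tendsto_add[OF tendsto_const[of "Rs 0"]] by fastforce
  have ev: "eventually (\<lambda>s::complex. s \<noteq> 0 \<and> norm (inverse s) < \<mu>) at_infinity"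
  proof -
    have "eventually (\<lambda>w. w \<in> ball 0 \<mu> - {0}) (at (0::complex))"
      using eventually_at_ball'[OF \<mu>(1), of 0 UNIV] by eventually_elim simp
    then have "eventually (\<lambda>s. inverse s \<in> ball 0 \<mu> - {0::complex}) at_infinity"
      using filterlim_iff[THEN iffD1, OF inf] by blast
    then show ?thesis by eventually_elim auto
  qed
  show ?thesis
  proof (rule Lim_transform_eventually[OF lim])
    show "\<forall>\<^sub>F s in at_infinity. Rs 0 + inverse s * E (inverse s) =
       (\<Sum>q | q \<in> ball 0 r - {0} \<and> h q = inverse s. of_int (zorder (\<lambda>x. h x - inverse s) q) * A q)
            - (\<Sum>i=1..m. Rs i * s ^ i)"
      using ev
    proof eventually_elim
      case (elim s)
      have "(\<Sum>i\<le>m. Rs i * s ^ i) = Rs 0 + (\<Sum>i=1..m. Rs i * s ^ i)"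
        by (simp add: atMost_atLeast0 sum.atLeast_Suc_atMost)
      then show ?case using key[of "inverse s"] elim by simp
    qed
  qed
qed

section \<open>Residues at the cusp\<close>

text \<open>Write \<open>H = q^k U\<close> with a unit \<open>U\<close>, so that
  \<open>H' / H = k / q + U' / U\<close>. The first term contributes \<open>k\<close> times the
  constant coefficient of \<open>F^+\<close>, which is 0. By the gap \<open>U'\<close> has order at
  least \<open>m - 1\<close>, while \<open>F^+\<close> has order at least \<open>1 - m\<close>, so
  the second product is regular. This is where the vanishing conditions on \<open>F^+\<close> meet
  the congruence \<open>1 + O(q^m)\<close>.\<close>

lemma fls_residue_log_deriv_eq_0:
  fixes H Fp :: "complex fls"
  assumes Fp: "\<And>n. n \<le> - int m \<Longrightarrow> fls_nth Fp n = 0" "fls_nth Fp 0 = 0" and H: "H \<noteq> 0"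
    and gap: "\<And>j. 0 < j \<Longrightarrow> j < int m \<Longrightarrow> fls_nth H (fls_subdegree H + j) = 0"
  shows "fls_residue (Fp * fls_deriv H / H) = 0"
proof -
  define k where "k = fls_subdegree H"
  define U where "U = fls_shift k H"
  have U0: "U \<noteq> 0" "fls_subdegree U = 0" using H by (auto simp: U_def k_def fls_shift_eq0_iff)
  define X where "X = (fls_X_intpow k :: complex fls)"
  define J where "J = (fls_X_intpow (-1) :: complex fls)"
  have HU: "H = X * U" by (simp add: U_def X_def fls_X_intpow_times_conv_shift)
  have X0: "X \<noteq> 0" by (simp add: X_def)
  have "fls_deriv X = of_int k * fls_X_intpow (- 1 + k)"
    unfolding X_def by (subst fls_deriv_X_intpow) (simp add: add.commute)
  also have "fls_X_intpow (- 1 + k) = J * X"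
    unfolding J_def X_def by (rule fls_X_intpow_times_fls_X_intpow[symmetric])
  finally have "fls_deriv H = of_int k * (J * X) * U + X * fls_deriv U"
    unfolding HU by simp
  then have "Fp * fls_deriv H / H = of_int k * (Fp * J) + Fp * (fls_deriv U / U)"
    unfolding HU using U0 X0 by (simp add: field_simps)
  then have "fls_residue (Fp * fls_deriv H / H) = of_int k * fls_residue (Fp * J) +
     fls_residue (Fp * (fls_deriv U / U))"
    by (simp only: fls_residue_add fls_residue_of_int_times)
  also have "fls_residue (Fp * J) = 0"
    using Fp(2) by (simp add: J_def fls_X_intpow_times_conv_shift fls_shifted_times_simps)
  also have "fls_residue (Fp * (fls_deriv U / U)) = 0"
  proof (cases "Fp = 0 \<or> fls_deriv U = 0")
    case False
    have "fls_subdegree Fp \<ge> 1 - int m" by (rule fls_subdegree_geI) (use Fp False in auto)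
    moreover have "fls_subdegree Fp \<ge> 1" if "m = 0"
      by (rule fls_subdegree_geI) (use Fp False that in auto)
    moreover have "fls_subdegree (fls_deriv U) \<ge> 0" by (rule fls_deriv_subdegree0) (rule U0)
    moreover have "fls_subdegree (fls_deriv U) \<ge> int m - 1"
    proof (rule fls_subdegree_geI)
      fix j assume "j < int m - 1"
      show "fls_nth (fls_deriv U) j = 0"
      proof (cases "j + 1 > 0")
        case True then show ?thesis using gap[of "j + 1"] \<open>j < int m - 1\<close> by (simp add: U_def k_def add_ac)
      next
        \<comment> \<open>At \<open>j = -1\<close> the factor \<open>j + 1\<close> of the derivative
          vanishes; for smaller \<open>j\<close> the coefficient of \<open>U\<close> itself
          does.\<close>
        case False then show ?thesis using U0 by (cases "j = -1") auto
      qed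
    qed (use False in auto)
    ultimately have "fls_subdegree (Fp * (fls_deriv U / U)) \<ge> 0"
      using False U0 by (cases "m = 0") (auto simp: fls_divide_subdegree)
    then show ?thesis by (rule fls_residue_power_series)
  qed auto
  finally show ?thesis by simp
qed

text \<open>\<open>H^i H' / H\<close> has order at least \<open>i * ord H - 1 >= m - 1\<close>,
  which absorbs the pole of \<open>F^+\<close>. This serves \<open>h = f - f(\<infinity>)\<close>,
  which vanishes at the cusp to order at least \<open>m\<close>.\<close>

lemma fls_residue_power_deriv_eq_0:
  fixes H Fp :: "complex fls"
  assumes Fp: "\<And>n. n \<le> - int m \<Longrightarrow> fls_nth Fp n = 0"
    and H: "fls_subdegree H \<ge> 1" "fls_subdegree H \<ge> int m" and i: "i \<ge> 1"
  shows "fls_residue (Fp * H ^ i * fls_deriv H / H) = 0"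
proof (cases "Fp = 0")
  case False
  have H0: "H \<noteq> 0" using H by auto
  have "fls_subdegree Fp \<ge> 1 - int m" by (rule fls_subdegree_geI) (use Fp False in auto)
  moreover have "fls_subdegree (fls_deriv H) = fls_subdegree H - 1"
    by (rule fls_subdegree_deriv) (use H in auto)
  moreover have "int i * fls_subdegree H \<ge> 1 * fls_subdegree H"
    by (rule mult_right_mono) (use i H in auto)
  ultimately have "fls_subdegree (Fp * H ^ i * fls_deriv H / H) \<ge> 0"
    using False H0 H(2) by (cases "fls_deriv H = 0") (simp_all add: fls_divide_subdegree fls_subdegree_pow)
  then show ?thesis by (rule fls_residue_power_series)
qed auto

section \<open>The group generated by Gamma0(p) and the Fricke involution\<close>

lemma matrix_mult_2:
  fixes A B :: "real^2^2"
  shows "(A ** B) $ i $ j = A$i$1 * B$1$j + A$i$2 * B$2$j"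
  by (simp add: matrix_matrix_mult_def sum_2)

lemma matrix_eq_2_iff:
  fixes A B :: "'a^2^2"
  shows "A = B \<longleftrightarrow> A$1$1 = B$1$1 \<and> A$1$2 = B$1$2 \<and> A$2$1 = B$2$1 \<and> A$2$2 = B$2$2"
  by (simp only: vec_eq_iff forall_2 conj_assoc)

lemma mat_1_entries: "(mat 1 :: real^2^2) $ 1 $ 1 = 1" "(mat 1 :: real^2^2) $ 1 $ 2 = 0"
    "(mat 1 :: real^2^2) $ 2 $ 1 = 0" "(mat 1 :: real^2^2) $ 2 $ 2 = 1"
  by (auto simp: mat_def)

definition mat2 :: "'a \<Rightarrow> 'a \<Rightarrow> 'a \<Rightarrow> 'a \<Rightarrow> 'a::zero^2^2" where
  "mat2 a b c d = vector [vector [a, b], vector [c, d]]"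

lemma mat2_entries [simp]:
  "mat2 a b c d $ 1 $ 1 = a" "mat2 a b c d $ 1 $ 2 = b" "mat2 a b c d $ 2 $ 1 = c" "mat2 a b c d $ 2 $ 2 = d"
  by (simp_all add: mat2_def vector_2)

definition adj2 :: "real^2^2 \<Rightarrow> real^2^2" where
  "adj2 A = mat2 (A$2$2) (- A$1$2) (- A$2$1) (A$1$1)"

lemma adj2_mult: "det A = 1 \<Longrightarrow> adj2 A ** A = mat 1" "det A = 1 \<Longrightarrow> A ** adj2 A = mat 1"
  by (auto simp: matrix_eq_2_iff matrix_mult_2 adj2_def det_2 mat_1_entries mult.commute)

lemma det_adj2: "det (adj2 A) = det A"
  by (simp add: adj2_def det_2 mult.commute)

lemma group_SL2R: "group SL2R"
proof (rule groupI)
  fix x assume "x \<in> carrier SL2R"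
  then show "\<exists>y\<in>carrier SL2R. y \<otimes>\<^bsub>SL2R\<^esub> x = \<one>\<^bsub>SL2R\<^esub>"
    by (intro bexI[of _ "adj2 x"]) (auto simp: SL2R_def adj2_mult det_adj2)
qed (auto simp: SL2R_def det_mul matrix_mul_assoc det_I)

lemma inv_SL2R: "det A = 1 \<Longrightarrow> inv\<^bsub>SL2R\<^esub> A = adj2 A"
  by (rule group.inv_equality[OF group_SL2R]) (auto simp: SL2R_def adj2_mult det_adj2)

lemma Gamma0_iff:
  "A \<in> Gamma0 p \<longleftrightarrow> det A = 1 \<and> (\<exists>a b c d :: int. A = mat2 (of_int a) (of_int b) (real p * of_int c) (of_int d))"
proof
  assume A: "A \<in> Gamma0 p"
  then have "A$1$1 \<in> \<int>" "A$1$2 \<in> \<int>" "A$2$2 \<in> \<int>" "\<exists>k\<in>\<int>. A$2$1 = real p * k" "det A = 1" by (auto simp: Gamma0_def)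
  then show "det A = 1 \<and> (\<exists>a b c d :: int. A = mat2 (of_int a) (of_int b) (real p * of_int c) (of_int d))"
    by (force elim!: Ints_cases simp: matrix_eq_2_iff)
qed (auto simp: Gamma0_def forall_2)

text \<open>The coset of the Fricke involution, that is all products of \<open>fricke p\<close> with
  elements of \<open>Gamma0 p\<close>, written out so that the integrality of the entries is
  visible. For \<open>p = 1\<close> it coincides with \<open>Gamma0 1\<close>.\<close>

definition fricke_coset :: "nat \<Rightarrow> (real^2^2) set" where
  "fricke_coset p = {A. det A = 1 \<and> (\<exists>a b c d :: int.
     A = mat2 (sqrt p * of_int a) (of_int b / sqrt p) (sqrt p * of_int c) (sqrt p * of_int d))}"

lemma Gamma0_I: "A = mat2 (of_int a) (of_int b) (real p * of_int c) (of_int d) \<Longrightarrow> det A = 1 \<Longrightarrow> A \<in> Gamma0 p"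
  unfolding Gamma0_iff by blast

lemma fricke_coset_I:
  "A = mat2 (sqrt p * of_int a) (of_int b / sqrt p) (sqrt p * of_int c) (sqrt p * of_int d) \<Longrightarrow> det A = 1 \<Longrightarrow>
    A \<in> fricke_coset p"
  unfolding fricke_coset_def by blast

lemma mat2_mult: "mat2 a b c d ** mat2 a' b' c' d' =
    mat2 (a * a' + b * c') (a * b' + b * d') (c * a' + d * c') (c * b' + d * d' :: real)"
  by (simp add: matrix_eq_2_iff matrix_mult_2)

context
  fixes p :: nat
  assumes p: "p > 0"
begin

text \<open>The two sets behave like a grading modulo 2: the square roots of \<open>p\<close> in two
  factors from the coset combine, so their product lies in \<open>Gamma0 p\<close>. Only the shape
  of the entries is at stake, the determinant being multiplicative.\<close>

lemma Gamma0star_product_closed: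
  assumes "A \<in> Gamma0 p \<union> fricke_coset p" "B \<in> Gamma0 p \<union> fricke_coset p"
  shows "A ** B \<in> Gamma0 p \<union> fricke_coset p"
proof -
  have dt: "det (A ** B) = 1" using assms by (auto simp: det_mul Gamma0_iff fricke_coset_def)
  have sp: "sqrt p * sqrt p = p" "sqrt p > 0" using p by auto
  have cancel: "x * sqrt p * (y / sqrt p) = x * y" "y / sqrt p * (x * sqrt p) = x * y"
    "real p * x / sqrt p = sqrt p * x" "sqrt p * (y / sqrt p) = y" for x y :: real
    using sp by (auto simp: field_simps)
  consider (1) "A \<in> Gamma0 p" "B \<in> Gamma0 p" | (2) "A \<in> Gamma0 p" "B \<in> fricke_coset p"
    | (3) "A \<in> fricke_coset p" "B \<in> Gamma0 p" | (4) "A \<in> fricke_coset p" "B \<in> fricke_coset p"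
    using assms by blast
  then show ?thesis
  proof cases
    case 1
    then obtain a b c d a' b' c' d' :: int where
      *: "A = mat2 (of_int a) (of_int b) (real p * of_int c) (of_int d)"
      "B = mat2 (of_int a') (of_int b') (real p * of_int c') (of_int d')" unfolding Gamma0_iff by blast
    have "A ** B = mat2 (of_int (a * a' + int p * b * c')) (of_int (a * b' + b * d'))
        (real p * of_int (c * a' + d * c')) (of_int (int p * c * b' + d * d'))"
      unfolding * mat2_mult by (simp add: algebra_simps)
    with dt show ?thesis by (blast intro: Gamma0_I)
  next
    case 2
    then obtain a b c d a' b' c' d' :: int where
      *: "A = mat2 (of_int a) (of_int b) (real p * of_int c) (of_int d)"
      "B = mat2 (sqrt p * of_int a') (of_int b' / sqrt p) (sqrt p * of_int c') (sqrt p * of_int d')"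
      unfolding Gamma0_iff fricke_coset_def by blast
    have "A ** B = mat2 (sqrt p * of_int (a * a' + b * c')) (of_int (a * b' + int p * b * d') / sqrt p)
        (sqrt p * of_int (int p * c * a' + d * c')) (sqrt p * of_int (c * b' + d * d'))"
      unfolding * mat2_mult using sp by (simp add: matrix_eq_2_iff field_simps)
    with dt show ?thesis by (blast intro: fricke_coset_I)
  next
    case 3
    then obtain a b c d a' b' c' d' :: int where
      *: "B = mat2 (of_int a') (of_int b') (real p * of_int c') (of_int d')"
      "A = mat2 (sqrt p * of_int a) (of_int b / sqrt p) (sqrt p * of_int c) (sqrt p * of_int d)"
      unfolding Gamma0_iff fricke_coset_def by blast
    have "A ** B = mat2 (sqrt p * of_int (a * a' + b * c')) (of_int (int p * a * b' + b * d') / sqrt p)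
        (sqrt p * of_int (c * a' + int p * d * c')) (sqrt p * of_int (c * b' + d * d'))"
      unfolding * mat2_mult using sp by (simp add: matrix_eq_2_iff field_simps)
    with dt show ?thesis by (blast intro: fricke_coset_I)
  next
    case 4
    then obtain a b c d a' b' c' d' :: int where
      *: "A = mat2 (sqrt p * of_int a) (of_int b / sqrt p) (sqrt p * of_int c) (sqrt p * of_int d)"
      "B = mat2 (sqrt p * of_int a') (of_int b' / sqrt p) (sqrt p * of_int c') (sqrt p * of_int d')"
      unfolding fricke_coset_def by blast
    have "A ** B = mat2 (of_int (int p * a * a' + b * c')) (of_int (a * b' + b * d'))
        (real p * of_int (c * a' + d * c')) (of_int (c * b' + int p * d * d'))"
      unfolding * mat2_mult using sp by (simp add: matrix_eq_2_iff field_simps)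
    with dt show ?thesis by (blast intro: Gamma0_I)
  qed
qed

lemma Gamma0star_adj2_closed:
  assumes "A \<in> Gamma0 p \<union> fricke_coset p"
  shows "adj2 A \<in> Gamma0 p \<union> fricke_coset p"
  using assms
proof
  assume A: "A \<in> Gamma0 p"
  then obtain a b c d :: int where
    *: "A = mat2 (of_int a) (of_int b) (real p * of_int c) (of_int d)" unfolding Gamma0_iff by blast
  have "adj2 A = mat2 (of_int d) (of_int (- b)) (real p * of_int (- c)) (of_int a)"
    by (simp add: adj2_def *)
  moreover have "det (adj2 A) = 1" using A by (simp add: det_adj2 Gamma0_iff)
  ultimately show ?thesis by (blast intro: Gamma0_I)
next
  assume A: "A \<in> fricke_coset p"
  then obtain a b c d :: int where
    *: "A = mat2 (sqrt p * of_int a) (of_int b / sqrt p) (sqrt p * of_int c) (sqrt p * of_int d)"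
    unfolding fricke_coset_def by blast
  have "adj2 A = mat2 (sqrt p * of_int d) (of_int (- b) / sqrt p) (sqrt p * of_int (- c)) (sqrt p * of_int a)"
    by (simp add: adj2_def *)
  moreover have "det (adj2 A) = 1" using A by (simp add: det_adj2 fricke_coset_def)
  ultimately show ?thesis by (blast intro: fricke_coset_I)
qed

lemma fricke_eq: "fricke p = mat2 0 (- 1 / sqrt p) (sqrt p) 0"
  by (simp add: fricke_def mat2_def)

lemma fricke_mem: "fricke p \<in> fricke_coset p"
proof -
  have "fricke p = mat2 (sqrt p * of_int 0) (of_int (-1) / sqrt p) (sqrt p * of_int 1) (sqrt p * of_int 0)"
    by (simp add: fricke_eq)
  moreover have "det (fricke p) = 1" using p by (simp add: fricke_eq det_2)
  ultimately show ?thesis by (blast intro: fricke_coset_I)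
qed

text \<open>The right-hand side is closed under products and inverses, so it contains the generated
  group. All later estimates on matrix entries rest on this explicit form.\<close>

lemma Gamma0star_eq: "Gamma0star p = Gamma0 p \<union> fricke_coset p"
proof (intro equalityI subsetI)
  fix A assume "A \<in> Gamma0star p"
  then show "A \<in> Gamma0 p \<union> fricke_coset p"
    unfolding Gamma0star_def
  proof (induction rule: generate.induct)
    case one
    have "(mat 1 :: real^2^2) = mat2 (of_int 1) (of_int 0) (real p * of_int 0) (of_int 1)"
      by (simp add: matrix_eq_2_iff mat_1_entries)
    moreover have "det (mat 1 :: real^2^2) = 1" by simp
    ultimately have "mat 1 \<in> Gamma0 p" by (rule Gamma0_I)
    then show ?case by (simp add: SL2R_def)
  next
    case (incl h) then show ?case using fricke_mem by auto
  next
    case (inv h)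
    then have "h \<in> Gamma0 p \<union> fricke_coset p" using fricke_mem by auto
    moreover from this have "det h = 1" by (auto simp: Gamma0_iff fricke_coset_def)
    ultimately show ?case using Gamma0star_adj2_closed by (simp add: inv_SL2R)
  next
    case (eng h1 h2) then show ?case using Gamma0star_product_closed by (simp add: SL2R_def)
  qed
next
  fix A assume "A \<in> Gamma0 p \<union> fricke_coset p"
  then show "A \<in> Gamma0star p"
  proof
    assume A: "A \<in> fricke_coset p"
    then obtain a b c d :: int where
      *: "A = mat2 (sqrt p * of_int a) (of_int b / sqrt p) (sqrt p * of_int c) (sqrt p * of_int d)"
      unfolding fricke_coset_def by blast
    \<comment> \<open>This is the inverse of the Fricke matrix times \<open>A\<close>.\<close>
    define B where "B = mat2 (of_int c) (of_int d) (real p * of_int (- a)) (of_int (- b))"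
    have "det B = 1" using A p unfolding fricke_coset_def by (simp add: B_def * det_2 field_simps)
    with B_def have B: "B \<in> Gamma0 p" by (rule Gamma0_I)
    have "A = fricke p ** B"
      unfolding fricke_eq B_def * mat2_mult using p by (simp add: matrix_eq_2_iff field_simps)
    moreover have "fricke p ** B \<in> Gamma0star p"
      using generate.eng[of "fricke p" SL2R "Gamma0 p \<union> {fricke p}" B] B unfolding Gamma0star_def
      by (auto intro: generate.incl simp: SL2R_def)
    ultimately show ?thesis by simp
  qed (auto simp: Gamma0star_def intro: generate.incl)
qed

lemma Gamma0star_mult: "A \<in> Gamma0star p \<Longrightarrow> B \<in> Gamma0star p \<Longrightarrow> A ** B \<in> Gamma0star p"
  using Gamma0star_product_closed by (simp add: Gamma0star_eq)

lemma Gamma0star_adj2: "A \<in> Gamma0star p \<Longrightarrow> adj2 A \<in> Gamma0star p"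
  using Gamma0star_adj2_closed by (simp add: Gamma0star_eq)

lemma Gamma0star_det: "A \<in> Gamma0star p \<Longrightarrow> det A = 1"
  by (auto simp: Gamma0star_eq Gamma0_iff fricke_coset_def)

lemma Gamma0_subset_star: "A \<in> Gamma0 p \<Longrightarrow> A \<in> Gamma0star p"
  by (simp add: Gamma0star_eq)

lemma translation_mem: "mat2 1 (of_int n) 0 1 \<in> Gamma0star p"
proof (rule Gamma0_subset_star)
  have "mat2 1 (of_int n) 0 1 = mat2 (of_int 1) (of_int n) (real p * of_int 0) (of_int 1)" by simp
  moreover have "det (mat2 1 (of_int n) 0 1 :: real^2^2) = 1" by (simp add: det_2)
  ultimately show "mat2 1 (of_int n) 0 1 \<in> Gamma0 p" by (rule Gamma0_I)
qed

lemma mat_1_mem: "mat 1 \<in> Gamma0star p"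
  using translation_mem[of 0] by (simp add: matrix_eq_2_iff mat_1_entries) (metis mat_1_entries matrix_eq_2_iff mat2_entries)

lemma Gamma0star_uminus:
  assumes "A \<in> Gamma0star p"
  shows "- A \<in> Gamma0star p"
proof -
  have "mat2 (-1) 0 0 (-1) = mat2 (of_int (-1)) (of_int 0) (real p * of_int 0) (of_int (-1))" by simp
  moreover have "det (mat2 (-1) 0 0 (-1) :: real^2^2) = 1" by (simp add: det_2)
  ultimately have "mat2 (-1) 0 0 (-1) \<in> Gamma0 p" by (rule Gamma0_I)
  then have "mat2 (-1) 0 0 (-1) ** A \<in> Gamma0star p" using Gamma0_subset_star Gamma0star_mult assms by blast
  also have "mat2 (-1) 0 0 (-1) ** A = - A" by (simp add: matrix_eq_2_iff matrix_mult_2)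
  finally show ?thesis .
qed

text \<open>Discreteness in the form needed for finiteness: after scaling by \<open>sqrt p\<close>
  at most, every entry is an integer, so a bounded range contains finitely many values.\<close>

lemma Gamma0star_scaled_integral:
  assumes "A \<in> Gamma0star p"
  shows "\<exists>n :: int. sqrt p * A$i$j = of_int n \<or> A$i$j = of_int n"
proof -
  have sp: "sqrt p * (sqrt p * x) = p * x" for x using p by (simp flip: mult.assoc)
  have ij: "i = 1 \<or> i = 2" "j = 1 \<or> j = 2" using exhaust_2 by auto
  from assms consider "A \<in> Gamma0 p" | "A \<in> fricke_coset p" unfolding Gamma0star_eq by blast
  then show ?thesis
  proof cases
    case 1
    then obtain a b c d :: int where
      *: "A = mat2 (of_int a) (of_int b) (real p * of_int c) (of_int d)" unfolding Gamma0_iff by blast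
    have "\<exists>n :: int. A$i$j = of_int n"
      using ij unfolding *
      by (elim disjE; simp; intro exI[of _ "int p * c"]; simp)
    then show ?thesis by blast
  next
    case 2
    then obtain a b c d :: int where
      *: "A = mat2 (sqrt p * of_int a) (of_int b / sqrt p) (sqrt p * of_int c) (sqrt p * of_int d)"
      unfolding fricke_coset_def by blast
    have "\<exists>n :: int. sqrt p * A$i$j = of_int n"
      using ij p unfolding * 
      by (elim disjE; simp add: sp; intro exI[of _ b] exI[of _ "int p * a"] exI[of _ "int p * c"] exI[of _ "int p * d"]; simp)
    then show ?thesis by blast
  qed
qed

text \<open>The entry is an integral multiple of \<open>p\<close> or of \<open>sqrt p\<close>. The
  bound 1, uniform in \<open>p\<close>, makes height 1 a sufficient threshold near the cusp.\<close>

lemma Gamma0star_lower_left: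
  assumes "A \<in> Gamma0star p" "A$2$1 \<noteq> 0"
  shows "\<bar>A$2$1\<bar> \<ge> 1"
proof -
  have ge1: "\<bar>of_int c\<bar> \<ge> (1::real)" if "c \<noteq> 0" for c :: int
    using that by (simp flip: of_int_abs)
  have p1: "sqrt p \<ge> 1" "real p \<ge> 1" using p by auto
  from assms(1) consider "A \<in> Gamma0 p" | "A \<in> fricke_coset p" unfolding Gamma0star_eq by blast
  then obtain c :: int and x :: real where "A$2$1 = x * of_int c" "x \<ge> 1"
  proof cases
    case 1
    then obtain a b c d :: int where "A = mat2 (of_int a) (of_int b) (real p * of_int c) (of_int d)"
      unfolding Gamma0_iff by blast
    then show ?thesis using that[of "real p" c] p1 by simp
  next
    case 2
    then obtain a b c d :: int where
      "A = mat2 (sqrt p * of_int a) (of_int b / sqrt p) (sqrt p * of_int c) (sqrt p * of_int d)"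
      unfolding fricke_coset_def by blast
    then show ?thesis using that[of "sqrt p" c] p1 by simp
  qed
  then show ?thesis using assms(2) ge1[of c] mult_mono'[of 1 x 1 "\<bar>of_int c\<bar>"] by (auto simp: abs_mult)
qed

text \<open>The stabilizer of \<infinity> consists of integral translations up to sign, so the cusp
  has width 1 and \<open>q_inf\<close> is a coordinate there. In the Fricke coset a lower left entry
  0 gives \<open>p a d = 1\<close>, hence \<open>p = 1\<close>.\<close>

lemma Gamma0star_upper_triangular:
  assumes "A \<in> Gamma0star p" "A$2$1 = 0"
  obtains n :: int where "A = mat2 1 (of_int n) 0 1 \<or> - A = mat2 1 (of_int n) 0 1"
proof -
  have unit: "(a = 1 \<and> d = 1) \<or> (a = -1 \<and> d = -1)" if "real_of_int a * of_int d = 1" for a d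
  proof -
    have "a * d = 1" using that by (metis of_int_1 of_int_eq_iff of_int_mult)
    then show ?thesis by (auto simp: zmult_eq_1_iff)
  qed
  from assms(1) consider "A \<in> Gamma0 p" | "A \<in> fricke_coset p" unfolding Gamma0star_eq by blast
  then show ?thesis
  proof cases
    case 1
    then obtain a b c d :: int where
      *: "A = mat2 (of_int a) (of_int b) (real p * of_int c) (of_int d)" and "det A = 1" unfolding Gamma0_iff by blast
    then have "real_of_int a * of_int d = 1" using assms(2) p by (auto simp: det_2)
    from unit[OF this] show ?thesis using assms(2) * that[of b] that[of "-b"] by (auto simp: matrix_eq_2_iff)
  next
    case 2
    then obtain a b c d :: int where
      *: "A = mat2 (sqrt p * of_int a) (of_int b / sqrt p) (sqrt p * of_int c) (sqrt p * of_int d)"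
      and "det A = 1" unfolding fricke_coset_def by blast
    then have "sqrt p * of_int a * (sqrt p * of_int d) = 1" using assms(2) p by (simp add: det_2)
    moreover have "sqrt p * of_int a * (sqrt p * of_int d) = (sqrt p * sqrt p) * (real_of_int a * of_int d)"
      by (simp only: mult_ac)
    ultimately have "real p * (real_of_int a * of_int d) = 1" by simp
    then have 1: "int p * (a * d) = 1" by (metis of_int_1 of_int_eq_iff of_int_mult of_int_of_nat_eq)
    then have "int p dvd 1" by (metis dvd_triv_left)
    then have "p = 1" by simp
    with * 1 have A: "A = mat2 (of_int a) (of_int b) (of_int c) (of_int d)" and ad: "real_of_int a * of_int d = 1"
      by (auto simp flip: of_int_mult)
    from unit[OF ad] show ?thesis using assms(2) A that[of b] that[of "-b"] by (auto simp: matrix_eq_2_iff)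
  qed
qed

end

section \<open>Action on the upper half plane\<close>

lemma upper_half_plane_iff [simp]: "z \<in> upper_half_plane \<longleftrightarrow> Im z > 0"
  by (simp add: upper_half_plane_def)

lemma open_upper_half_plane [simp, intro]: "open upper_half_plane"
  unfolding upper_half_plane_def by (rule open_halfspace_Im_gt)

lemma connected_upper_half_plane [simp, intro]: "connected upper_half_plane"
  unfolding upper_half_plane_def by (rule convex_connected) (rule convex_halfspace_Im_gt)

definition mob_den :: "real^2^2 \<Rightarrow> complex \<Rightarrow> complex" where
  "mob_den A z = of_real (A$2$1) * z + of_real (A$2$2)"

lemma mob_den_nonzero:
  assumes "det A = 1" "Im z > 0"
  shows "mob_den A z \<noteq> 0"
proof
  assume 0: "mob_den A z = 0"
  then have "Im (mob_den A z) = 0" by simp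
  then have "A$2$1 = 0" using assms by (simp add: mob_den_def)
  moreover from this 0 have "A$2$2 = 0" by (simp add: mob_den_def)
  ultimately show False using assms by (simp add: det_2)
qed

lemma mob_altdef: "mob A z = (of_real (A$1$1) * z + of_real (A$1$2)) / mob_den A z"
  by (simp add: mob_def mob_den_def)

lemma Im_mob:
  assumes "det A = 1" "Im z > 0"
  shows "Im (mob A z) = Im z / (norm (mob_den A z))\<^sup>2"
proof -
  have d: "A$1$1 * A$2$2 - A$1$2 * A$2$1 = 1" using assms by (simp add: det_2)
  have "Im (mob A z) = Im ((of_real (A$1$1) * z + of_real (A$1$2)) * cnj (mob_den A z)) / (norm (mob_den A z))\<^sup>2"
    unfolding mob_altdef by (subst complex_div_cnj) (simp add: Im_divide_of_real power2_eq_square)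
  also have "Im ((of_real (A$1$1) * z + of_real (A$1$2)) * cnj (mob_den A z)) = (A$1$1 * A$2$2 - A$1$2 * A$2$1) * Im z"
    by (simp add: mob_den_def algebra_simps)
  finally show ?thesis by (simp add: d)
qed

lemma mob_upper_half_plane [simp]: "det A = 1 \<Longrightarrow> Im z > 0 \<Longrightarrow> Im (mob A z) > 0"
  by (simp add: Im_mob mob_den_nonzero)

lemma mob_den_mult:
  assumes "det B = 1" "Im z > 0"
  shows "mob_den (A ** B) z = mob_den A (mob B z) * mob_den B z"
  using mob_den_nonzero[OF assms]
  by (simp add: mob_altdef mob_den_def matrix_mult_2 field_simps)

lemma mob_mult:
  assumes "det A = 1" "det B = 1" "Im z > 0"
  shows "mob (A ** B) z = mob A (mob B z)"
proof -
  have nz: "mob_den B z \<noteq> 0" "mob_den A (mob B z) \<noteq> 0" using mob_den_nonzero[OF assms(2,3)] mob_den_nonzero[OF assms(1), of "mob B z"]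
    mob_upper_half_plane[OF assms(2,3)] by auto
  have "(of_real ((A ** B)$1$1) * z + of_real ((A ** B)$1$2)) =
      (of_real (A$1$1) * mob B z + of_real (A$1$2)) * mob_den B z"
    unfolding mob_altdef[of B] using nz(1) by (simp add: matrix_mult_2 field_simps mob_den_def)
  then show ?thesis unfolding mob_altdef[of "A ** B"] mob_altdef[of A]
    using nz by (simp add: mob_den_mult assms)
qed

lemma mob_1 [simp]: "mob (mat 1) z = z"
  by (simp add: mob_def mat_1_entries)

lemma mob_uminus [simp]: "mob (- A) z = mob A z"
proof -
  have "mob (- A) z = (- (of_real (A$1$1) * z + of_real (A$1$2))) / (- (of_real (A$2$1) * z + of_real (A$2$2)))"
    by (simp add: mob_def)
  then show ?thesis by (simp only: minus_divide_divide mob_def)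
qed

lemma mob_adj2: "det A = 1 \<Longrightarrow> Im z > 0 \<Longrightarrow> mob (adj2 A) (mob A z) = z"
  using mob_mult[of "adj2 A" A z] by (simp add: det_adj2 adj2_mult)

lemma mob_eq_iff: "det A = 1 \<Longrightarrow> Im z > 0 \<Longrightarrow> Im w > 0 \<Longrightarrow> mob A z = mob A w \<longleftrightarrow> z = w"
  by (metis mob_adj2)

lemma mob_has_field_derivative:
  assumes "det A = 1" "Im z > 0"
  shows "(mob A has_field_derivative 1 / (mob_den A z)\<^sup>2) (at z)"
proof -
  have d: "of_real (A$1$1) * of_real (A$2$2) - of_real (A$1$2) * of_real (A$2$1) = (1::complex)"
    using assms by (simp add: det_2 flip: of_real_mult of_real_diff)
  have nz: "of_real (A$2$1) * z + of_real (A$2$2) \<noteq> 0"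
    using mob_den_nonzero[OF assms] by (simp add: mob_den_def)
  have "(mob A has_field_derivative (of_real (A$1$1) * of_real (A$2$2) - of_real (A$1$2) * of_real (A$2$1)) / (mob_den A z)\<^sup>2) (at z)"
    unfolding mob_def [abs_def] mob_den_def using nz
    by (auto intro!: derivative_eq_intros simp: divide_simps power2_eq_square) (simp add: algebra_simps)
  then show ?thesis by (simp only: d)
qed

lemma mob_holomorphic: "det A = 1 \<Longrightarrow> mob A holomorphic_on upper_half_plane"
  unfolding holomorphic_on_open[OF open_upper_half_plane]
  using mob_has_field_derivative by (auto intro!: exI)

lemma mob_analytic: "det A = 1 \<Longrightarrow> Im z > 0 \<Longrightarrow> mob A analytic_on {z}"
  using mob_holomorphic[of A] analytic_at by (auto intro!: exI[of _ upper_half_plane])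

lemma continuous_on_mob: "det A = 1 \<Longrightarrow> continuous_on upper_half_plane (mob A)"
  by (auto intro!: continuous_at_imp_continuous_on DERIV_isCont mob_has_field_derivative)

lemma mob_translation: "mob (mat2 1 (of_int n) 0 1) z = z + of_int n"
  by (simp add: mob_def)

context
  fixes p :: nat
  assumes p: "p > 0"
begin

lemma finite_Gamma0star_entries:
  "finite {A \<in> Gamma0star p. \<forall>i j. \<bar>A$i$j\<bar> \<le> b}"
proof -
  define E where "E = {x :: real. \<bar>x\<bar> \<le> b \<and> (\<exists>n :: int. sqrt p * x = of_int n \<or> x = of_int n)}"
  have sp: "sqrt p \<ge> 1" using p by simp
  have "E \<subseteq> (\<lambda>n. of_int n / sqrt p) ` {- \<lceil>b * sqrt p\<rceil>..\<lceil>b * sqrt p\<rceil>} \<union> of_int ` {- \<lceil>b\<rceil>..\<lceil>b\<rceil>}"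
  proof
    fix x assume "x \<in> E"
    then obtain n :: int where x: "\<bar>x\<bar> \<le> b" "sqrt p * x = of_int n \<or> x = of_int n" unfolding E_def by blast
    from x(2) show "x \<in> (\<lambda>n. of_int n / sqrt p) ` {- \<lceil>b * sqrt p\<rceil>..\<lceil>b * sqrt p\<rceil>} \<union> of_int ` {- \<lceil>b\<rceil>..\<lceil>b\<rceil>}"
    proof
      assume n: "sqrt p * x = of_int n"
      have "\<bar>of_int n\<bar> = \<bar>x\<bar> * sqrt p" unfolding n[symmetric] by (simp add: abs_mult)
      also have "\<dots> \<le> b * sqrt p" using x(1) by (intro mult_right_mono) auto
      finally have "\<bar>real_of_int n\<bar> \<le> b * sqrt p" .
      then have "n \<in> {- \<lceil>b * sqrt p\<rceil>..\<lceil>b * sqrt p\<rceil>}" by (auto simp: abs_le_iff) linarith+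
      moreover have "x = of_int n / sqrt p" using n p by (simp add: field_simps)
      ultimately show ?thesis by blast
    next
      assume n: "x = of_int n"
      then have "n \<in> {- \<lceil>b\<rceil>..\<lceil>b\<rceil>}" using x(1) by (auto simp: abs_le_iff) linarith+
      then show ?thesis using n by blast
    qed
  qed
  then have "finite E" by (rule finite_subset) auto
  then have "finite ((\<lambda>(a, b, c, d). mat2 a b c d) ` (E \<times> E \<times> E \<times> E))" by (intro finite_imageI finite_cartesian_product)
  then show ?thesis
  proof (rule rev_finite_subset, intro subsetI)
    fix A assume "A \<in> {A \<in> Gamma0star p. \<forall>i j. \<bar>A$i$j\<bar> \<le> b}"
    then have "A$i$j \<in> E" for i j using Gamma0star_scaled_integral[OF p, of A i j] by (auto simp: E_def)
    moreover have "A = mat2 (A$1$1) (A$1$2) (A$2$1) (A$2$2)" by (simp add: matrix_eq_2_iff)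
    ultimately show "A \<in> (\<lambda>(a, b, c, d). mat2 a b c d) ` (E \<times> E \<times> E \<times> E)"
      by (intro image_eqI[where x = "(A$1$1, A$1$2, A$2$1, A$2$2)"]) auto
  qed
qed

text \<open>For \<open>z\<close> and \<open>A z\<close> in \<open>K\<close> the formula for
  \<open>Im (A z)\<close> bounds |cz + d|, and then \<open>az + b = (A z) (cz + d)\<close> is
  bounded too. As \<open>Im z\<close> is bounded below on \<open>K\<close>, these bounds pass to the
  real coefficients, and the entries are discrete.\<close>

lemma Gamma0star_properly_discontinuous:
  assumes K: "compact K" "K \<subseteq> upper_half_plane"
  shows "finite {A \<in> Gamma0star p. \<exists>z\<in>K. mob A z \<in> K}"
proof (cases "K = {}")
  case False
  obtain R where R: "\<And>z. z \<in> K \<Longrightarrow> norm z \<le> R" using compact_imp_bounded[OF K(1)] by (auto simp: bounded_iff)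
  obtain w where w: "w \<in> K" "\<And>z. z \<in> K \<Longrightarrow> Im w \<le> Im z"
    using continuous_attains_inf[OF K(1) False, of Im] continuous_on_Im[OF continuous_on_id] by blast
  define y where "y = Im w"
  have y: "y > 0" using w(1) K(2) by (auto simp: y_def)
  have "R \<ge> 0" using R[OF w(1)] norm_ge_zero order_trans by blast
  \<comment> \<open>\<open>b\<close> bounds |cz + d|; from it \<open>b1\<close>, \<open>b2\<close>,
    \<open>b3\<close>, \<open>b4\<close> bound the lower left, lower right, upper left and upper
    right entry.\<close>
  define b where "b = sqrt (R / y)"
  define b1 where "b1 = b / y"
  define b2 where "b2 = b + b1 * R"
  define b3 where "b3 = R * b / y"
  define b4 where "b4 = R * b + b3 * R"
  have b: "b \<ge> 0" "b1 \<ge> 0" "b2 \<ge> 0" "b3 \<ge> 0" "b4 \<ge> 0"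
    using y \<open>R \<ge> 0\<close> by (auto simp: b_def b1_def b2_def b3_def b4_def)
  have lin: "\<bar>c\<bar> \<le> B / y \<and> \<bar>d\<bar> \<le> B + B / y * R" if z: "z \<in> K" and B: "norm (of_real c * z + of_real d) \<le> B" for z c d B
  proof -
    have "\<bar>c\<bar> * y \<le> \<bar>c\<bar> * Im z" using w(2)[OF z] by (intro mult_left_mono) (auto simp: y_def)
    also have "\<dots> = \<bar>Im (of_real c * z + of_real d)\<bar>" using w(2)[OF z] y by (simp add: abs_mult y_def)
    also have "\<dots> \<le> B" using abs_Im_le_cmod B order_trans by blast
    finally have c: "\<bar>c\<bar> \<le> B / y" using y by (simp add: field_simps)
    have "\<bar>d\<bar> = norm ((of_real c * z + of_real d) - of_real c * z)" by simp
    also have "\<dots> \<le> norm (of_real c * z + of_real d) + norm (of_real c * z)" by (rule norm_triangle_ineq4)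
    also have "norm (of_real c * z) \<le> B / y * R"
      unfolding norm_mult using c R[OF z] by (intro mult_mono) (auto intro: order_trans[OF abs_ge_zero])
    finally show ?thesis using B c by simp
  qed
  show ?thesis
  proof (rule finite_subset[OF _ finite_Gamma0star_entries[of "Max {b1, b2, b3, b4}"]], intro subsetI CollectI conjI allI)
    fix A assume "A \<in> {A \<in> Gamma0star p. \<exists>z\<in>K. mob A z \<in> K}"
    then obtain z where A: "A \<in> Gamma0star p" and z: "z \<in> K" "mob A z \<in> K" by blast
    show "A \<in> Gamma0star p" by fact
    have dt: "det A = 1" using A by (rule Gamma0star_det[OF p])
    have iz: "Im z > 0" using z K by auto
    have nz: "mob_den A z \<noteq> 0" using dt iz by (rule mob_den_nonzero)
    have "y * (norm (mob_den A z))\<^sup>2 \<le> Im z"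
      using w(2)[OF z(2)] nz unfolding Im_mob[OF dt iz] y_def by (simp add: field_simps)
    also have "\<dots> \<le> R" using R[OF z(1)] abs_Im_le_cmod[of z] by linarith
    finally have "(norm (mob_den A z))\<^sup>2 \<le> R / y" using y by (simp add: field_simps)
    then have den: "norm (mob_den A z) \<le> b" unfolding b_def by (rule real_le_rsqrt)
    have "of_real (A$1$1) * z + of_real (A$1$2) = mob A z * mob_den A z" unfolding mob_altdef using nz by simp
    then have num: "norm (of_real (A$1$1) * z + of_real (A$1$2)) \<le> R * b"
      using R[OF z(2)] den b \<open>R \<ge> 0\<close> by (simp add: norm_mult mult_mono)
    have *: "\<bar>A$2$1\<bar> \<le> b1" "\<bar>A$2$2\<bar> \<le> b2" "\<bar>A$1$1\<bar> \<le> b3" "\<bar>A$1$2\<bar> \<le> b4"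
      using lin[OF z(1) den[unfolded mob_den_def]] lin[OF z(1) num] by (auto simp: b1_def b2_def b3_def b4_def)
    fix i j :: 2
    have "i = 1 \<or> i = 2" "j = 1 \<or> j = 2" using exhaust_2 by auto
    then show "\<bar>A$i$j\<bar> \<le> Max {b1, b2, b3, b4}" using * by (auto simp: max_def)
  qed
qed auto

text \<open>With a nonzero lower left entry \<open>c\<close>, the estimate |cz + d| >= |c| Im z >=
  Im z would give \<open>Im (A z) <= 1 / Im z < 1\<close>.\<close>

lemma Gamma0star_Im_gt_1:
  assumes "A \<in> Gamma0star p" "Im z > 1" "Im (mob A z) > 1"
  obtains n :: int where "A = mat2 1 (of_int n) 0 1 \<or> - A = mat2 1 (of_int n) 0 1"
proof -
  have dt: "det A = 1" using assms(1) by (rule Gamma0star_det[OF p])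
  have "A$2$1 = 0"
  proof (rule ccontr)
    assume "A$2$1 \<noteq> 0"
    then have c: "\<bar>A$2$1\<bar> \<ge> 1" using Gamma0star_lower_left[OF p assms(1)] by blast
    have "Im z = 1 * Im z" by simp
    also have "\<dots> \<le> \<bar>A$2$1\<bar> * Im z" by (rule mult_right_mono) (use c assms in auto)
    also have "\<dots> = \<bar>Im (mob_den A z)\<bar>" using assms by (simp add: mob_den_def abs_mult)
    also have "\<dots> \<le> norm (mob_den A z)" by (rule abs_Im_le_cmod)
    finally have le: "Im z \<le> norm (mob_den A z)" .
    have "(norm (mob_den A z))\<^sup>2 \<ge> (Im z)\<^sup>2" by (rule power_mono[OF le]) (use assms in auto)
    moreover have "(Im z)\<^sup>2 > Im z" using assms by (simp add: power2_eq_square)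
    moreover have "(norm (mob_den A z))\<^sup>2 < Im z"
      using assms(3) mob_den_nonzero[OF dt, of z] assms(2) Im_mob[OF dt, of z] by (simp add: field_simps)
    ultimately show False by linarith
  qed
  from Gamma0star_upper_triangular[OF p assms(1) this] that show ?thesis by blast
qed

end

section \<open>Reduction theory and orbits\<close>

text \<open>If \<open>p\<close> divides \<open>c\<close>, the row completes to a matrix of
  \<open>Gamma0 p\<close> with \<open>t = 1\<close>. Otherwise \<open>p\<close> is a prime not
  dividing \<open>c\<close>, so \<open>c\<close> is coprime to \<open>p d\<close> and the row,
  scaled by \<open>t = sqrt p\<close>, completes in the Fricke coset. This is why there is a single
  cusp, and \<open>t\<^sup>2 \<le> p\<close> bounds the height lost in reduction.\<close>

lemma Gamma0star_bottom_row:
  fixes c d :: int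
  assumes p: "prime p \<or> p = 1" and cd: "coprime c d"
  obtains A t where "A \<in> Gamma0star p" "A$2$1 = t * of_int c" "A$2$2 = t * of_int d" "t > 0" "t\<^sup>2 \<le> p"
proof -
  have p0: "p > 0" using p by (auto intro: prime_gt_0_nat)
  show ?thesis
  proof (cases "int p dvd c")
    case True
    then obtain c' where c': "c = int p * c'" by blast
    obtain u v where "u * c + v * d = gcd c d" using bezout_int by blast
    then have "u * c + v * d = 1" using cd by simp
    then have uv: "of_int u * (real p * of_int c') + of_int v * of_int d = 1"
      unfolding c' by (metis of_int_1 of_int_add of_int_mult of_int_of_nat_eq)
    define A where "A = mat2 (of_int v) (of_int (- u)) (real p * of_int c') (of_int d)"
    have "det A = 1" using uv by (simp add: A_def det_2 mult_ac)
    with A_def have "A \<in> Gamma0 p" by (rule Gamma0_I)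
    then show ?thesis using that[of A 1] p0 Gamma0_subset_star[OF p0] by (simp add: A_def c')
  next
    case False
    then have "prime p" using p by auto
    then have "coprime (int p) c" using False by (simp add: prime_imp_coprime)
    then have "coprime c (int p * d)" using cd by (simp add: coprime_commute)
    moreover obtain u v where "u * c + v * (int p * d) = gcd c (int p * d)" using bezout_int by blast
    ultimately have "u * c + v * (int p * d) = 1" by simp
    then have uv: "of_int u * of_int c + of_int v * (real p * of_int d) = 1"
      by (metis of_int_1 of_int_add of_int_mult of_int_of_nat_eq)
    define A where "A = mat2 (sqrt p * of_int v) (of_int (- u) / sqrt p) (sqrt p * of_int c) (sqrt p * of_int d)"
    have "sqrt p * of_int v * (sqrt p * of_int d) = (sqrt p * sqrt p) * (real_of_int v * of_int d)"
      by (simp only: mult_ac)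
    then have "det A = 1" using uv p0 by (simp add: A_def det_2 mult_ac)
    with A_def have "A \<in> fricke_coset p" by (rule fricke_coset_I)
    then show ?thesis using that[of A "sqrt p"] p0 Gamma0star_eq[OF p0] by (simp add: A_def)
  qed
qed

text \<open>A quantitative substitute for a fundamental domain. For \<open>y = Im z < 1\<close>,
  Dirichlet approximation with \<open>N\<close> about \<open>1 / sqrt y\<close> yields
  \<open>k\<close>, \<open>h\<close> with |k Re z - h| <= sqrt y and \<open>k y <= 2 sqrt y\<close>,
  so |kz - h|^2 <= 5y. The scaling of the row costs a factor \<open>t\<^sup>2 \<le> p\<close>, hence
  the constant \<open>1 / (5 p)\<close>.\<close>

lemma Gamma0star_Im_ge:
  assumes p: "prime p \<or> p = 1" and z: "Im z > 0"
  obtains A where "A \<in> Gamma0star p" "Im (mob A z) \<ge> 1 / (5 * real p)"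
proof (cases "Im z \<ge> 1")
  case True
  have p0: "p > 0" using p by (auto intro: prime_gt_0_nat)
  have "1 / (5 * real p) \<le> 1" using p0 by simp
  then show ?thesis using that[of "mat 1"] mat_1_mem[OF p0] True by simp
next
  case False
  have p0: "p > 0" using p by (auto intro: prime_gt_0_nat)
  define y where "y = Im z"
  have y: "0 < y" "y < 1" using z False by (auto simp: y_def)
  define N where "N = nat \<lceil>1 / sqrt y\<rceil>"
  have sy: "sqrt y > 0" "sqrt y < 1" using y by auto
  have N1: "1 / sqrt y \<le> real N" unfolding N_def by linarith
  have "1 / sqrt y > 1" using sy by simp
  \<comment> \<open>Rounding up a number larger than 1 at most doubles it.\<close>
  then have N2: "real N \<le> 2 / sqrt y" and N0: "N > 0" unfolding N_def by linarith+
  obtain h k where hk: "coprime h k" "0 < k" "k \<le> int N" "\<bar>of_int k * Re z - of_int h\<bar> < 1 / N"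
    using Dirichlet_approx_coprime[OF N0] by blast
  have "coprime k (- h)" using hk(1) by (simp add: coprime_commute)
  from Gamma0star_bottom_row[OF p this] obtain A t where
    A: "A \<in> Gamma0star p" "A$2$1 = t * of_int k" "A$2$2 = t * of_int (- h)" "t > 0" "t\<^sup>2 \<le> p" by blast
  have dt: "det A = 1" using A(1) by (rule Gamma0star_det[OF p0])
  have "mob_den A z = of_real t * (of_int k * z - of_int h)" unfolding mob_den_def A by (simp add: algebra_simps)
  then have "(norm (mob_den A z))\<^sup>2 = t\<^sup>2 * ((of_int k * Re z - of_int h)\<^sup>2 + (of_int k * y)\<^sup>2)"
    by (simp add: norm_mult power_mult_distrib cmod_power2 y_def)
  also have "\<dots> \<le> p * (y + 4 * y)"
  proof (rule mult_mono)
    have "(of_int k * Re z - of_int h)\<^sup>2 \<le> (sqrt y)\<^sup>2"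
    proof (rule abs_le_square_iff[THEN iffD1])
      have "1 / N \<le> sqrt y" using N1 N0 sy by (simp add: field_simps)
      then show "\<bar>of_int k * Re z - of_int h\<bar> \<le> \<bar>sqrt y\<bar>" using hk(4) sy by linarith
    qed
    moreover have "(of_int k * y)\<^sup>2 \<le> (2 * sqrt y)\<^sup>2"
    proof (rule power_mono)
      have "of_int k * y \<le> real N * y" using hk(3) y by (intro mult_right_mono) auto
      also have "\<dots> \<le> 2 / sqrt y * y" using N2 y by (intro mult_right_mono) auto
      also have "\<dots> = 2 * sqrt y" using y by (simp add: field_simps)
      finally show "of_int k * y \<le> 2 * sqrt y" .
    qed (use hk y in auto)
    ultimately show "(of_int k * Re z - of_int h)\<^sup>2 + (of_int k * y)\<^sup>2 \<le> y + 4 * y"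
      using y by (simp add: power_mult_distrib)
  qed (use A y in auto)
  finally have "(norm (mob_den A z))\<^sup>2 \<le> 5 * real p * y" by simp
  moreover have "norm (mob_den A z) > 0" using mob_den_nonzero[OF dt z] by simp
  ultimately have "Im (mob A z) \<ge> y / (5 * real p * y)"
    unfolding Im_mob[OF dt z] y_def[symmetric] using y p0 by (intro divide_left_mono) auto
  then have "Im (mob A z) \<ge> 1 / (5 * real p)" using y by simp
  then show ?thesis using that A(1) by blast
qed

lemma Gamma0star_reduce:
  assumes p: "prime p \<or> p = 1" and z: "Im z > 0"
  obtains A where "A \<in> Gamma0star p" "Im (mob A z) \<ge> 1 / (5 * real p)" "0 \<le> Re (mob A z)" "Re (mob A z) < 1"
proof -
  have p0: "p > 0" using p by (auto intro: prime_gt_0_nat)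
  obtain A where A: "A \<in> Gamma0star p" "Im (mob A z) \<ge> 1 / (5 * real p)" using Gamma0star_Im_ge[OF p z] .
  define n where "n = - \<lfloor>Re (mob A z)\<rfloor>"
  define T where "T = mat2 1 (of_int n) 0 (1::real)"
  have T: "T \<in> Gamma0star p" unfolding T_def by (rule translation_mem[OF p0])
  have "mob (T ** A) z = mob A z + of_int n"
    using Gamma0star_det[OF p0] T A z by (simp add: mob_mult) (simp add: T_def mob_translation)
  then show ?thesis using that[of "T ** A"] Gamma0star_mult[OF p0 T A(1)] A(2)
    unfolding n_def by simp linarith
qed

text \<open>The row \<open>(b, - a)\<close> annihilates \<open>a / b\<close>, so a matrix with this
  bottom row, up to scaling, sends the point to \<infinity>.\<close>

lemma proj_mob_rational:
  assumes p: "prime p \<or> p = 1" and x: "x \<in> \<rat>"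
  obtains A where "A \<in> Gamma0star p" "proj_mob A (Aff x) = Infty"
proof -
  from x obtain r where r: "x = of_rat r" by (auto elim: Rats_cases)
  obtain a b where ab: "quotient_of r = (a, b)" by force
  have b: "b > 0" and cop: "coprime a b" and rr: "r = of_int a / of_int b"
    using ab by (auto dest: quotient_of_denom_pos quotient_of_coprime quotient_of_div)
  have "coprime b (- a)" using cop by (simp add: coprime_commute)
  from Gamma0star_bottom_row[OF p this] obtain A t where
    A: "A \<in> Gamma0star p" "A$2$1 = t * of_int b" "A$2$2 = t * of_int (- a)" by blast
  have "of_real (A$2$1) * x + of_real (A$2$2) = (0::complex)"
    unfolding A r rr using b by (simp add: of_rat_divide)
  then show ?thesis using that[of A] A(1) by simp
qed

lemma proj_mob_Aff: "det A = 1 \<Longrightarrow> Im z > 0 \<Longrightarrow> proj_mob A (Aff z) = Aff (mob A z)"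
  using mob_den_nonzero[of A z] by (simp add: mob_den_def)

lemma proj_mob_mult:
  assumes "det A = 1" "det B = 1"
  shows "proj_mob (A ** B) x = proj_mob A (proj_mob B x)"
proof -
  have dA: "A$1$1 * A$2$2 - A$1$2 * A$2$1 = 1" and dB: "B$1$1 * B$2$2 - B$1$2 * B$2$1 = 1"
    using assms by (auto simp: det_2)
  show ?thesis
  proof (cases x)
    case Infty
    show ?thesis
    proof (cases "B$2$1 = 0")
      case True
      then have "B$1$1 \<noteq> 0" using dB by auto
      then show ?thesis using True Infty by (simp add: matrix_mult_2)
    next
      case False
      have "(A ** B)$2$1 = B$2$1 * (A$2$1 * (B$1$1 / B$2$1) + A$2$2)"
        "(A ** B)$1$1 = B$2$1 * (A$1$1 * (B$1$1 / B$2$1) + A$1$2)"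
        using False by (simp_all add: matrix_mult_2 field_simps)
      then show ?thesis using False Infty 
        by (simp add: mob_def flip: of_real_divide of_real_mult of_real_add)
    qed
  next
    case (Aff z)
    \<comment> \<open>\<open>n\<close> and \<open>d\<close> are homogeneous coordinates of the image
      of \<open>z\<close> under \<open>B\<close>. They treat finite and infinite images alike, and
      they are not both 0 because \<open>det B = 1\<close>.\<close>
    define n where "n = of_real (B$1$1) * z + of_real (B$1$2)"
    define d where "d = of_real (B$2$1) * z + of_real (B$2$2)"
    have AB: "of_real ((A ** B)$2$1) * z + of_real ((A ** B)$2$2) = of_real (A$2$1) * n + of_real (A$2$2) * d"
      "of_real ((A ** B)$1$1) * z + of_real ((A ** B)$1$2) = of_real (A$1$1) * n + of_real (A$1$2) * d"
      by (simp_all add: n_def d_def matrix_mult_2 algebra_simps)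
    have mA: "mob (A ** B) z = (of_real (A$1$1) * n + of_real (A$1$2) * d) / (of_real (A$2$1) * n + of_real (A$2$2) * d)"
      unfolding mob_def AB ..
    show ?thesis
    proof (cases "d = 0")
      case True
      have "n \<noteq> 0"
      proof
        assume "n = 0"
        have "of_real (B$1$1) * d - of_real (B$2$1) * n = of_real (B$1$1 * B$2$2 - B$1$2 * B$2$1)"
          by (simp add: n_def d_def algebra_simps)
        then show False using True \<open>n = 0\<close> dB by simp
      qed
      have "proj_mob (A ** B) x = (if A$2$1 = 0 then Infty else Aff (of_real (A$1$1) / of_real (A$2$1)))"
        using True \<open>n \<noteq> 0\<close> unfolding Aff by (simp add: AB mA)
      also have "\<dots> = proj_mob A (proj_mob B x)" using True unfolding Aff by (simp add: d_def)
      finally show ?thesis .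
    next
      case False
      have "proj_mob B x = Aff (n / d)" using False unfolding Aff by (simp add: d_def n_def mob_def)
      moreover have "of_real (A$2$1) * n + of_real (A$2$2) * d = d * (of_real (A$2$1) * (n / d) + of_real (A$2$2))"
        "of_real (A$1$1) * n + of_real (A$1$2) * d = d * (of_real (A$1$1) * (n / d) + of_real (A$1$2))"
        using False by (simp_all add: field_simps)
      ultimately show ?thesis using False unfolding Aff by (simp add: AB mA) (simp add: mob_def)
    qed
  qed
qed

context
  fixes p :: nat
  assumes p: "p > 0"
begin

lemma orbit_self: "x \<in> orbit p x"
proof -
  have "x = proj_mob (mat 1) x" by (cases x) (auto simp: mat_1_entries)
  then show ?thesis using mat_1_mem[OF p] unfolding orbit_def by blast
qed

lemma orbit_eq: "A \<in> Gamma0star p \<Longrightarrow> orbit p (proj_mob A x) = orbit p x"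
proof (intro equalityI subsetI)
  assume A: "A \<in> Gamma0star p"
  note dt = Gamma0star_det[OF p]
  fix y assume "y \<in> orbit p (proj_mob A x)"
  then obtain B where B: "B \<in> Gamma0star p" "y = proj_mob B (proj_mob A x)" unfolding orbit_def by blast
  then have "y = proj_mob (B ** A) x" using A dt by (simp add: proj_mob_mult)
  then show "y \<in> orbit p x" using Gamma0star_mult[OF p B(1) A] unfolding orbit_def by blast
next
  assume A: "A \<in> Gamma0star p"
  note dt = Gamma0star_det[OF p]
  fix y assume "y \<in> orbit p x"
  then obtain B where B: "B \<in> Gamma0star p" "y = proj_mob B x" unfolding orbit_def by blast
  have A': "adj2 A \<in> Gamma0star p" by (rule Gamma0star_adj2[OF p A])
  have "x = proj_mob (mat 1) x" by (cases x) (auto simp: mat_1_entries)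
  also have "mat 1 = adj2 A ** A" using adj2_mult(1)[OF dt[OF A]] by simp
  also have "proj_mob (adj2 A ** A) x = proj_mob (adj2 A) (proj_mob A x)" using A A' dt by (simp add: proj_mob_mult)
  finally have "y = proj_mob (B ** adj2 A) (proj_mob A x)" using B A' dt by (simp add: proj_mob_mult)
  then show "y \<in> orbit p (proj_mob A x)" using Gamma0star_mult[OF p B(1) A'] unfolding orbit_def by blast
qed

lemma orbit_Aff: "Im z > 0 \<Longrightarrow> orbit p (Aff z) = {Aff (mob A z) | A. A \<in> Gamma0star p}"
  unfolding orbit_def setcompr_eq_image Setcompr_eq_image
  by (rule image_cong) (auto intro!: proj_mob_Aff Gamma0star_det[OF p] simp del: proj_mob.simps)

lemma cusp_not_Aff: "Im z > 0 \<Longrightarrow> orbit p (Aff z) \<noteq> cusp p"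
  using orbit_self[of Infty] orbit_Aff[of z] by (auto simp: cusp_def)

lemma orbit_Aff_eq_iff:
  assumes "Im z > 0" "Im w > 0"
  shows "orbit p (Aff z) = orbit p (Aff w) \<longleftrightarrow> (\<exists>A\<in>Gamma0star p. mob A z = w)"
proof
  assume "orbit p (Aff z) = orbit p (Aff w)"
  then have "Aff w \<in> orbit p (Aff z)" using orbit_self by simp
  then show "\<exists>A\<in>Gamma0star p. mob A z = w" using orbit_Aff[OF assms(1)] by auto
next
  assume "\<exists>A\<in>Gamma0star p. mob A z = w"
  then obtain A where A: "A \<in> Gamma0star p" "mob A z = w" by blast
  then have "proj_mob A (Aff z) = Aff w" using proj_mob_Aff[OF Gamma0star_det[OF p]] assms by metis
  then show "orbit p (Aff z) = orbit p (Aff w)" using orbit_eq[OF A(1), of "Aff z"] by simp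
qed

lemma rep_orbit:
  assumes "Im z > 0"
  shows "Im (rep (orbit p (Aff z))) > 0" "orbit p (Aff (rep (orbit p (Aff z)))) = orbit p (Aff z)"
proof -
  have "\<exists>w. w \<in> upper_half_plane \<and> Aff w \<in> orbit p (Aff z)"
    using assms orbit_self by auto
  then have r: "rep (orbit p (Aff z)) \<in> upper_half_plane \<and> Aff (rep (orbit p (Aff z))) \<in> orbit p (Aff z)"
    unfolding rep_def by (rule someI_ex)
  then show 1: "Im (rep (orbit p (Aff z))) > 0" by simp
  from r orbit_Aff[OF assms] obtain A where "A \<in> Gamma0star p" "rep (orbit p (Aff z)) = mob A z" by auto
  then show "orbit p (Aff (rep (orbit p (Aff z)))) = orbit p (Aff z)"
    using orbit_Aff_eq_iff[OF assms 1] by metis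
qed

end

lemma X0star_noncuspidal:
  assumes p: "prime p \<or> p = 1" and a: "a \<in> X0star p" "a \<noteq> cusp p"
  obtains z where "Im z > 0" "a = orbit p (Aff z)"
proof -
  have p0: "p > 0" using p by (auto intro: prime_gt_0_nat)
  obtain x where x: "x \<in> extended_half_plane" "a = orbit p x" using a(1) unfolding X0star_def by blast
  from x(1) consider z where "x = Aff z" "Im z > 0" | z where "x = Aff z" "z \<in> \<rat>" | "x = Infty"
    unfolding extended_half_plane_def by auto
  then show ?thesis
  proof cases
    case 1 then show ?thesis using that x by blast
  next
    case 2
    obtain A where A: "A \<in> Gamma0star p" "proj_mob A (Aff z) = Infty" using proj_mob_rational[OF p 2(2)] .
    then have "a = cusp p" using orbit_eq[OF p0 A(1), of "Aff z"] x(2) 2(1) by (simp add: cusp_def)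
    then show ?thesis using a by simp
  next
    case 3 then show ?thesis using a x by (simp add: cusp_def)
  qed
qed

section \<open>Sums over orbits\<close>

definition stab :: "nat \<Rightarrow> complex \<Rightarrow> (real^2^2) set" where
  "stab p z = {A \<in> Gamma0star p. mob A z = z}"

text \<open>The weight turns an order in \<tau> into an order in the local parameter of the curve,
  which is an \<open>e\<close>-th power. The index set is cut down to the support because a sum over
  an infinite set defaults to 0.\<close>

definition orbit_sum :: "nat \<Rightarrow> (complex \<Rightarrow> complex) \<Rightarrow> complex" where
  "orbit_sum p \<psi> = (\<Sum>a | a \<in> X0star p - {cusp p} \<and> \<psi> (rep a) \<noteq> 0. \<psi> (rep a) / of_nat (ram_index p (rep a)))"

context
  fixes p :: nat
  assumes p: "p > 0"
begin

lemma finite_stab: "Im z > 0 \<Longrightarrow> finite (stab p z)"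
  using Gamma0star_properly_discontinuous[OF p, of "{z}"] by (simp add: stab_def)

lemma mat_1_in_stab: "mat 1 \<in> stab p z"
  by (simp add: stab_def mat_1_mem[OF p])

lemma det_not_uminus: "det A = 1 \<Longrightarrow> A \<noteq> - A" for A :: "real^2^2"
  by (auto simp: matrix_eq_2_iff det_2)

lemma card_stab:
  assumes z: "Im z > 0"
  shows "card (stab p z) = 2 * ram_index p z"
proof -
  define C where "C = (\<lambda>A. {A, - A}) ` stab p z"
  have U: "\<Union>C = stab p z"
    unfolding C_def stab_def using Gamma0star_uminus[OF p] by auto
  have "2 * card C = card (\<Union>C)"
  proof (rule card_partition)
    show "finite C" unfolding C_def by (intro finite_imageI finite_stab z)
    show "finite (\<Union>C)" unfolding U by (rule finite_stab[OF z])
    show "card c = 2" if "c \<in> C" for c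
      using that Gamma0star_det[OF p] by (auto simp: C_def stab_def det_not_uminus)
    show "c1 \<inter> c2 = {}" if "c1 \<in> C" "c2 \<in> C" "c1 \<noteq> c2" for c1 c2
      using that by (auto simp: C_def)
  qed
  then show ?thesis unfolding U by (simp add: ram_index_def C_def stab_def)
qed

lemma ram_index_pos: "Im z > 0 \<Longrightarrow> ram_index p z > 0"
  using card_stab[of z] finite_stab[of z] mat_1_in_stab[of z] card_gt_0_iff[of "stab p z"] by auto

text \<open>Conjugation by \<open>A\<close> embeds one stabilizer into the other. One inequality
  suffices, since the other follows from it for \<open>adj2 A\<close>.\<close>

lemma card_stab_mob_le:
  assumes A: "A \<in> Gamma0star p" and z: "Im z > 0"
  shows "card (stab p z) \<le> card (stab p (mob A z))"
proof (rule card_inj_on_le)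
  note dt = Gamma0star_det[OF p]
  let ?f = "\<lambda>C. A ** C ** adj2 A"
  have i: "Im (mob A z) > 0" using dt[OF A] z by simp
  show "inj_on ?f (stab p z)"
  proof (rule inj_on_inverseI)
    fix C show "adj2 A ** (A ** C ** adj2 A) ** A = C"
      using adj2_mult[OF dt[OF A]] by (metis matrix_mul_assoc matrix_mul_lid matrix_mul_rid)
  qed
  show "?f ` stab p z \<subseteq> stab p (mob A z)"
  proof (intro image_subsetI)
    fix C assume C: "C \<in> stab p z"
    then have CG: "C \<in> Gamma0star p" "mob C z = z" by (auto simp: stab_def)
    have A': "adj2 A \<in> Gamma0star p" by (rule Gamma0star_adj2[OF p A])
    have AC: "A ** C \<in> Gamma0star p" by (rule Gamma0star_mult[OF p A CG(1)])
    have "mob (A ** C ** adj2 A) (mob A z) = mob (A ** C) (mob (adj2 A) (mob A z))"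
      by (rule mob_mult[OF dt[OF AC] dt[OF A'] i])
    also have "\<dots> = mob A z" using mob_adj2[OF dt[OF A] z] mob_mult[OF dt[OF A] dt[OF CG(1)] z] CG by simp
    finally show "?f C \<in> stab p (mob A z)"
      using Gamma0star_mult[OF p AC A'] by (simp add: stab_def)
  qed
  show "finite (stab p (mob A z))" by (rule finite_stab[OF i])
qed

lemma ram_index_mob:
  assumes A: "A \<in> Gamma0star p" and z: "Im z > 0"
  shows "ram_index p (mob A z) = ram_index p z"
proof -
  note dt = Gamma0star_det[OF p]
  have i: "Im (mob A z) > 0" using dt[OF A] z by simp
  have "card (stab p (mob A z)) \<le> card (stab p (mob (adj2 A) (mob A z)))"
    by (rule card_stab_mob_le[OF Gamma0star_adj2[OF p A] i])
  then have "card (stab p (mob A z)) = card (stab p z)"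
    using card_stab_mob_le[OF A z] mob_adj2[OF dt[OF A] z] by simp
  then show ?thesis using card_stab[OF z] card_stab[OF i] by simp
qed

lemma rep_equiv:
  assumes "Im z > 0"
  obtains A where "A \<in> Gamma0star p" "mob A z = rep (orbit p (Aff z))" "Im (rep (orbit p (Aff z))) > 0"
  using orbit_Aff_eq_iff[OF p assms rep_orbit(1)[OF p assms]] rep_orbit[OF p assms] by metis

text \<open>The assumptions make \<open>S\<close> the set of all group elements that carry a point
  of \<open>U\<close> into \<open>U\<close>. Then \<open>A \<mapsto> A z\<close> maps
  \<open>S\<close> onto the part of the orbit of \<open>z\<close> in \<open>U\<close>, and each
  fibre is a left coset of the stabilizer, of size \<open>2 e\<close>.\<close>

lemma card_orbit_inter:
  assumes S: "finite S" and U: "U \<subseteq> upper_half_plane"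
    and SU: "\<And>A z. A \<in> S \<Longrightarrow> z \<in> U \<Longrightarrow> A \<in> Gamma0star p \<and> mob A z \<in> U"
    and US: "\<And>A z. A \<in> Gamma0star p \<Longrightarrow> z \<in> U \<Longrightarrow> mob A z \<in> U \<Longrightarrow> A \<in> S"
    and z: "z \<in> U"
  shows "card S = card {w \<in> U. orbit p (Aff w) = orbit p (Aff z)} * (2 * ram_index p z)"
proof -
  note dt = Gamma0star_det[OF p]
  have iz: "Im z > 0" using z U by auto
  have img: "{w \<in> U. orbit p (Aff w) = orbit p (Aff z)} = (\<lambda>A. mob A z) ` S"
  proof (intro equalityI subsetI)
    fix w assume w: "w \<in> {w \<in> U. orbit p (Aff w) = orbit p (Aff z)}"
    then have "Im w > 0" using U by auto
    then obtain A where "A \<in> Gamma0star p" "mob A z = w" using w orbit_Aff_eq_iff[OF p iz, of w] by auto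
    then show "w \<in> (\<lambda>A. mob A z) ` S" using US[of A z] w z by auto
  next
    fix w assume "w \<in> (\<lambda>A. mob A z) ` S"
    then obtain A where A: "A \<in> S" "w = mob A z" by blast
    then have "A \<in> Gamma0star p" "w \<in> U" using SU z by auto
    moreover from this have "Im w > 0" using U by auto
    ultimately show "w \<in> {w \<in> U. orbit p (Aff w) = orbit p (Aff z)}"
      using orbit_Aff_eq_iff[OF p iz, of w] A by auto
  qed
  have fib: "card {A \<in> S. mob A z = w} = card (stab p z)" if w: "w \<in> (\<lambda>A. mob A z) ` S" for w
  proof -
    obtain B where B: "B \<in> S" "w = mob B z" using w by blast
    then have BG: "B \<in> Gamma0star p" using SU z by blast
    have B': "adj2 B \<in> Gamma0star p" by (rule Gamma0star_adj2[OF p BG])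
    have "bij_betw (\<lambda>C. B ** C) (stab p z) {A \<in> S. mob A z = w}"
    proof (rule bij_betw_byWitness[where f' = "\<lambda>A. adj2 B ** A"])
      show "\<forall>C\<in>stab p z. adj2 B ** (B ** C) = C"
        using adj2_mult[OF dt[OF BG]] by (simp add: matrix_mul_assoc)
      show "\<forall>A\<in>{A \<in> S. mob A z = w}. B ** (adj2 B ** A) = A"
        using adj2_mult[OF dt[OF BG]] by (simp add: matrix_mul_assoc)
      show "(\<lambda>C. B ** C) ` stab p z \<subseteq> {A \<in> S. mob A z = w}"
      proof (intro image_subsetI)
        fix C assume "C \<in> stab p z"
        then have C: "C \<in> Gamma0star p" "mob C z = z" by (auto simp: stab_def)
        have BC: "B ** C \<in> Gamma0star p" by (rule Gamma0star_mult[OF p BG C(1)])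
        have "mob (B ** C) z = w" using mob_mult[OF dt[OF BG] dt[OF C(1)] iz] C B by simp
        moreover have "w \<in> U" using SU B z by blast
        ultimately show "B ** C \<in> {A \<in> S. mob A z = w}" using US[OF BC z] by simp
      qed
      show "(\<lambda>A. adj2 B ** A) ` {A \<in> S. mob A z = w} \<subseteq> stab p z"
      proof (intro image_subsetI)
        fix A assume A: "A \<in> {A \<in> S. mob A z = w}"
        then have AG: "A \<in> Gamma0star p" using SU z by blast
        have "mob (adj2 B ** A) z = mob (adj2 B) (mob A z)" by (rule mob_mult[OF dt[OF B'] dt[OF AG] iz])
        also have "\<dots> = z" using A B mob_adj2[OF dt[OF BG] iz] by simp
        finally show "adj2 B ** A \<in> stab p z" using Gamma0star_mult[OF p B' AG] by (simp add: stab_def)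
      qed
    qed
    then show ?thesis by (simp add: bij_betw_same_card)
  qed
  have "card S = (\<Sum>A\<in>S. 1)" by simp
  also have "\<dots> = (\<Sum>w\<in>(\<lambda>A. mob A z) ` S. \<Sum>A | A \<in> S \<and> mob A z = w. 1)"
    by (rule sum.image_gen[OF S])
  also have "\<dots> = (\<Sum>w\<in>(\<lambda>A. mob A z) ` S. card (stab p z))"
    by (rule sum.cong) (use fib in simp_all)
  also have "\<dots> = card ((\<lambda>A. mob A z) ` S) * card (stab p z)" by simp
  finally show ?thesis unfolding img card_stab[OF iz] .
qed

text \<open>Stabilizers in \<open>SL\<^sub>2\<close> contain \<open>- 1\<close>, whereas ramification indices are taken modulo sign: hence the factor 2.\<close>

lemma orbit_sum_eq_local_sums:
  fixes I :: "'i set" and \<psi> :: "complex \<Rightarrow> complex"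
  assumes I: "finite I" and S: "\<And>i. i \<in> I \<Longrightarrow> finite (S i)" and U: "\<And>i. i \<in> I \<Longrightarrow> U i \<subseteq> upper_half_plane"
    and SU: "\<And>i A z. i \<in> I \<Longrightarrow> A \<in> S i \<Longrightarrow> z \<in> U i \<Longrightarrow> A \<in> Gamma0star p \<and> mob A z \<in> U i"
    and US: "\<And>i j A z. i \<in> I \<Longrightarrow> j \<in> I \<Longrightarrow> A \<in> Gamma0star p \<Longrightarrow> z \<in> U i \<Longrightarrow> mob A z \<in> U j \<Longrightarrow> i = j \<and> A \<in> S i"
    and inv: "\<And>A z. A \<in> Gamma0star p \<Longrightarrow> Im z > 0 \<Longrightarrow> \<psi> (mob A z) = \<psi> z"
    and fin: "\<And>i. i \<in> I \<Longrightarrow> finite {z \<in> U i. \<psi> z \<noteq> 0}"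
    and cover: "\<And>z. Im z > 0 \<Longrightarrow> \<psi> z \<noteq> 0 \<Longrightarrow> \<exists>A\<in>Gamma0star p. \<exists>i\<in>I. mob A z \<in> U i"
    and p': "prime p \<or> p = 1"
  shows "finite {a \<in> X0star p - {cusp p}. \<psi> (rep a) \<noteq> 0} \<and>
    orbit_sum p \<psi> = (\<Sum>i\<in>I. 2 / of_nat (card (S i)) * (\<Sum>z | z \<in> U i \<and> \<psi> z \<noteq> 0. \<psi> z))"
proof -
  define \<pi> where "\<pi> = (\<lambda>z. orbit p (Aff z))"
  define Z where "Z = (\<lambda>i. {z \<in> U i. \<psi> z \<noteq> 0})"
  have repz: "\<psi> (rep (\<pi> z)) = \<psi> z" "ram_index p (rep (\<pi> z)) = ram_index p z" if "Im z > 0" for z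
    using rep_equiv[OF that] inv ram_index_mob that unfolding \<pi>_def by metis+
  have supp: "{a \<in> X0star p - {cusp p}. \<psi> (rep a) \<noteq> 0} = (\<Union>i\<in>I. \<pi> ` Z i)"
  proof (intro equalityI subsetI)
    fix a assume a: "a \<in> {a \<in> X0star p - {cusp p}. \<psi> (rep a) \<noteq> 0}"
    then obtain z where z: "Im z > 0" "a = \<pi> z" using X0star_noncuspidal[OF p', of a] unfolding \<pi>_def by auto
    have "\<psi> z \<noteq> 0" using a repz z by auto
    from cover[OF z(1) this] obtain A i where A: "A \<in> Gamma0star p" "i \<in> I" "mob A z \<in> U i" by blast
    have "Im (mob A z) > 0" using U[OF A(2)] A(3) by auto
    then have "\<pi> (mob A z) = a" unfolding z \<pi>_def using orbit_Aff_eq_iff[OF p z(1)] A(1) by metis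
    moreover have "mob A z \<in> Z i" using A inv[OF A(1) z(1)] \<open>\<psi> z \<noteq> 0\<close> by (simp add: Z_def)
    ultimately show "a \<in> (\<Union>i\<in>I. \<pi> ` Z i)" using A(2) by blast
  next
    fix a assume "a \<in> (\<Union>i\<in>I. \<pi> ` Z i)"
    then obtain i z where z: "i \<in> I" "z \<in> U i" "\<psi> z \<noteq> 0" "a = \<pi> z" by (auto simp: Z_def)
    then have "Im z > 0" using U[OF z(1)] by auto
    then show "a \<in> {a \<in> X0star p - {cusp p}. \<psi> (rep a) \<noteq> 0}"
      using repz[of z] z cusp_not_Aff[OF p, of z] by (auto simp: \<pi>_def X0star_def extended_half_plane_def)
  qed
  have finZ: "finite (Z i)" if "i \<in> I" for i using fin[OF that] by (simp add: Z_def)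
  have fin_supp: "finite {a \<in> X0star p - {cusp p}. \<psi> (rep a) \<noteq> 0}" unfolding supp using I finZ by auto
  have "orbit_sum p \<psi> = (\<Sum>a\<in>(\<Union>i\<in>I. \<pi> ` Z i). \<psi> (rep a) / of_nat (ram_index p (rep a)))"
    unfolding orbit_sum_def supp[symmetric] by simp
  also have "\<dots> = (\<Sum>i\<in>I. \<Sum>a\<in>\<pi> ` Z i. \<psi> (rep a) / of_nat (ram_index p (rep a)))"
  proof (rule sum.UNION_disjoint[OF I])
    show "\<forall>i\<in>I. \<forall>j\<in>I. i \<noteq> j \<longrightarrow> \<pi> ` Z i \<inter> \<pi> ` Z j = {}"
    proof (intro ballI impI, rule ccontr)
      fix i j assume ij: "i \<in> I" "j \<in> I" "i \<noteq> j" "\<pi> ` Z i \<inter> \<pi> ` Z j \<noteq> {}"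
      then obtain z w where zw: "z \<in> U i" "w \<in> U j" "\<pi> z = \<pi> w" by (auto simp: Z_def)
      then have "Im z > 0" "Im w > 0" using U[OF ij(1)] U[OF ij(2)] by auto
      then obtain A where "A \<in> Gamma0star p" "mob A z = w" using orbit_Aff_eq_iff[OF p, of z w] zw(3) by (auto simp: \<pi>_def)
      then show False using US[of i j A z] ij zw by auto
    qed
  qed (use finZ in auto)
  also have "\<dots> = (\<Sum>i\<in>I. 2 / of_nat (card (S i)) * (\<Sum>z | z \<in> U i \<and> \<psi> z \<noteq> 0. \<psi> z))"
  proof (rule sum.cong[OF refl])
    fix i assume i: "i \<in> I"
    have "(\<Sum>z\<in>Z i. \<psi> z) = (\<Sum>a\<in>\<pi> ` Z i. \<Sum>z | z \<in> Z i \<and> \<pi> z = a. \<psi> z)"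
      by (rule sum.image_gen[OF finZ[OF i]])
    also have "\<dots> = (\<Sum>a\<in>\<pi> ` Z i. of_nat (card (S i)) / 2 * (\<psi> (rep a) / of_nat (ram_index p (rep a))))"
    proof (rule sum.cong[OF refl])
      fix a assume "a \<in> \<pi> ` Z i"
      then obtain z where z: "z \<in> U i" "\<psi> z \<noteq> 0" "a = \<pi> z" by (auto simp: Z_def)
      have iz: "Im z > 0" using U[OF i] z by auto
      have eq: "\<psi> x = \<psi> z" if "x \<in> U i" "\<pi> x = \<pi> z" for x
      proof -
        have "Im x > 0" using that(1) U[OF i] by auto
        then show ?thesis using repz(1)[of x] repz(1)[OF iz] that(2) by simp
      qed
      have eqs: "{x. x \<in> Z i \<and> \<pi> x = a} = {w \<in> U i. orbit p (Aff w) = orbit p (Aff z)}"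
      proof (intro equalityI subsetI)
        fix x assume "x \<in> {w \<in> U i. orbit p (Aff w) = orbit p (Aff z)}"
        then have x: "x \<in> U i" "\<pi> x = \<pi> z" by (auto simp: \<pi>_def)
        from eq[OF this] show "x \<in> {x. x \<in> Z i \<and> \<pi> x = a}" using x z(2,3) by (simp add: Z_def)
      qed (use z(3) in \<open>auto simp: Z_def \<pi>_def\<close>)
      have "(\<Sum>x | x \<in> Z i \<and> \<pi> x = a. \<psi> x) = (\<Sum>x | x \<in> Z i \<and> \<pi> x = a. \<psi> z)"
        by (rule sum.cong[OF refl], rule eq) (use z(3) in \<open>auto simp: Z_def\<close>)
      then have const: "(\<Sum>x | x \<in> Z i \<and> \<pi> x = a. \<psi> x) = of_nat (card {w \<in> U i. orbit p (Aff w) = orbit p (Aff z)}) * \<psi> z"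
        unfolding eqs by simp
      \<comment> \<open>Each orbit that meets \<open>U i\<close> does so in
        \<open>card (S i) / (2 e)\<close> points, on all of which \<psi> has the same value; this
        converts the sum over points into the weighted sum over orbits.\<close>
      have "card (S i) = card {w \<in> U i. orbit p (Aff w) = orbit p (Aff z)} * (2 * ram_index p z)"
      proof (rule card_orbit_inter[OF S[OF i] U[OF i] _ _ z(1)])
        show "A \<in> Gamma0star p \<and> mob A z \<in> U i" if "A \<in> S i" "z \<in> U i" for A z using SU[OF i that] .
        show "A \<in> S i" if "A \<in> Gamma0star p" "z \<in> U i" "mob A z \<in> U i" for A z using US[OF i i that] by blast
      qed
      then show "(\<Sum>z | z \<in> Z i \<and> \<pi> z = a. \<psi> z) =
          of_nat (card (S i)) / 2 * (\<psi> (rep a) / of_nat (ram_index p (rep a)))"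
        unfolding const using repz[OF iz] z(3) ram_index_pos[OF iz] by simp
    qed
    also have "\<dots> = of_nat (card (S i)) / 2 * (\<Sum>a\<in>\<pi> ` Z i. \<psi> (rep a) / of_nat (ram_index p (rep a)))"
      by (simp add: sum_distrib_left)
    finally have e: "(\<Sum>z\<in>Z i. \<psi> z) = \<dots>" .
    show "(\<Sum>a\<in>\<pi> ` Z i. \<psi> (rep a) / of_nat (ram_index p (rep a))) = 2 / of_nat (card (S i)) * (\<Sum>z | z \<in> U i \<and> \<psi> z \<noteq> 0. \<psi> z)"
    \<comment> \<open>If \<psi> vanishes on \<open>U i\<close>, both sides are empty sums, whatever
      \<open>card (S i)\<close> is. Otherwise \<open>U i\<close> is nonempty, so
      \<open>mat 1\<close> lies in \<open>S i\<close> and the division is by a nonzero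
      number.\<close>
    proof (cases "Z i = {}")
      case True
      have "{z. z \<in> U i \<and> \<psi> z \<noteq> 0} = Z i" by (simp add: Z_def)
      then show ?thesis by (simp only: True) simp
    next
      case False
      then obtain z where "z \<in> U i" by (auto simp: Z_def)
      have "card (S i) \<noteq> 0"
        using US[OF i i mat_1_mem[OF p] \<open>z \<in> U i\<close>] \<open>z \<in> U i\<close> S[OF i] by auto
      moreover have "{z. z \<in> U i \<and> \<psi> z \<noteq> 0} = Z i" by (simp add: Z_def)
      moreover have "x = 2 / c * y" if "y = c / 2 * x" "c \<noteq> 0" for x y c :: complex
        using that(2) by (simp add: that(1))
      ultimately show ?thesis using e by (metis of_nat_eq_0_iff)
    qed
  qed
  finally have "orbit_sum p \<psi> = \<dots>" .
  with fin_supp show ?thesis by blast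
qed

end

section \<open>Modular functions\<close>

text \<open>Nonconstancy is required in the local form that makes the order of \<open>h - w\<close>
  meaningful everywhere. Values at poles are left free, so subtracting a constant or inverting stays
  in the class; the behaviour at the cusp is added separately by
  \<open>has_q_expansion\<close>.\<close>

definition modular_function :: "nat \<Rightarrow> (complex \<Rightarrow> complex) \<Rightarrow> bool" where
  "modular_function p h \<longleftrightarrow> h meromorphic_on upper_half_plane \<and> Gamma_invariant p h \<and>
     (\<forall>w z. Im z > 0 \<longrightarrow> (\<forall>\<^sub>F x in at z. h x \<noteq> w))"

text \<open>\<open>g - g z\<close> has a simple zero, and orders multiply under composition. Applied
  to \<open>mob A\<close> and to \<open>q_inf\<close>.\<close>

lemma zorder_compose_locally_injective:
  assumes f: "f meromorphic_on {g z}" "\<forall>\<^sub>F x in at (g z). f x \<noteq> 0"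
    and g: "g analytic_on {z}" "deriv g z \<noteq> 0"
  shows "zorder (\<lambda>x. f (g x)) z = zorder f (g z)"
proof -
  have an: "(\<lambda>x. g x - g z) analytic_on {z}" by (intro analytic_intros g)
  have d: "deriv (\<lambda>x. g x - g z) z = deriv g z"
    using g(1) by (subst deriv_diff) (auto dest: analytic_on_imp_differentiable_at)
  have ne: "\<forall>\<^sub>F x in at z. g x \<noteq> g z"
  proof -
    have "(g has_field_derivative deriv g z) (at z)"
      using g(1) analytic_on_imp_differentiable_at DERIV_deriv_iff_field_differentiable by blast
    then have "(\<lambda>x. (g x - g z) / (x - z)) \<midarrow>z\<rightarrow> deriv g z"
      by (simp add: has_field_derivative_iff)
    from tendsto_imp_eventually_ne[OF this g(2)] show ?thesis by eventually_elim auto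
  qed
  have "zorder (\<lambda>x. g x - g z) z = 1"
    by (rule zorder_zero_eqI'[OF an]) (use d g in auto)
  moreover have "zorder (f \<circ> g) z = zorder f (g z) * zorder (\<lambda>x. g x - g z) z"
    by (rule zorder_compose') (use f g ne meromorphic_at_iff in auto)
  ultimately show ?thesis by (simp add: o_def)
qed

lemma modular_function_meromorphic_at: "modular_function p h \<Longrightarrow> Im z > 0 \<Longrightarrow> (\<lambda>x. h x - w) meromorphic_on {z}"
  by (rule meromorphic_on_subset[of _ upper_half_plane])
     (auto simp: modular_function_def intro!: meromorphic_intros)

lemma modular_function_nonconst: "modular_function p h \<Longrightarrow> Im z > 0 \<Longrightarrow> \<forall>\<^sub>F x in at z. h x - w \<noteq> 0"
  by (auto simp: modular_function_def)

lemma zorder_mob: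
  assumes p: "p > 0" and h: "modular_function p h" and A: "A \<in> Gamma0star p" and z: "Im z > 0"
  shows "zorder (\<lambda>x. h x - w) (mob A z) = zorder (\<lambda>x. h x - w) z"
proof -
  have dt: "det A = 1" by (rule Gamma0star_det[OF p A])
  have i: "Im (mob A z) > 0" using dt z by simp
  have "zorder (\<lambda>x. h (mob A x) - w) z = zorder (\<lambda>x. h x - w) (mob A z)"
  proof (rule zorder_compose_locally_injective[where f = "\<lambda>x. h x - w" and g = "mob A"])
    show "deriv (mob A) z \<noteq> 0"
      using DERIV_imp_deriv[OF mob_has_field_derivative[OF dt z]] mob_den_nonzero[OF dt z] by simp
  qed (use modular_function_meromorphic_at[OF h i] modular_function_nonconst[OF h i] mob_analytic[OF dt z] in auto)
  moreover have "zorder (\<lambda>x. h (mob A x) - w) z = zorder (\<lambda>x. h x - w) z"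
  proof (rule zorder_cong)
    have "\<forall>\<^sub>F x in at z. x \<in> upper_half_plane" by (intro eventually_at_in_open') (use z in auto)
    then show "\<forall>\<^sub>F x in at z. h (mob A x) - w = h x - w"
      by eventually_elim (use h A in \<open>auto simp: modular_function_def Gamma_invariant_def\<close>)
  qed simp
  ultimately show ?thesis by simp
qed

section \<open>Separation of inequivalent points and neighbourhoods of zeros\<close>

text \<open>Only finitely many group elements carry a fixed compact neighbourhood of
  \<open>Z\<close> into itself, and each of them that does not map \<open>z\<close> to
  \<open>w\<close> keeps small discs around these points apart by continuity. The statement is about
  all small radii so that further smallness conditions can be added.\<close>

lemma separating_radius:
  assumes p: "p > 0" and Z: "finite Z" "Z \<subseteq> upper_half_plane"
    and ineq: "\<And>z w A. z \<in> Z \<Longrightarrow> w \<in> Z \<Longrightarrow> A \<in> Gamma0star p \<Longrightarrow> mob A z = w \<Longrightarrow> z = w"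
  shows "\<forall>\<^sub>F \<delta> in at_right 0. \<forall>z\<in>Z. cball z \<delta> \<subseteq> upper_half_plane \<and>
    (\<forall>w\<in>Z. \<forall>A\<in>Gamma0star p. (\<exists>x\<in>cball z \<delta>. mob A x \<in> cball w \<delta>) \<longrightarrow> z = w \<and> A \<in> stab p z)"
proof -
  have small: "\<forall>\<^sub>F \<delta> in at_right 0. \<forall>z\<in>Z. cball z \<delta> \<subseteq> V z" if V: "\<And>z. z \<in> Z \<Longrightarrow> open (V z) \<and> z \<in> V z" for V
  proof (rule eventually_ball_finite[OF Z(1)], rule ballI)
    fix z assume "z \<in> Z"
    then obtain e where "e > 0" "cball z e \<subseteq> V z" using V open_contains_cball_eq by metis
    then show "\<forall>\<^sub>F \<delta> in at_right 0. cball z \<delta> \<subseteq> V z"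
      unfolding eventually_at_right_field using subset_cball[of _ e z] by (metis less_imp_le order_trans)
  qed
  have ev1: "\<forall>\<^sub>F \<delta> in at_right 0. \<forall>z\<in>Z. cball z \<delta> \<subseteq> upper_half_plane"
    by (rule small[of "\<lambda>_. upper_half_plane"]) (use Z in auto)
  then obtain r where r: "r > 0" "\<And>z. z \<in> Z \<Longrightarrow> cball z r \<subseteq> upper_half_plane"
    using eventually_happens[OF eventually_conj[OF ev1 eventually_at_right_less]] by auto
  define K where "K = (\<Union>z\<in>Z. cball z r)"
  have K: "compact K" "K \<subseteq> upper_half_plane" using Z r by (auto simp: K_def intro!: compact_UN)
  define E where "E = {A \<in> Gamma0star p. \<exists>z\<in>K. mob A z \<in> K}"
  have E: "finite E" unfolding E_def by (rule Gamma0star_properly_discontinuous[OF p K])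
  define T where "T = {(A, z, w). A \<in> E \<and> z \<in> Z \<and> w \<in> Z \<and> mob A z \<noteq> w}"
  have "T \<subseteq> E \<times> Z \<times> Z" by (auto simp: T_def)
  then have T: "finite T" using E Z finite_subset by blast
  have "\<forall>\<^sub>F \<delta> in at_right 0. \<forall>t\<in>T. case t of (A, z, w) \<Rightarrow> \<forall>x\<in>cball z \<delta>. mob A x \<notin> cball w \<delta>"
  proof (rule eventually_ball_finite[OF T], rule ballI)
    fix t assume "t \<in> T"
    then obtain A z w where t: "t = (A, z, w)" "A \<in> E" "z \<in> Z" "w \<in> Z" "mob A z \<noteq> w" by (auto simp: T_def)
    have dt: "det A = 1" using t by (auto simp: E_def Gamma0star_det[OF p])
    \<comment> \<open>One half of this distance pays for the movement of \<open>mob A x\<close>, the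
      other for the radius of the disc around \<open>w\<close>.\<close>
    define \<epsilon> where "\<epsilon> = dist (mob A z) w"
    have \<epsilon>: "\<epsilon> > 0" using t by (simp add: \<epsilon>_def)
    have "Im z > 0" using t(3) Z(2) by auto
    then have "isCont (mob A) z" by (rule DERIV_isCont[OF mob_has_field_derivative[OF dt]])
    then obtain d where d: "d > 0" "\<And>x. dist x z < d \<Longrightarrow> dist (mob A x) (mob A z) < \<epsilon> / 2"
      using \<epsilon> unfolding continuous_at_eps_delta by (metis half_gt_zero)
    show "\<forall>\<^sub>F \<delta> in at_right 0. case t of (A, z, w) \<Rightarrow> \<forall>x\<in>cball z \<delta>. mob A x \<notin> cball w \<delta>"
      unfolding eventually_at_right_field
    proof (intro exI[of _ "min d (\<epsilon> / 2)"] conjI allI impI)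
      fix \<delta> assume \<delta>: "0 < \<delta>" "\<delta> < min d (\<epsilon> / 2)"
      have "mob A x \<notin> cball w \<delta>" if "x \<in> cball z \<delta>" for x
      proof
        assume "mob A x \<in> cball w \<delta>"
        then have "dist (mob A z) w < \<epsilon>"
          using d(2)[of x] that \<delta> dist_triangle[of "mob A z" w "mob A x"] by (simp add: dist_commute)
        then show False by (simp add: \<epsilon>_def)
      qed
      then show "case t of (A, z, w) \<Rightarrow> \<forall>x\<in>cball z \<delta>. mob A x \<notin> cball w \<delta>" by (simp add: t)
    qed (use d \<epsilon> in auto)
  qed
  moreover have "\<forall>\<^sub>F \<delta> in at_right 0. \<delta> < r" using r(1) by (auto simp: eventually_at_right_field)
  ultimately show ?thesis using ev1
  proof eventually_elim
    case (elim \<delta>)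
    show ?case
    proof (intro ballI conjI impI)
      fix z w A assume zw: "z \<in> Z" "w \<in> Z" "A \<in> Gamma0star p" "\<exists>x\<in>cball z \<delta>. mob A x \<in> cball w \<delta>"
      then obtain x where x: "x \<in> cball z \<delta>" "mob A x \<in> cball w \<delta>" by blast
      have "cball z \<delta> \<subseteq> K" "cball w \<delta> \<subseteq> K" using zw elim(2) unfolding K_def by force+
      then have "A \<in> E" using x zw(3) unfolding E_def by blast
      then have "mob A z = w" using elim(1) zw unfolding T_def by blast
      then show "z = w" using ineq zw by blast
      then show "A \<in> stab p z" using zw \<open>mob A z = w\<close> by (simp add: stab_def)
    qed (use elim in auto)
  qed
qed

text \<open>\<open>U\<close> is a finite intersection of preimages of \<open>V\<close>, hence open;
  it is invariant because the stabilizer is closed under products.\<close>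

lemma stab_invariant_neighbourhood:
  assumes p: "p > 0" and z: "Im z > 0" and V: "open V" "z \<in> V" "V \<subseteq> upper_half_plane"
  defines "U \<equiv> {x \<in> V. \<forall>A\<in>stab p z. mob A x \<in> V}"
  shows "open U" "z \<in> U" "U \<subseteq> V" "\<And>A x. A \<in> stab p z \<Longrightarrow> x \<in> U \<Longrightarrow> mob A x \<in> U"
proof -
  note dt = Gamma0star_det[OF p]
  have "V \<inter> (\<Inter>A\<in>stab p z. V \<inter> mob A -` V) = U" unfolding U_def by auto
  have "open (V \<inter> mob A -` V)" if "A \<in> stab p z" for A
    using continuous_open_preimage[OF continuous_on_subset[OF continuous_on_mob V(3)] V(1) V(1)] dt that
    by (auto simp: stab_def)
  then have "open (\<Inter>A\<in>stab p z. V \<inter> mob A -` V)"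
    by (intro open_INT finite_stab[OF p z]) auto
  from open_Int[OF V(1) this] show "open U" by (simp only: \<open>V \<inter> (\<Inter>A\<in>stab p z. V \<inter> mob A -` V) = U\<close>)
  show "z \<in> U" using V by (auto simp: U_def stab_def)
  show "U \<subseteq> V" by (auto simp: U_def)
  fix A x assume A: "A \<in> stab p z" and x: "x \<in> U"
  have "mob B (mob A x) \<in> V" if B: "B \<in> stab p z" for B
  proof -
    have "B ** A \<in> stab p z"
      using A B mob_mult[of B A z] Gamma0star_mult[OF p] dt z by (auto simp: stab_def)
    then have "mob (B ** A) x \<in> V" using x by (simp add: U_def)
    moreover have "Im x > 0" using x V by (auto simp: U_def)
    ultimately show ?thesis using mob_mult[of B A x] dt A B by (auto simp: stab_def)
  qed
  then show "mob A x \<in> U" using A x by (auto simp: U_def)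
qed

text \<open>Around an accumulation point \<open>h\<close> is analytic and nonzero on a punctured
  disc, where all orders are 0.\<close>

lemma modular_function_finite_zeros:
  assumes h: "modular_function p h" and K: "compact K" "K \<subseteq> upper_half_plane"
  shows "finite {z \<in> K. zorder h z \<noteq> 0}"
proof (rule ccontr)
  assume inf: "infinite {z \<in> K. zorder h z \<noteq> 0}"
  have "{z \<in> K. zorder h z \<noteq> 0} \<subseteq> K" by blast
  then obtain l where l: "l \<in> K" "l islimpt {z \<in> K. zorder h z \<noteq> 0}"
    using compact_eq_Bolzano_Weierstrass[THEN iffD1, OF K(1)] inf by blast
  have il: "Im l > 0" using l K by auto
  have me: "h meromorphic_on {l}" using modular_function_meromorphic_at[OF h il, of 0] by simp
  obtain r where r: "r > 0" "h analytic_on ball l r - {l}"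
    using meromorphic_on_isolated_singularity[OF me] by (auto simp: isolated_singularity_at_def)
  have "\<forall>\<^sub>F x in at l. h x \<noteq> 0" using modular_function_nonconst[OF h il, of 0] by simp
  moreover have "\<forall>\<^sub>F x in at l. x \<in> ball l r - {l}" using r(1) by (intro eventually_at_in_open) auto
  ultimately have "\<forall>\<^sub>F x in at l. zorder h x = 0"
  proof eventually_elim
    case (elim x)
    then have "h analytic_on {x}" using r(2) by (auto intro: analytic_on_subset)
    then show ?case using elim by (intro zorder_eq_0I) auto
  qed
  then have "\<forall>\<^sub>F x in at l. x \<notin> {z \<in> K. zorder h z \<noteq> 0}" by eventually_elim auto
  then show False using l(2) by (simp add: islimpt_iff_eventually)
qed

lemma zorder_remove_sings_diff:
  assumes "h meromorphic_on {z}"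
  shows "zorder (\<lambda>x. remove_sings h x - w) z = zorder (\<lambda>x. h x - w) z"
proof (rule zorder_cong)
  show "\<forall>\<^sub>F x in at z. remove_sings h x - w = h x - w"
    using eventually_remove_sings_eq_at[OF meromorphic_on_isolated_singularity[OF assms]]
    by eventually_elim simp
qed simp

lemma modular_function_zorder_pos_tendsto:
  assumes h: "modular_function p h" and z: "Im z > 0" and pos: "zorder (\<lambda>x. h x - w) z > 0"
  shows "h \<midarrow>z\<rightarrow> w"
proof -
  have "isolated_zero (\<lambda>x. h x - w) z"
    by (rule zorder_pos_imp_isolated_zero[OF modular_function_meromorphic_at[OF h z] modular_function_nonconst[OF h z] pos])
  then have "(\<lambda>x. h x - w) \<midarrow>z\<rightarrow> 0" by (simp add: isolated_zero_def)
  then have "(\<lambda>x. (h x - w) + w) \<midarrow>z\<rightarrow> 0 + w" by (intro tendsto_intros)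
  then show ?thesis by simp
qed

text \<open>\<open>remove_sings\<close> is needed because a modular function is controlled only on
  punctured neighbourhoods; its value at the zero itself may be arbitrary.\<close>

lemma modular_function_zero_nbhd:
  assumes h: "modular_function p h" and z: "Im z > 0" and pos: "zorder h z > 0"
  obtains R where "R > 0" "ball z R \<subseteq> upper_half_plane" "remove_sings h holomorphic_on ball z R"
    "\<And>x. x \<in> ball z R - {z} \<Longrightarrow> remove_sings h x \<noteq> 0"
proof -
  have me: "h meromorphic_on {z}" using modular_function_meromorphic_at[OF h z, of 0] by simp
  have iso: "isolated_singularity_at h z" by (rule meromorphic_on_isolated_singularity[OF me])
  have "h \<midarrow>z\<rightarrow> 0" using modular_function_zorder_pos_tendsto[OF h z, of 0] pos by simp
  then have "remove_sings h analytic_on {z}" by (rule remove_sings_analytic_at[OF iso])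
  then obtain S where S: "open S" "z \<in> S" "remove_sings h holomorphic_on S" using analytic_at by blast
  have "\<forall>\<^sub>F x in at z. remove_sings h x \<noteq> 0"
    using eventually_remove_sings_eq_at[OF iso] modular_function_nonconst[OF h z, of 0] by eventually_elim simp
  then obtain S' where S': "open S'" "z \<in> S'" "\<And>x. x \<in> S' \<Longrightarrow> x \<noteq> z \<Longrightarrow> remove_sings h x \<noteq> 0"
    unfolding eventually_at_topological by blast
  have "open (S \<inter> S' \<inter> upper_half_plane)" using S S' by (intro open_Int) auto
  moreover have "z \<in> S \<inter> S' \<inter> upper_half_plane" using S S' z by simp
  ultimately obtain R where R: "R > 0" "ball z R \<subseteq> S \<inter> S' \<inter> upper_half_plane"
    using open_contains_ball_eq by metis
  show ?thesis
  proof (rule that[OF R(1)])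
    show "remove_sings h holomorphic_on ball z R" using S(3) R(2) by (auto intro: holomorphic_on_subset)
  qed (use R S' in blast)+
qed

text \<open>\<open>FA\<close> and \<open>FB\<close> are in general not invariant, only their
  combination \<open>F\<close> is. Sums over orbits are therefore formed with \<open>F\<close>, and
  the splitting is used only on discs.\<close>

locale harmonic_invariant =
  fixes p :: nat and F FA FB :: "complex \<Rightarrow> complex"
  assumes p: "prime p \<or> p = 1"
    and F_inv: "Gamma_invariant p F"
    and FA: "FA holomorphic_on upper_half_plane" and FB: "FB holomorphic_on upper_half_plane"
    and F_eq: "\<And>z. Im z > 0 \<Longrightarrow> F z = FA z + cnj (FB z)"
begin

lemma p_pos: "p > 0" using p by (auto intro: prime_gt_0_nat)

text \<open>The contribution of \<open>z\<close> to the sum of \<open>F\<close> over the fibre of \<open>h\<close> above \<open>w\<close>; the maximum discards the poles of \<open>h\<close>.\<close>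

definition fib :: "(complex \<Rightarrow> complex) \<Rightarrow> complex \<Rightarrow> complex \<Rightarrow> complex" where
  "fib h w z = of_int (max 0 (zorder (\<lambda>x. h x - w) z)) * F z"

lemma fib_nonzero: "fib h w z \<noteq> 0 \<Longrightarrow> zorder (\<lambda>x. h x - w) z > 0"
  by (auto simp: fib_def max_def split: if_splits)

lemma fib_mob:
  "modular_function p h \<Longrightarrow> A \<in> Gamma0star p \<Longrightarrow> Im z > 0 \<Longrightarrow> fib h w (mob A z) = fib h w z"
  using F_inv by (simp add: fib_def zorder_mob[OF p_pos] Gamma_invariant_def)

text \<open>The argument principle works on round discs, whereas orbit counting needs a
  neighbourhood \<open>U\<close> invariant under the stabilizer; for small \<open>w\<close> both
  contain the same points of the fibre.\<close>

lemma disc_fibre_sum: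
  assumes h: "modular_function p h" and R: "ball z R \<subseteq> upper_half_plane"
    and hol: "remove_sings h holomorphic_on ball z R" and nz: "\<And>x. x \<in> ball z R - {z} \<Longrightarrow> remove_sings h x \<noteq> 0"
    and \<delta>: "0 < \<delta>" "\<delta> < R" and U: "open U" "z \<in> U" "U \<subseteq> ball z \<delta>"
  obtains \<mu> P Q where "\<mu> > 0" "P holomorphic_on ball 0 \<mu>" "Q holomorphic_on ball 0 \<mu>"
    "\<And>w. w \<in> ball 0 \<mu> \<Longrightarrow> finite {x \<in> U. fib h w x \<noteq> 0}"
    "\<And>w. w \<in> ball 0 \<mu> \<Longrightarrow> (\<Sum>x | x \<in> U \<and> fib h w x \<noteq> 0. fib h w x) = P w + cnj (Q w)"
proof -
  define h1 where "h1 = remove_sings h"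
  have sub: "sphere z \<delta> \<subseteq> cball z \<delta> - U" using U by auto
  have "sphere z \<delta> \<noteq> {}" using \<delta> by simp
  then have ne: "cball z \<delta> - U \<noteq> {}" using sub by blast
  have cp: "compact (cball z \<delta> - U)" by (intro compact_diff U) auto
  have cont: "continuous_on (cball z \<delta> - U) (\<lambda>x. norm (h1 x))"
    unfolding h1_def
    by (intro continuous_intros holomorphic_on_imp_continuous_on holomorphic_on_subset[OF hol]) (use \<delta> in auto)
  obtain x0 where x0: "x0 \<in> cball z \<delta> - U" "\<And>x. x \<in> cball z \<delta> - U \<Longrightarrow> norm (h1 x0) \<le> norm (h1 x)"
    using continuous_attains_inf[OF cp ne cont] by blast
  \<comment> \<open>The minimum modulus of \<open>h1\<close> on the closed disc without
    \<open>U\<close>. For |w| < \<mu> every solution of \<open>h1 x = w\<close> in the disc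
    therefore lies in \<open>U\<close>.\<close>
  define \<mu> where "\<mu> = norm (h1 x0)"
  have "x0 \<in> ball z R - {z}" using x0(1) U \<delta> by auto
  then have \<mu>: "\<mu> > 0" using nz by (simp add: \<mu>_def h1_def)
  have sph: "norm (h1 x) \<ge> \<mu>" if "x \<in> sphere z \<delta>" for x using x0(2) sub that by (auto simp: \<mu>_def)
  have inU: "x \<in> U" if "x \<in> ball z \<delta>" "norm (h1 x) < \<mu>" for x
    using x0(2)[of x] that by (force simp: \<mu>_def)
  have hol': "h1 holomorphic_on ball z R" using hol by (simp add: h1_def)
  have AB: "FA holomorphic_on ball z R" "FB holomorphic_on ball z R"
    using FA FB R by (auto intro: holomorphic_on_subset)
  define I where "I = (\<lambda>A w. contour_integral (circlepath z \<delta>) (\<lambda>x. (A x * deriv h1 x) / (h1 x - w)) / (2 * pi * \<i>))"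
  have holI: "I A holomorphic_on ball 0 \<mu>" if "A holomorphic_on ball z R" for A
    unfolding I_def
  proof (intro holomorphic_intros contour_integral_Cauchy_kernel_holomorphic \<delta> sph)
    have "sphere z \<delta> \<subseteq> ball z R" using \<delta> by auto
    moreover have "(\<lambda>x. A x * deriv h1 x) holomorphic_on ball z R"
      by (intro holomorphic_intros that hol') auto
    ultimately show "continuous_on (sphere z \<delta>) (\<lambda>x. A x * deriv h1 x)" "continuous_on (sphere z \<delta>) h1"
      using hol' by (meson continuous_on_subset holomorphic_on_imp_continuous_on)+
  qed auto
  have posiff: "zorder (\<lambda>x. h x - w) x > 0 \<longleftrightarrow> h1 x = w" if "x \<in> ball z \<delta>" for x w
  proof -
    have xb: "x \<in> ball z R" using that \<delta> by auto
    have x: "Im x > 0" "x \<in> ball z R" using subsetD[OF R xb] xb by simp_all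
    have me: "h meromorphic_on {x}" using modular_function_meromorphic_at[OF h x(1), of 0] by simp
    have "(\<lambda>x. h1 x - w) analytic_on {x}"
      using hol' x(2) by (intro analytic_intros) (auto simp: analytic_at)
    moreover have "\<forall>\<^sub>F y in at x. h1 y - w \<noteq> 0"
      using eventually_remove_sings_eq_at[OF meromorphic_on_isolated_singularity[OF me]]
        modular_function_nonconst[OF h x(1), of w] by eventually_elim (simp add: h1_def)
    then have "\<exists>\<^sub>F y in at x. h1 y - w \<noteq> 0" by (rule eventually_frequently[OF trivial_limit_at])
    ultimately have "zorder (\<lambda>x. h1 x - w) x > 0 \<longleftrightarrow> h1 x - w = 0" by (rule zorder_pos_iff')
    then show ?thesis using zorder_remove_sings_diff[OF me, of w] by (simp add: h1_def)
  qed
  have eqz: "zorder (\<lambda>x. h1 x - w) x = zorder (\<lambda>x. h x - w) x" if "x \<in> ball z \<delta>" for x w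
  proof -
    have "x \<in> ball z R" using that \<delta> by auto
    then have "Im x > 0" using subsetD[OF R] by simp
    then have "h meromorphic_on {x}" using modular_function_meromorphic_at[OF h, of x 0] by simp
    then show ?thesis using zorder_remove_sings_diff by (simp add: h1_def)
  qed
  show ?thesis
  proof (rule that[OF \<mu> holI[OF AB(1)] holI[OF AB(2)]])
    fix w assume "w \<in> ball (0::complex) \<mu>"
    then have w: "norm w < \<mu>" by simp
    define T where "T = {x \<in> ball z \<delta>. h1 x = w}"
    have finT: "finite T"
      unfolding T_def by (rule fibre_sum_eq_contour_integral(1)[OF hol' AB(1) \<delta> sph w])
    have fsub: "{x \<in> U. fib h w x \<noteq> 0} \<subseteq> T"
    proof
      fix x assume x: "x \<in> {x \<in> U. fib h w x \<noteq> 0}"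
      then have xb: "x \<in> ball z \<delta>" using U(3) by blast
      have "zorder (\<lambda>x. h x - w) x > 0" by (rule fib_nonzero) (use x in simp)
      then show "x \<in> T" using posiff[OF xb, of w] xb by (simp add: T_def)
    qed
    then show "finite {x \<in> U. fib h w x \<noteq> 0}" using finT finite_subset by blast
    have "(\<Sum>x | x \<in> U \<and> fib h w x \<noteq> 0. fib h w x) = (\<Sum>x\<in>T. fib h w x)"
      by (rule sum.mono_neutral_left[OF finT fsub]) (use inU w in \<open>auto simp: T_def\<close>)
    \<comment> \<open>Multiplicities are integers, so they can be drawn into the conjugate, and the
      antiholomorphic part becomes the conjugate of a holomorphic fibre sum.\<close>
    also have "\<dots> = (\<Sum>x\<in>T. of_int (zorder (\<lambda>x. h1 x - w) x) * FA x + cnj (of_int (zorder (\<lambda>x. h1 x - w) x) * FB x))"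
    proof (rule sum.cong[OF refl])
      fix x assume "x \<in> T"
      then have x: "x \<in> ball z \<delta>" "h1 x = w" by (auto simp: T_def)
      have "x \<in> ball z R" using x \<delta> by auto
      then have "Im x > 0" using subsetD[OF R] by simp
      then show "fib h w x = of_int (zorder (\<lambda>x. h1 x - w) x) * FA x + cnj (of_int (zorder (\<lambda>x. h1 x - w) x) * FB x)"
        using posiff[OF x(1), of w] x(2) by (simp add: fib_def eqz[OF x(1)] F_eq algebra_simps)
    qed
    also have "\<dots> = I FA w + cnj (I FB w)"
      unfolding sum.distrib cnj_sum[symmetric] I_def T_def
      using fibre_sum_eq_contour_integral(2)[OF hol' AB(1) \<delta> sph w] fibre_sum_eq_contour_integral(2)[OF hol' AB(2) \<delta> sph w]
      by simp
    finally show "(\<Sum>x | x \<in> U \<and> fib h w x \<noteq> 0. fib h w x) = I FA w + cnj (I FB w)" .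
  qed
qed

end

section \<open>Local harmonicity of the fibre sums\<close>

text \<open>Translations preserve the height, and all other elements bring \<open>z\<close> to
  height at most \<open>1 / Im z\<close>. So the orbits of a compact set have bounded height, which
  separates them from a strip near the cusp.\<close>

lemma Gamma0star_Im_mob_le:
  assumes p: "p > 0" and A: "A \<in> Gamma0star p" and z: "Im z > 0"
  shows "Im (mob A z) \<le> max (Im z) (1 / Im z)"
proof (cases "A$2$1 = 0")
  case True
  from Gamma0star_upper_triangular[OF p A True] obtain n :: int
    where "A = mat2 1 (of_int n) 0 1 \<or> - A = mat2 1 (of_int n) 0 1" .
  then have "mob A z = mob (mat2 1 (of_int n) 0 1) z" by (metis mob_uminus)
  then show ?thesis by (simp add: mob_translation)
next
  case False
  have dt: "det A = 1" by (rule Gamma0star_det[OF p A])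
  have "Im z = 1 * Im z" by simp
  also have "\<dots> \<le> \<bar>A$2$1\<bar> * Im z" by (rule mult_right_mono) (use Gamma0star_lower_left[OF p A False] z in auto)
  also have "\<dots> = \<bar>Im (mob_den A z)\<bar>" using z by (simp add: mob_den_def abs_mult)
  also have "\<dots> \<le> norm (mob_den A z)" by (rule abs_Im_le_cmod)
  finally have "(Im z)\<^sup>2 \<le> (norm (mob_den A z))\<^sup>2" using z by (intro power_mono) auto
  then have "Im (mob A z) \<le> Im z / (Im z)\<^sup>2"
    unfolding Im_mob[OF dt z] using z mob_den_nonzero[OF dt z] by (intro divide_left_mono) auto
  also have "\<dots> = 1 / Im z" using z by (simp add: power2_eq_square)
  finally show ?thesis by simp
qed

lemma strip_equiv_imp_eq:
  assumes p: "p > 0" and A: "A \<in> Gamma0star p" and z: "Im z > 1" "0 \<le> Re z" "Re z < 1"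
    and Az: "Im (mob A z) > 1" "0 \<le> Re (mob A z)" "Re (mob A z) < 1"
  shows "A \<in> {mat 1, - mat 1}"
proof -
  obtain n :: int where n: "A = mat2 1 (of_int n) 0 1 \<or> - A = mat2 1 (of_int n) 0 1"
    using Gamma0star_Im_gt_1[OF p A z(1) Az(1)] .
  then have "mob A z = z + of_int n" using mob_translation[of n z] by (metis mob_uminus)
  then have "0 \<le> Re z + of_int n" "Re z + of_int n < 1" using Az by auto
  then have "n = 0" using z by linarith
  then have "mat2 1 (of_int n) 0 1 = (mat 1 :: real^2^2)" by (simp add: matrix_eq_2_iff mat_1_entries)
  then show ?thesis using n by (metis insertCI minus_minus)
qed

context harmonic_invariant
begin

text \<open>For small \<open>w\<close> every point of the fibre that contributes is equivalent to
  one near a zero of \<open>h\<close> or to one in the strip above \<open>Y'\<close>. The former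
  give a holomorphic plus an antiholomorphic function. The strip is left as an explicit sum whose
  finiteness the caller supplies: it is empty if \<open>h\<close> stays away from 0 at the cusp, and
  is treated through \<open>q_inf\<close> if \<open>h\<close> vanishes there.\<close>

lemma orbit_sum_fib_local:
  assumes h: "modular_function p h" and Y: "Y \<ge> 1"
    and no_zero: "\<And>z. Im z > Y \<Longrightarrow> zorder h z \<le> 0"
  obtains \<epsilon> P Q Y' where "\<epsilon> > 0" "Y' \<ge> Y" "P holomorphic_on ball 0 \<epsilon>" "Q holomorphic_on ball 0 \<epsilon>"
    "\<And>w. w \<in> ball 0 \<epsilon> \<Longrightarrow> finite {z. Im z > Y' \<and> 0 \<le> Re z \<and> Re z < 1 \<and> fib h w z \<noteq> 0} \<Longrightarrow>
       finite {a \<in> X0star p - {cusp p}. fib h w (rep a) \<noteq> 0} \<and>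
       orbit_sum p (fib h w) = P w + cnj (Q w) +
          (\<Sum>z | Im z > Y' \<and> 0 \<le> Re z \<and> Re z < 1 \<and> fib h w z \<noteq> 0. fib h w z)"
proof -
  note dt = Gamma0star_det[OF p_pos]
  \<comment> \<open>Every orbit has a point with real part in [0, 1) and height at least
    \<open>1 / (5 p)\<close>; if its height is at most \<open>Y\<close>, it lies in the compact
    rectangle \<open>K Y\<close>.\<close>
  define K where "K = (\<lambda>Y. cbox (Complex 0 (1 / (5 * real p))) (Complex 1 Y))"
  have Kc: "compact (K y)" and Ku: "K y \<subseteq> upper_half_plane" for y
  proof -
    show "compact (K y)" by (simp add: K_def)
    have "1 / (5 * real p) > 0" using p_pos by simp
    show "K y \<subseteq> upper_half_plane"
    proof
      fix x assume "x \<in> K y"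
      then have "Im x \<ge> 1 / (5 * real p)" by (simp add: K_def in_cbox_complex_iff)
      with \<open>1 / (5 * real p) > 0\<close> have "Im x > 0" by linarith
      then show "x \<in> upper_half_plane" by simp
    qed
  qed
  have KH: "Im x > 0" if "x \<in> K y" for x y using subsetD[OF Ku that] by simp
  have reduce: "\<exists>A\<in>Gamma0star p. 0 \<le> Re (mob A z) \<and> Re (mob A z) < 1 \<and> Im (mob A z) > 0 \<and> (Im (mob A z) > y \<or> mob A z \<in> K y)"
    if iz: "Im z > 0" for z y
  proof -
    obtain A where A: "A \<in> Gamma0star p" "Im (mob A z) \<ge> 1 / (5 * real p)" "0 \<le> Re (mob A z)" "Re (mob A z) < 1"
      using Gamma0star_reduce[OF p iz] .
    then show ?thesis using dt[OF A(1)] iz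
      by (intro bexI[of _ A]) (auto simp: K_def in_cbox_complex_iff)
  qed
  \<comment> \<open>\<open>rep\<close> chooses one point from each orbit of zeros, so distinct
    elements of \<open>Z\<close> are inequivalent.\<close>
  define Z where "Z = (\<lambda>z. rep (orbit p (Aff z))) ` {z \<in> K Y. zorder h z \<noteq> 0 \<and> zorder h z > 0}"
  have finZ: "finite Z"
    unfolding Z_def by (intro finite_imageI finite_subset[OF _ modular_function_finite_zeros[OF h Kc Ku]]) auto
  have ZH: "Z \<subseteq> upper_half_plane"
    using KH rep_orbit(1)[OF p_pos] by (auto simp: Z_def)
  have zord: "zorder h (mob A z) = zorder h z" if "A \<in> Gamma0star p" "Im z > 0" for A z
    using zorder_mob[OF p_pos h that, of 0] by simp
  have Zpos: "zorder h z > 0" if zZ: "z \<in> Z" for z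
  proof -
    obtain x where x: "x \<in> K Y" "zorder h x > 0" "z = rep (orbit p (Aff x))" using zZ unfolding Z_def by blast
    have ix: "Im x > 0" using x(1) by (rule KH)
    obtain A where "A \<in> Gamma0star p" "mob A x = z" using rep_equiv[OF p_pos ix] x(3) by metis
    then show ?thesis using zord[of A x] ix x(2) by simp
  qed
  have Zall: "\<exists>A\<in>Gamma0star p. mob A z \<in> Z" if z: "Im z > 0" "zorder h z > 0" for z
  proof -
    obtain A where A: "A \<in> Gamma0star p" "Im (mob A z) > 0" "Im (mob A z) > Y \<or> mob A z \<in> K Y"
      using reduce[OF z(1)] by blast
    have pos: "zorder h (mob A z) > 0" using zord[OF A(1) z(1)] z(2) by simp
    then have "mob A z \<in> K Y" using A(3) no_zero[of "mob A z"] by auto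
    then have inZ: "rep (orbit p (Aff (mob A z))) \<in> Z" using pos unfolding Z_def by auto
    obtain B where B: "B \<in> Gamma0star p" "mob B (mob A z) = rep (orbit p (Aff (mob A z)))"
      using rep_equiv[OF p_pos A(2)] by blast
    have "mob (B ** A) z \<in> Z" using inZ B mob_mult[OF dt[OF B(1)] dt[OF A(1)] z(1)] by simp
    then show ?thesis using Gamma0star_mult[OF p_pos B(1) A(1)] by blast
  qed
  have ineq: "z = w" if "z \<in> Z" "w \<in> Z" "A \<in> Gamma0star p" "mob A z = w" for z w A
  proof -
    obtain x y where xy: "x \<in> K Y" "y \<in> K Y" "z = rep (orbit p (Aff x))" "w = rep (orbit p (Aff y))"
      using \<open>z \<in> Z\<close> \<open>w \<in> Z\<close> unfolding Z_def by blast
    have i: "Im x > 0" "Im y > 0" "Im z > 0" "Im w > 0"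
      using KH[OF xy(1)] KH[OF xy(2)] subsetD[OF ZH \<open>z \<in> Z\<close>] subsetD[OF ZH \<open>w \<in> Z\<close>] by simp_all
    have "orbit p (Aff z) = orbit p (Aff w)" using orbit_Aff_eq_iff[OF p_pos i(3,4)] that(3,4) by blast
    then have "orbit p (Aff x) = orbit p (Aff y)"
      using rep_orbit(2)[OF p_pos i(1)] rep_orbit(2)[OF p_pos i(2)] xy by simp
    then show ?thesis using xy by simp
  qed
  have "\<forall>z\<in>Z. \<exists>R. R > 0 \<and> ball z R \<subseteq> upper_half_plane \<and> remove_sings h holomorphic_on ball z R \<and>
      (\<forall>x \<in> ball z R - {z}. remove_sings h x \<noteq> 0)"
  proof
    fix z assume "z \<in> Z"
    then have "Im z > 0" "zorder h z > 0" using ZH Zpos by auto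
    from modular_function_zero_nbhd[OF h this] show "\<exists>R. R > 0 \<and> ball z R \<subseteq> upper_half_plane \<and> remove_sings h holomorphic_on ball z R \<and>
      (\<forall>x \<in> ball z R - {z}. remove_sings h x \<noteq> 0)" by metis
  qed
  then obtain R where R: "\<And>z. z \<in> Z \<Longrightarrow> R z > 0" "\<And>z. z \<in> Z \<Longrightarrow> ball z (R z) \<subseteq> upper_half_plane"
      "\<And>z. z \<in> Z \<Longrightarrow> remove_sings h holomorphic_on ball z (R z)"
      "\<And>z x. z \<in> Z \<Longrightarrow> x \<in> ball z (R z) - {z} \<Longrightarrow> remove_sings h x \<noteq> 0"
    by metis
  have "\<forall>\<^sub>F \<delta> in at_right 0. \<forall>z\<in>Z. \<delta> < R z"
  proof (rule eventually_ball_finite[OF finZ], rule ballI)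
    fix z assume "z \<in> Z"
    then show "\<forall>\<^sub>F \<delta> in at_right 0. \<delta> < R z" using R(1)[of z] by (auto simp: eventually_at_right_field)
  qed
  moreover have "\<forall>\<^sub>F \<delta> in at_right 0. \<forall>z\<in>Z. cball z \<delta> \<subseteq> upper_half_plane \<and>
    (\<forall>w\<in>Z. \<forall>A\<in>Gamma0star p. (\<exists>x\<in>cball z \<delta>. mob A x \<in> cball w \<delta>) \<longrightarrow> z = w \<and> A \<in> stab p z)"
    by (rule separating_radius[OF p_pos finZ ZH]) (rule ineq)
  moreover have "\<forall>\<^sub>F \<delta> in at_right (0::real). 0 < \<delta>" by (rule eventually_at_right_less)
  ultimately have "\<forall>\<^sub>F \<delta> in at_right 0. (\<forall>z\<in>Z. \<delta> < R z) \<and> (\<forall>z\<in>Z. cball z \<delta> \<subseteq> upper_half_plane \<and>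
    (\<forall>w\<in>Z. \<forall>A\<in>Gamma0star p. (\<exists>x\<in>cball z \<delta>. mob A x \<in> cball w \<delta>) \<longrightarrow> z = w \<and> A \<in> stab p z)) \<and> 0 < \<delta>"
    by (intro eventually_conj)
  from eventually_happens[OF this]
  obtain \<delta> where \<delta>: "0 < \<delta>" "\<And>z. z \<in> Z \<Longrightarrow> \<delta> < R z" "\<And>z. z \<in> Z \<Longrightarrow> cball z \<delta> \<subseteq> upper_half_plane"
    "\<And>z w A x. z \<in> Z \<Longrightarrow> w \<in> Z \<Longrightarrow> A \<in> Gamma0star p \<Longrightarrow> x \<in> cball z \<delta> \<Longrightarrow> mob A x \<in> cball w \<delta> \<Longrightarrow> z = w \<and> A \<in> stab p z"
    by (simp only: trivial_limit_at_right_real) blast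
  define U where "U = (\<lambda>z. {x \<in> ball z \<delta>. \<forall>A\<in>stab p z. mob A x \<in> ball z \<delta>})"
  have U: "open (U z)" "z \<in> U z" "U z \<subseteq> ball z \<delta>" "\<And>A x. A \<in> stab p z \<Longrightarrow> x \<in> U z \<Longrightarrow> mob A x \<in> U z"
    if zZ: "z \<in> Z" for z
  proof -
    have iz: "Im z > 0" using ZH zZ by auto
    have b: "ball z \<delta> \<subseteq> upper_half_plane" using \<delta>(3)[OF zZ] ball_subset_cball by blast
    have c: "z \<in> ball z \<delta>" using \<delta>(1) by simp
    note * = stab_invariant_neighbourhood[OF p_pos iz open_ball c b]
    show "open (U z)" "z \<in> U z" "U z \<subseteq> ball z \<delta>" "\<And>A x. A \<in> stab p z \<Longrightarrow> x \<in> U z \<Longrightarrow> mob A x \<in> U z"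
      unfolding U_def using * by blast+
  qed
  have UH: "U z \<subseteq> upper_half_plane" if "z \<in> Z" for z
    using U(3)[OF that] \<delta>(3)[OF that] ball_subset_cball by blast
  \<comment> \<open>One height bound for all translates of the discs: above it the strip contains no
    point equivalent to a point of a disc.\<close>
  have "\<exists>Y'\<ge>Y. \<forall>z\<in>Z. \<forall>x\<in>cball z \<delta>. \<forall>A\<in>Gamma0star p. Im (mob A x) \<le> Y'"
  proof -
    have cpt: "compact (\<Union>z\<in>Z. cball z \<delta>)" using finZ by (intro compact_UN) auto
    have sub: "(\<Union>z\<in>Z. cball z \<delta>) \<subseteq> upper_half_plane" using \<delta>(3) by blast
    have "continuous_on (\<Union>z\<in>Z. cball z \<delta>) (\<lambda>x. max (Im x) (1 / Im x))"
      using sub by (intro continuous_intros) force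
    then have "bounded ((\<lambda>x. max (Im x) (1 / Im x)) ` (\<Union>z\<in>Z. cball z \<delta>))"
      using cpt compact_continuous_image compact_imp_bounded by blast
    then obtain M where M: "\<forall>y\<in>(\<lambda>x. max (Im x) (1 / Im x)) ` (\<Union>z\<in>Z. cball z \<delta>). norm y \<le> M"
      unfolding bounded_iff by blast
    have "Im (mob A x) \<le> max Y M" if "z \<in> Z" "x \<in> cball z \<delta>" "A \<in> Gamma0star p" for z x A
    proof -
      have xm: "x \<in> (\<Union>z\<in>Z. cball z \<delta>)" using that by blast
      have ix: "Im x > 0" using subsetD[OF sub xm] by simp
      have "norm (max (Im x) (1 / Im x)) \<le> M" using M xm by blast
      from order_trans[OF abs_ge_self this[unfolded real_norm_def]]
      show ?thesis using Gamma0star_Im_mob_le[OF p_pos that(3) ix] by linarith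
    qed
    then show ?thesis by (intro exI[of _ "max Y M"]) auto
  qed
  then obtain Y' where Y': "Y' \<ge> Y" "\<And>z x A. z \<in> Z \<Longrightarrow> x \<in> cball z \<delta> \<Longrightarrow> A \<in> Gamma0star p \<Longrightarrow> Im (mob A x) \<le> Y'"
    by blast
  define St where "St = {z. Im z > Y' \<and> 0 \<le> Re z \<and> Re z < 1}"
  have St_gt1: "Im z > 1" if "z \<in> St" for z using that Y Y'(1) by (auto simp: St_def)
  have "\<forall>z\<in>Z. \<exists>\<mu> P Q. \<mu> > 0 \<and> P holomorphic_on ball 0 \<mu> \<and> Q holomorphic_on ball 0 \<mu> \<and>
    (\<forall>w\<in>ball 0 \<mu>. finite {x \<in> U z. fib h w x \<noteq> 0} \<and> (\<Sum>x | x \<in> U z \<and> fib h w x \<noteq> 0. fib h w x) = P w + cnj (Q w))"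
  proof
    fix z assume zZ: "z \<in> Z"
    show "\<exists>\<mu> P Q. \<mu> > 0 \<and> P holomorphic_on ball 0 \<mu> \<and> Q holomorphic_on ball 0 \<mu> \<and>
    (\<forall>w\<in>ball 0 \<mu>. finite {x \<in> U z. fib h w x \<noteq> 0} \<and> (\<Sum>x | x \<in> U z \<and> fib h w x \<noteq> 0. fib h w x) = P w + cnj (Q w))"
    proof (rule disc_fibre_sum[OF h R(2,3,4)[OF zZ] \<delta>(1) \<delta>(2)[OF zZ] U(1,2,3)[OF zZ]])
      fix \<mu> P Q
      assume *: "\<mu> > 0" "P holomorphic_on ball 0 \<mu>" "Q holomorphic_on ball 0 \<mu>"
        "\<And>w. w \<in> ball 0 \<mu> \<Longrightarrow> finite {x \<in> U z. fib h w x \<noteq> 0}"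
        "\<And>w. w \<in> ball 0 \<mu> \<Longrightarrow> (\<Sum>x | x \<in> U z \<and> fib h w x \<noteq> 0. fib h w x) = P w + cnj (Q w)"
      show ?thesis by (intro exI[of _ \<mu>] exI[of _ P] exI[of _ Q] conjI ballI *)
    qed assumption
  qed
  then obtain \<mu> Pz Qz where PQ': "\<forall>z\<in>Z. \<mu> z > 0 \<and> Pz z holomorphic_on ball 0 (\<mu> z) \<and> Qz z holomorphic_on ball 0 (\<mu> z) \<and>
    (\<forall>w\<in>ball 0 (\<mu> z). finite {x \<in> U z. fib h w x \<noteq> 0} \<and>
      (\<Sum>x | x \<in> U z \<and> fib h w x \<noteq> 0. fib h w x) = Pz z w + cnj (Qz z w))"
    unfolding bchoice_iff by (elim exE) (rule that)
  have PQ: "\<And>z. z \<in> Z \<Longrightarrow> \<mu> z > 0" "\<And>z. z \<in> Z \<Longrightarrow> Pz z holomorphic_on ball 0 (\<mu> z)"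
      "\<And>z. z \<in> Z \<Longrightarrow> Qz z holomorphic_on ball 0 (\<mu> z)"
      "\<And>z w. z \<in> Z \<Longrightarrow> w \<in> ball 0 (\<mu> z) \<Longrightarrow> finite {x \<in> U z. fib h w x \<noteq> 0}"
      "\<And>z w. z \<in> Z \<Longrightarrow> w \<in> ball 0 (\<mu> z) \<Longrightarrow> (\<Sum>x | x \<in> U z \<and> fib h w x \<noteq> 0. fib h w x) = Pz z w + cnj (Qz z w)"
    using PQ' by simp_all
  \<comment> \<open>All points equivalent to a point of some \<open>U z\<close>; in particular all
    zeros of \<open>h\<close>.\<close>
  define W where "W = (\<Union>A\<in>Gamma0star p. \<Union>z\<in>Z. {x \<in> upper_half_plane. mob A x \<in> U z})"
  have W: "open W"
  proof -
    have "open {x \<in> upper_half_plane. mob A x \<in> U z}" if "A \<in> Gamma0star p" "z \<in> Z" for A z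
      using continuous_open_preimage[OF continuous_on_mob[OF dt[OF that(1)]] open_upper_half_plane U(1)[OF that(2)]]
      by (simp add: vimage_def Int_def)
    then show ?thesis unfolding W_def by blast
  qed
  \<comment> \<open>The poles of \<open>1 / h\<close> are the zeros of \<open>h\<close> and lie in
    \<open>W\<close>. With its other singularities removed, \<open>1 / h\<close> is thus bounded on
    the compact remainder \<open>K Y' - W\<close>, so \<open>h\<close> stays away from 0
    there.\<close>
  define g where "g = remove_sings (\<lambda>x. inverse (h x))"
  have mero_inv: "(\<lambda>x. inverse (h x)) meromorphic_on upper_half_plane"
    using h by (auto simp: modular_function_def intro!: meromorphic_intros)
  have ganal: "g analytic_on {x}" if x: "x \<in> K Y' - W" for x
  proof -
    have ix: "Im x > 0" using x KH by blast
    have nice: "g nicely_meromorphic_on upper_half_plane"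
      unfolding g_def by (rule remove_sings_nicely_meromorphic[OF mero_inv])
    have "\<not> is_pole g x"
    proof
      assume "is_pole g x"
      moreover have iso: "isolated_singularity_at (\<lambda>x. inverse (h x)) x"
        by (rule meromorphic_on_isolated_singularity, rule meromorphic_on_subset[OF mero_inv]) (use ix in simp)
      ultimately have pole: "is_pole (\<lambda>x. inverse (h x)) x" by (simp add: g_def)
      have me: "h meromorphic_on {x}" using modular_function_meromorphic_at[OF h ix, of 0] by simp
      have "isolated_zero (\<lambda>x. inverse (inverse (h x))) x" by (rule is_pole_imp_isolated_zero_inverse[OF pole])
      then have "zorder h x > 0"
        using zorder_isolated_zero_pos'[of h x] meromorphic_on_isolated_singularity[OF me] by simp
      then obtain A where A: "A \<in> Gamma0star p" "mob A x \<in> Z" using Zall ix by blast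
      then have "x \<in> W" unfolding W_def using U(2)[OF A(2)] ix by auto
      then show False using x by simp
    qed
    then show ?thesis using nicely_meromorphic_on_imp_analytic_at[OF nice] ix by auto
  qed
  have "continuous_on (K Y' - W) g"
    by (intro continuous_at_imp_continuous_on ballI analytic_at_imp_isCont ganal)
  then have "bounded (g ` (K Y' - W))"
    using compact_diff[OF Kc W] compact_continuous_image compact_imp_bounded by blast
  then obtain B where B: "B > 0" "\<And>x. x \<in> K Y' - W \<Longrightarrow> norm (g x) \<le> B"
    unfolding bounded_pos by auto
  \<comment> \<open>Below \<open>1 / (B + 1)\<close> the fibre avoids \<open>K Y' - W\<close>,
    because |1/w| would exceed \<open>B\<close>; below each \<open>\<mu> z\<close> the sum over
    \<open>U z\<close> has its local form.\<close>
  define \<epsilon> where "\<epsilon> = Min (insert (1 / (B + 1)) (\<mu> ` Z))"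
  have "\<epsilon> > 0" unfolding \<epsilon>_def using finZ PQ(1) B(1) by (subst Min_gr_iff) auto
  moreover have "\<epsilon> \<le> 1 / (B + 1)" unfolding \<epsilon>_def by (rule Min_le) (use finZ in simp_all)
  moreover have "\<epsilon> \<le> \<mu> z" if "z \<in> Z" for z unfolding \<epsilon>_def by (rule Min_le) (use finZ that in simp_all)
  ultimately have \<epsilon>: "\<epsilon> > 0" "\<epsilon> \<le> 1 / (B + 1)" "\<And>z. z \<in> Z \<Longrightarrow> \<epsilon> \<le> \<mu> z" by simp_all
  \<comment> \<open>The pieces to be summed: \<open>None\<close> stands for the strip, whose
    self-equivalences are 1 and -1, and \<open>Some z\<close> for the neighbourhood of the zero
    \<open>z\<close> with its stabilizer.\<close>
  define V where "V = (\<lambda>i. case i of None \<Rightarrow> St | Some z \<Rightarrow> U z)"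
  define S where "S = (\<lambda>i. case i of None \<Rightarrow> {mat 1, - mat 1} | Some z \<Rightarrow> stab p z)"
  define I where "I = insert None (Some ` Z)"
  define P where "P = (\<lambda>w. \<Sum>z\<in>Z. 2 / of_nat (card (stab p z)) * Pz z w)"
  define Q where "Q = (\<lambda>w. \<Sum>z\<in>Z. 2 / of_nat (card (stab p z)) * Qz z w)"
  have neq: "(mat 1 :: real^2^2) \<noteq> - mat 1" using det_not_uminus[OF p_pos, of "mat 1"] by simp
  show ?thesis
  proof (rule that[OF \<epsilon>(1) Y'(1), of P Q])
    have sub: "ball 0 \<epsilon> \<subseteq> ball (0::complex) (\<mu> z)" if "z \<in> Z" for z using \<epsilon>(3)[OF that] by auto
    show "P holomorphic_on ball 0 \<epsilon>"
      unfolding P_def by (intro holomorphic_intros holomorphic_on_subset[OF PQ(2) sub])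
    show "Q holomorphic_on ball 0 \<epsilon>"
      unfolding Q_def by (intro holomorphic_intros holomorphic_on_subset[OF PQ(3) sub])
    fix w assume w: "w \<in> ball (0::complex) \<epsilon>" and
      fin: "finite {z. Im z > Y' \<and> 0 \<le> Re z \<and> Re z < 1 \<and> fib h w z \<noteq> 0}"
    have St_eq: "{z \<in> St. fib h w z \<noteq> 0} = {z. Im z > Y' \<and> 0 \<le> Re z \<and> Re z < 1 \<and> fib h w z \<noteq> 0}"
      by (auto simp: St_def)
    have "finite {a \<in> X0star p - {cusp p}. fib h w (rep a) \<noteq> 0} \<and>
      orbit_sum p (fib h w) = (\<Sum>i\<in>I. 2 / of_nat (card (S i)) * (\<Sum>z | z \<in> V i \<and> fib h w z \<noteq> 0. fib h w z))"
    proof (rule orbit_sum_eq_local_sums[OF p_pos, where S = S and U = V and I = I])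
      show "finite I" using finZ by (simp add: I_def)
      show "finite (S i)" if "i \<in> I" for i
        using that finite_stab[OF p_pos] ZH by (auto simp: I_def S_def)
      show "V i \<subseteq> upper_half_plane" if "i \<in> I" for i
        using that UH St_gt1 by (fastforce simp: I_def V_def)
      show "A \<in> Gamma0star p \<and> mob A z \<in> V i" if "i \<in> I" "A \<in> S i" "z \<in> V i" for i A z
        using that U(4) mat_1_mem[OF p_pos] Gamma0star_uminus[OF p_pos mat_1_mem[OF p_pos]]
        by (auto simp: I_def S_def V_def stab_def)
      show "i = j \<and> A \<in> S i" if "i \<in> I" "j \<in> I" and A: "A \<in> Gamma0star p" and z: "z \<in> V i" "mob A z \<in> V j" for i j A z
      proof (cases i)
        case None
        show ?thesis
        proof (cases j)
          case None
          then show ?thesis using \<open>i = None\<close> z strip_equiv_imp_eq[OF p_pos A, of z] St_gt1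
            by (auto simp: V_def S_def St_def)
        next
          case (Some y)
          then have y0: "y \<in> Z" "mob A z \<in> U y" using \<open>j \<in> I\<close> z(2) by (auto simp: I_def V_def)
          then have y: "y \<in> Z" "mob A z \<in> cball y \<delta>" using subsetD[OF U(3)[OF y0(1)] y0(2)] by auto
          have zS: "z \<in> St" using z(1) None by (simp add: V_def)
          have "Im (mob (adj2 A) (mob A z)) \<le> Y'" by (rule Y'(2)[OF y Gamma0star_adj2[OF p_pos A]])
          then show ?thesis using mob_adj2[OF dt[OF A], of z] zS St_gt1[OF zS] by (simp add: St_def)
        qed
      next
        case (Some x)
        then have x0: "x \<in> Z" "z \<in> U x" using \<open>i \<in> I\<close> z(1) by (auto simp: I_def V_def)
        then have x: "x \<in> Z" "z \<in> cball x \<delta>" using subsetD[OF U(3)[OF x0(1)] x0(2)] by auto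
        show ?thesis
        proof (cases j)
          case None
          then have "mob A z \<in> St" using z(2) by (simp add: V_def)
          then show ?thesis using Y'(2)[OF x A] by (simp add: St_def)
        next
          case (Some y)
          then have y0: "y \<in> Z" "mob A z \<in> U y" using \<open>j \<in> I\<close> z(2) by (auto simp: I_def V_def)
          then have y: "y \<in> Z" "mob A z \<in> cball y \<delta>" using subsetD[OF U(3)[OF y0(1)] y0(2)] by auto
          then show ?thesis using \<delta>(4)[OF x(1) y(1) A x(2) y(2)] \<open>i = Some x\<close> Some by (auto simp: S_def)
        qed
      qed
      show "fib h w (mob A z) = fib h w z" if "A \<in> Gamma0star p" "Im z > 0" for A z
        by (rule fib_mob[OF h that])
      show "finite {z \<in> V i. fib h w z \<noteq> 0}" if "i \<in> I" for i
      proof (cases i)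
        case None then show ?thesis using fin St_eq by (simp add: V_def)
      next
        case (Some x)
        then have xZ: "x \<in> Z" using that unfolding I_def by blast
        have "finite {z \<in> U x. fib h w z \<noteq> 0}" by (rule PQ(4)[OF xZ subsetD[OF sub[OF xZ] w]])
        then show ?thesis using Some by (simp add: V_def)
      qed
      show "\<exists>A\<in>Gamma0star p. \<exists>i\<in>I. mob A z \<in> V i" if z: "Im z > 0" "fib h w z \<noteq> 0" for z
      proof -
        obtain A where A: "A \<in> Gamma0star p" "0 \<le> Re (mob A z)" "Re (mob A z) < 1" "Im (mob A z) > 0"
            "Im (mob A z) > Y' \<or> mob A z \<in> K Y'"
          using reduce[OF z(1)] by blast
        show ?thesis
        proof (cases "Im (mob A z) > Y'")
          case True
          then have "mob A z \<in> V None" using A by (simp add: V_def St_def)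
          then show ?thesis using A(1) by (auto simp: I_def)
        next
          case False
          define y where "y = mob A z"
          have y: "y \<in> K Y'" "Im y > 0" using False A by (auto simp: y_def)
          have pos: "zorder (\<lambda>x. h x - w) y > 0"
            using fib_nonzero[of h w y] fib_mob[OF h A(1) z(1), of w] z(2) by (simp add: y_def)
          have "y \<in> W"
          proof (rule ccontr)
            assume "y \<notin> W"
            then have yW: "y \<in> K Y' - W" using y by simp
            have lim: "h \<midarrow>y\<rightarrow> w" by (rule modular_function_zorder_pos_tendsto[OF h y(2) pos])
            show False
            \<comment> \<open>For \<open>w = 0\<close> the point is a zero of \<open>h\<close> and
              lies in \<open>W\<close> by construction; otherwise the bound on \<open>1 / h\<close>
              is violated by \<open>inverse w\<close>.\<close>
            proof (cases "w = 0")
              case True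
              then obtain C where C: "C \<in> Gamma0star p" "mob C y \<in> Z" using Zall[OF y(2)] pos by auto
              then have "y \<in> W" unfolding W_def using U(2)[OF C(2)] y by auto
              then show False using \<open>y \<notin> W\<close> by simp
            next
              case False
              have "(\<lambda>x. inverse (h x)) \<midarrow>y\<rightarrow> inverse w" by (intro tendsto_intros lim False)
              then have "g y = inverse w" unfolding g_def by (rule remove_sings_eqI)
              then have "inverse (norm w) \<le> B" using B(2)[OF yW] by (simp add: norm_inverse)
              moreover have "norm w < 1 / (B + 1)" using w \<epsilon>(2) by simp
              then have "inverse (norm w) > B + 1" using False B(1) by (simp add: field_simps)
              ultimately show False by simp
            qed
          qed
          then obtain C x where C: "C \<in> Gamma0star p" "x \<in> Z" "mob C y \<in> U x" unfolding W_def by blast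
          have "mob (C ** A) z \<in> V (Some x)"
            using mob_mult[OF dt[OF C(1)] dt[OF A(1)] z(1)] C by (simp add: y_def V_def)
          moreover have "C ** A \<in> Gamma0star p" by (rule Gamma0star_mult[OF p_pos C(1) A(1)])
          ultimately show ?thesis using C(2) by (auto simp: I_def)
        qed
      qed
      show "prime p \<or> p = 1" by (rule p)
    qed
    moreover have "(\<Sum>i\<in>I. 2 / of_nat (card (S i)) * (\<Sum>z | z \<in> V i \<and> fib h w z \<noteq> 0. fib h w z)) =
       P w + cnj (Q w) + (\<Sum>z | Im z > Y' \<and> 0 \<le> Re z \<and> Re z < 1 \<and> fib h w z \<noteq> 0. fib h w z)"
    proof -
      \<comment> \<open>For the strip the factor is \<open>2 / 2 = 1\<close>: its points have no
        stabilizer beyond sign.\<close>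
      have "(\<Sum>i\<in>I. 2 / of_nat (card (S i)) * (\<Sum>z | z \<in> V i \<and> fib h w z \<noteq> 0. fib h w z)) =
        (\<Sum>z | z \<in> St \<and> fib h w z \<noteq> 0. fib h w z) +
        (\<Sum>x\<in>Z. 2 / of_nat (card (stab p x)) * (\<Sum>z | z \<in> U x \<and> fib h w z \<noteq> 0. fib h w z))"
        unfolding I_def using finZ neq by (simp add: sum.reindex V_def S_def card_insert_if)
      also have "(\<Sum>x\<in>Z. 2 / of_nat (card (stab p x)) * (\<Sum>z | z \<in> U x \<and> fib h w z \<noteq> 0. fib h w z)) =
        (\<Sum>x\<in>Z. 2 / of_nat (card (stab p x)) * Pz x w + cnj (2 / of_nat (card (stab p x)) * Qz x w))"
      proof (rule sum.cong[OF refl])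
        fix x assume "x \<in> Z"
        then have "(\<Sum>z | z \<in> U x \<and> fib h w z \<noteq> 0. fib h w z) = Pz x w + cnj (Qz x w)" using PQ(5) sub w by blast
        then show "2 / of_nat (card (stab p x)) * (\<Sum>z | z \<in> U x \<and> fib h w z \<noteq> 0. fib h w z) =
          2 / of_nat (card (stab p x)) * Pz x w + cnj (2 / of_nat (card (stab p x)) * Qz x w)"
          by (simp add: distrib_left)
      qed
      also have "\<dots> = P w + cnj (Q w)" unfolding P_def Q_def by (simp add: sum.distrib)
      finally show ?thesis unfolding St_eq by simp
    qed
    ultimately show "finite {a \<in> X0star p - {cusp p}. fib h w (rep a) \<noteq> 0} \<and>
       orbit_sum p (fib h w) = P w + cnj (Q w) +
          (\<Sum>z | Im z > Y' \<and> 0 \<le> Re z \<and> Re z < 1 \<and> fib h w z \<noteq> 0. fib h w z)" by simp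
  qed
qed

end

section \<open>The cusp\<close>

lemma norm_q_inf: "norm (q_inf z) = exp (- 2 * pi * Im z)"
  by (simp add: q_inf_def)

lemma q_inf_nonzero [simp]: "q_inf z \<noteq> 0"
  by (simp add: q_inf_def)

lemma q_inf_holomorphic [holomorphic_intros]: "q_inf holomorphic_on A"
  unfolding q_inf_def[abs_def] by (intro holomorphic_intros)

lemma q_inf_analytic: "q_inf analytic_on A"
  using q_inf_holomorphic[of UNIV] by (auto simp: analytic_on_open intro: analytic_on_subset[of _ UNIV])

lemma deriv_q_inf_nonzero: "deriv q_inf z \<noteq> 0"
proof -
  have "(q_inf has_field_derivative 2 * of_real pi * \<i> * q_inf z) (at z)"
    unfolding q_inf_def[abs_def] by (auto intro!: derivative_eq_intros)
  then show ?thesis by (simp add: DERIV_imp_deriv)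
qed

lemma bij_betw_q_inf:
  "bij_betw q_inf {z. Im z > Y \<and> 0 \<le> Re z \<and> Re z < 1} (ball 0 (exp (- 2 * pi * Y)) - {0})"
proof (rule bij_betw_imageI)
  show "inj_on q_inf {z. Im z > Y \<and> 0 \<le> Re z \<and> Re z < 1}"
  proof (rule inj_onI)
    fix z w assume z: "z \<in> {z. Im z > Y \<and> 0 \<le> Re z \<and> Re z < 1}"
      and w: "w \<in> {z. Im z > Y \<and> 0 \<le> Re z \<and> Re z < 1}" and eq: "q_inf z = q_inf w"
    then obtain n :: int where "2 * of_real pi * \<i> * z = 2 * of_real pi * \<i> * w + of_real (of_int (2 * n) * pi) * \<i>"
      unfolding q_inf_def exp_eq by blast
    then have "2 * of_real pi * \<i> * z = 2 * of_real pi * \<i> * (w + of_int n)" by (simp add: algebra_simps)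
    then have zw: "z = w + of_int n" by simp
    then have "Re z = Re w + of_int n" by simp
    then have "n = 0" using z w by auto
    then show "z = w" using zw by simp
  qed
  show "q_inf ` {z. Im z > Y \<and> 0 \<le> Re z \<and> Re z < 1} = ball 0 (exp (- 2 * pi * Y)) - {0}"
  proof (intro equalityI subsetI)
    fix q :: complex assume q: "q \<in> ball 0 (exp (- 2 * pi * Y)) - {0}"
    define u where "u = Ln q / (2 * of_real pi * \<i>)"
    define z where "z = u - of_int \<lfloor>Re u\<rfloor>"
    have "2 * of_real pi * \<i> * z = Ln q + of_real (of_int (2 * (- \<lfloor>Re u\<rfloor>)) * pi) * \<i>"
      by (simp add: z_def u_def algebra_simps)
    then have "exp (2 * of_real pi * \<i> * z) = exp (Ln q)" unfolding exp_eq by blast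
    then have qz: "q_inf z = q" unfolding q_inf_def using q by simp
    have "exp (- 2 * pi * Im z) < exp (- 2 * pi * Y)" using q norm_q_inf[of z] qz by simp
    then have "Im z > Y" by simp
    moreover have "0 \<le> Re z" "Re z < 1" by (auto simp: z_def) linarith+
    ultimately show "q \<in> q_inf ` {z. Im z > Y \<and> 0 \<le> Re z \<and> Re z < 1}" using qz by blast
  qed (auto simp: norm_q_inf)
qed

lemma modular_function_diff_const:
  assumes "modular_function p h"
  shows "modular_function p (\<lambda>z. h z - c)"
proof -
  have "\<forall>\<^sub>F x in at z. h x - c \<noteq> w" if "Im z > 0" for z w
  proof -
    have "\<forall>\<^sub>F x in at z. h x \<noteq> w + c" using assms that by (auto simp: modular_function_def)
    then show ?thesis by eventually_elim auto
  qed
  moreover have "(\<lambda>z. h z - c) meromorphic_on upper_half_plane"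
    using assms unfolding modular_function_def by (intro meromorphic_on_diff meromorphic_on_const) blast
  ultimately show ?thesis using assms by (simp add: modular_function_def Gamma_invariant_def)
qed

lemma modular_function_inverse:
  assumes "modular_function p h"
  shows "modular_function p (\<lambda>z. inverse (h z))"
proof -
  have "\<forall>\<^sub>F x in at z. inverse (h x) \<noteq> w" if "Im z > 0" for z w
  proof -
    have "\<forall>\<^sub>F x in at z. h x \<noteq> inverse w" using assms that by (auto simp: modular_function_def)
    then show ?thesis by eventually_elim auto
  qed
  moreover have "(\<lambda>z. inverse (h z)) meromorphic_on upper_half_plane"
    using assms unfolding modular_function_def by (intro meromorphic_on_inverse) blast
  ultimately show ?thesis using assms by (simp add: modular_function_def Gamma_invariant_def)
qed

text \<open>From \<open>1 / h - s = - s (h - 1 / s) / h\<close> the two orders differ by that of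
  \<open>h\<close>. Where \<open>h\<close> has a zero or a pole this difference is nonzero, but then
  both orders are at most 0 and the maximum hides it.\<close>

lemma max_zorder_inverse_diff:
  assumes h: "h meromorphic_on {z}" and nc: "\<And>w. \<forall>\<^sub>F x in at z. h x \<noteq> w" and s: "s \<noteq> 0"
  shows "max 0 (zorder (\<lambda>x. inverse (h x) - s) z) = max 0 (zorder (\<lambda>x. h x - inverse s) z)"
proof -
  have fr: "\<exists>\<^sub>F x in at z. h x - w \<noteq> 0" for w
    using nc[of w] by (intro eventually_frequently) (auto simp: trivial_limit_at)
  have me: "(\<lambda>x. h x - w) meromorphic_on {z}" for w by (intro meromorphic_intros h)
  have "zorder (\<lambda>x. inverse (h x) - s) z = zorder (\<lambda>x. (- s) * ((h x - inverse s) / h x)) z"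
  proof (rule zorder_cong)
    show "\<forall>\<^sub>F x in at z. inverse (h x) - s = (- s) * ((h x - inverse s) / h x)"
      using nc[of 0] by eventually_elim (use s in \<open>simp add: field_simps\<close>)
  qed simp
  also have "\<dots> = zorder (\<lambda>x. (h x - inverse s) / h x) z" by (rule zorder_cmult) (use s in simp)
  also have "\<dots> = zorder (\<lambda>x. h x - inverse s) z - zorder h z"
    by (rule zorder_divide) (use me[of "inverse s"] fr[of "inverse s"] h fr[of 0] in auto)
  finally have eq: "zorder (\<lambda>x. inverse (h x) - s) z = zorder (\<lambda>x. h x - inverse s) z - zorder h z" .
  have c: "(\<lambda>_. inverse s) meromorphic_on {z}" "\<exists>\<^sub>F x in at z. inverse s \<noteq> 0" "zorder (\<lambda>_. inverse s) z = 0"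
    using s by (auto simp: frequently_const trivial_limit_at)
  have h0: "\<exists>\<^sub>F x in at z. h x \<noteq> 0" using fr[of 0] by simp
  consider "zorder h z < 0" | "zorder h z = 0" | "zorder h z > 0" by linarith
  then show ?thesis
  proof cases
    case 1
    then have "zorder (\<lambda>x. h x - inverse s) z = zorder h z" using zorder_diff1[OF h h0 c(1,2)] c(3) by simp
    then show ?thesis using eq 1 by simp
  next
    case 2 then show ?thesis using eq by simp
  next
    case 3
    then have "zorder (\<lambda>x. h x - inverse s) z = 0" using zorder_diff2[OF h h0 c(1,2)] c(3) by simp
    then show ?thesis using eq 3 by simp
  qed
qed

context harmonic_invariant
begin

lemma fib_inverse:
  assumes h: "modular_function p h" and z: "Im z > 0" and s: "s \<noteq> 0"
  shows "fib (\<lambda>x. inverse (h x)) s z = fib h (inverse s) z"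
proof -
  have "h meromorphic_on {z}" using modular_function_meromorphic_at[OF h z, of 0] by simp
  moreover have "\<forall>\<^sub>F x in at z. h x \<noteq> w" for w using h z by (auto simp: modular_function_def)
  ultimately show ?thesis using max_zorder_inverse_diff[of h z s] s by (simp add: fib_def)
qed

lemma fib_diff_const: "fib (\<lambda>x. h x - c) w = fib h (c + w)"
  by (simp add: fib_def fun_eq_iff diff_diff_eq)

lemma Im_rep_pos: "a \<in> X0star p - {cusp p} \<Longrightarrow> Im (rep a) > 0"
  using X0star_noncuspidal[OF p, of a] rep_orbit(1)[OF p_pos] by auto

lemma orbit_sum_cong:
  assumes "\<And>z. Im z > 0 \<Longrightarrow> \<psi> z = \<psi>' z"
  shows "orbit_sum p \<psi> = orbit_sum p \<psi>'"
proof -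
  have eq: "\<psi> (rep a) = \<psi>' (rep a)" if "a \<in> X0star p - {cusp p}" for a
    by (rule assms) (rule Im_rep_pos[OF that])
  have "{a. a \<in> X0star p - {cusp p} \<and> \<psi> (rep a) \<noteq> 0} = {a. a \<in> X0star p - {cusp p} \<and> \<psi>' (rep a) \<noteq> 0}"
    by (intro Collect_cong conj_cong refl) (simp only: eq)
  then show ?thesis unfolding orbit_sum_def by (rule sum.cong) (simp only: mem_Collect_eq eq)
qed

end

text \<open>\<open>Fm\<close> is the power series of \<open>F^-\<close> with conjugated
  coefficients, so that \<open>F^- = cnj (Fm (q))\<close> with \<open>Fm\<close> holomorphic; it
  vanishes at 0 as \<open>F^-\<close> has no constant term.\<close>

locale cusp_expansion = harmonic_invariant +
  fixes Fp :: "complex fls" and Fm :: "complex \<Rightarrow> complex" and m :: nat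
  assumes FA_eq: "\<And>z. Im z > 0 \<Longrightarrow> FA z = eval_fls Fp (q_inf z)" and Fp_rad: "fls_conv_radius Fp \<ge> 1"
    and FB_eq: "\<And>z. Im z > 0 \<Longrightarrow> FB z = Fm (q_inf z)" and Fm_hol: "Fm holomorphic_on ball 0 1" and Fm_0: "Fm 0 = 0"
    and Fp_nth: "\<And>n. n \<le> - int m \<Longrightarrow> fls_nth Fp n = 0"
begin

definition cusp_res :: "complex fls \<Rightarrow> nat \<Rightarrow> complex" where
  "cusp_res H i = fls_residue (Fp * H ^ i * fls_deriv H / H)"

end

text \<open>On the disc of radius \<open>R\<close> the expansion \<open>H\<close> converges and
  vanishes only at 0; \<open>R \<le> 1\<close> keeps it inside the discs of \<open>Fp\<close> and
  \<open>Fm\<close>. Heights above \<open>Y0\<close> give |q| < R, and \<open>Y0 \<ge> 1\<close>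
  ensures that only translations identify points in the strip up to sign.\<close>

locale cusp_zero_function = cusp_expansion +
  fixes h :: "complex \<Rightarrow> complex" and H :: "complex fls" and R Y0 :: real
  assumes h: "modular_function p h" and H: "fls_subdegree H \<ge> 1" and R: "0 < R" "R \<le> 1"
    and H_rad: "fls_conv_radius H \<ge> ereal R" and H_nz: "\<And>q. q \<noteq> 0 \<Longrightarrow> norm q < R \<Longrightarrow> eval_fls H q \<noteq> 0"
    and Y0: "Y0 \<ge> 1" "exp (- 2 * pi * Y0) < R" and h_eq: "\<And>z. Im z > Y0 \<Longrightarrow> h z = eval_fls H (q_inf z)"
begin

lemma H_hol: "eval_fls H holomorphic_on ball 0 R"
  using H by (intro holomorphic_on_eval_fls) (auto intro!: less_le_trans[OF _ H_rad])

lemma H_0: "eval_fls H 0 = 0"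
  using H by (simp add: eval_fls_at_0)

lemma q_small: "Im z > Y0 \<Longrightarrow> norm (q_inf z) < R"
proof -
  assume "Im z > Y0"
  then have "exp (- 2 * pi * Im z) < exp (- 2 * pi * Y0)" by simp
  then show ?thesis using Y0(2) unfolding norm_q_inf by linarith
qed

lemma h_analytic_nonzero:
  assumes z: "Im z > Y0"
  shows "h analytic_on {z}" "h z \<noteq> 0"
proof -
  have "(\<lambda>x. eval_fls H (q_inf x)) holomorphic_on {z. Im z > Y0}"
    by (rule holomorphic_on_compose_gen[OF q_inf_holomorphic H_hol, unfolded o_def]) (auto simp: q_small)
  then have "h holomorphic_on {z. Im z > Y0}" by (rule holomorphic_transform) (simp add: h_eq)
  then show "h analytic_on {z}"
    using z open_halfspace_Im_gt[of Y0] by (auto simp: analytic_at)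
  show "h z \<noteq> 0" using H_nz[OF q_inf_nonzero q_small[OF z]] h_eq[OF z] by simp
qed

lemma zorder_h_le_0: "Im z > Y0 \<Longrightarrow> zorder h z \<le> 0"
  using zorder_eq_0I[OF h_analytic_nonzero] by simp

lemma zorder_q_inf:
  assumes z: "Im z > Y0"
  shows "zorder (\<lambda>x. h x - w) z = zorder (\<lambda>q. eval_fls H q - w) (q_inf z)"
    and "zorder (\<lambda>x. h x - w) z > 0 \<longleftrightarrow> eval_fls H (q_inf z) = w"
proof -
  have iz: "Im z > 0" using z Y0 by simp
  have "\<forall>\<^sub>F x in at z. x \<in> {z. Im z > Y0}"
    by (rule eventually_at_in_open') (use z open_halfspace_Im_gt in auto)
  then have ev: "\<forall>\<^sub>F x in at z. h x - w = eval_fls H (q_inf x) - w"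
    by eventually_elim (simp add: h_eq)
  have qz: "q_inf z \<in> ball 0 R" using q_small[OF z] by simp
  have an: "(\<lambda>q. eval_fls H q - w) analytic_on {q_inf z}"
    using H_hol qz by (intro analytic_on_diff analytic_on_const) (metis analytic_at open_ball)
  \<comment> \<open>A witness that \<open>H - w\<close> is not identically 0: a point other than 0
    if \<open>w = 0\<close>, and the point 0 otherwise.\<close>
  have "\<exists>x\<in>ball 0 R. eval_fls H x - w \<noteq> 0"
  proof (cases "w = 0")
    case True
    then show ?thesis using H_nz[of "of_real (R/2)"] R by (intro bexI[of _ "of_real (R/2)"]) auto
  next
    case False
    then show ?thesis using H_0 R by (intro bexI[of _ 0]) auto
  qed
  then obtain x where x: "x \<in> ball 0 R" "eval_fls H x - w \<noteq> 0" by blast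
  have ne: "\<forall>\<^sub>F q in at (q_inf z). eval_fls H q - w \<noteq> 0"
  proof -
    have "\<forall>\<^sub>F q in at (q_inf z). eval_fls H q - w \<noteq> 0 \<and> q \<in> ball 0 R"
      by (rule non_zero_neighbour_alt[OF holomorphic_on_diff[OF H_hol holomorphic_on_const] open_ball connected_ball qz x(1) x(2)])
    then show ?thesis by eventually_elim simp
  qed
  have "zorder (\<lambda>x. h x - w) z = zorder (\<lambda>x. eval_fls H (q_inf x) - w) z"
    by (rule zorder_cong[OF ev refl])
  also have "\<dots> = zorder (\<lambda>q. eval_fls H q - w) (q_inf z)"
    by (rule zorder_compose_locally_injective[where f = "\<lambda>q. eval_fls H q - w" and g = q_inf])
       (use an ne q_inf_analytic deriv_q_inf_nonzero in \<open>auto intro: analytic_on_imp_meromorphic_on\<close>)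
  finally show eq: "zorder (\<lambda>x. h x - w) z = zorder (\<lambda>q. eval_fls H q - w) (q_inf z)" .
  have "\<exists>\<^sub>F q in at (q_inf z). eval_fls H q - w \<noteq> 0" by (rule eventually_frequently[OF trivial_limit_at ne])
  then show "zorder (\<lambda>x. h x - w) z > 0 \<longleftrightarrow> eval_fls H (q_inf z) = w"
    unfolding eq using zorder_pos_iff'[OF an] by simp
qed

text \<open>\<open>q_inf\<close> maps the strip bijectively to a punctured disc and preserves
  orders. The part from \<open>F^+\<close> is the punctured fibre sum with its residues. The part
  from \<open>F^-\<close> extends holomorphically over \<open>w = 0\<close>, up to conjugation, and
  tends to 0.\<close>

lemma cusp_sum:
  assumes Y: "Y \<ge> Y0"
  shows "\<forall>\<^sub>F s in at_infinity. finite {z. Im z > Y \<and> 0 \<le> Re z \<and> Re z < 1 \<and> fib h (inverse s) z \<noteq> 0}"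
    and "((\<lambda>s. (\<Sum>z | Im z > Y \<and> 0 \<le> Re z \<and> Re z < 1 \<and> fib h (inverse s) z \<noteq> 0. fib h (inverse s) z)
            - (\<Sum>i=1..m. cusp_res H i * s ^ i)) \<longlongrightarrow> cusp_res H 0) at_infinity"
proof -
  define r where "r = exp (- 2 * pi * Y)"
  have "exp (- 2 * pi * Y) \<le> exp (- 2 * pi * Y0)" using Y by simp
  then have r: "0 < r" "r < R" using Y0(2) unfolding r_def by (simp, linarith)
  define hh where "hh = eval_fls H"
  define A where "A = eval_fls Fp"
  have bij: "bij_betw q_inf {z. Im z > Y \<and> 0 \<le> Re z \<and> Re z < 1} (ball 0 r - {0})"
    unfolding r_def by (rule bij_betw_q_inf)
  have hol: "hh holomorphic_on ball 0 R" "Fm holomorphic_on ball 0 R"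
    using H_hol Fm_hol R by (auto simp: hh_def intro: holomorphic_on_subset)
  have ne: "sphere (0::complex) r \<noteq> {}" using r by simp
  have "continuous_on (sphere 0 r) (\<lambda>z. norm (hh z))"
    by (intro continuous_intros holomorphic_on_imp_continuous_on holomorphic_on_subset[OF hol(1)]) (use r in auto)
  from continuous_attains_inf[OF compact_sphere ne this]
  obtain x0 where x0: "x0 \<in> sphere 0 r" "\<And>z. z \<in> sphere 0 r \<Longrightarrow> norm (hh x0) \<le> norm (hh z)" by blast
  define \<mu> where "\<mu> = norm (hh x0)"
  have \<mu>: "\<mu> > 0" using x0(1) r H_nz[of x0] by (auto simp: \<mu>_def hh_def)
  have sph: "norm (hh z) \<ge> \<mu>" if "z \<in> sphere 0 r" for z using x0(2)[OF that] by (simp add: \<mu>_def)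
  define T where "T = (\<lambda>w. {q. q \<in> ball 0 r - {0} \<and> hh q = w})"
  define S where "S = (\<lambda>w. contour_integral (circlepath 0 r) (\<lambda>x. (Fm x * deriv hh x) / (hh x - w)) / (2 * pi * \<i>))"
  have Teq: "T w = {q \<in> ball 0 r. hh q = w}" if "w \<noteq> 0" for w
    using that H_0 by (auto simp: T_def hh_def)
  have finT: "finite (T w)" if "w \<noteq> 0" "norm w < \<mu>" for w
    unfolding Teq[OF that(1)] by (rule fibre_sum_eq_contour_integral(1)[OF hol r sph that(2)])
  have ST: "(\<Sum>q\<in>T w. of_int (zorder (\<lambda>x. hh x - w) q) * Fm q) = S w" if "w \<noteq> 0" "norm w < \<mu>" for w
    unfolding Teq[OF that(1)] S_def
    using fibre_sum_eq_contour_integral(2)[OF hol r sph that(2)] by simp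
  \<comment> \<open>The fibre above 0 in the full disc consists of \<open>q = 0\<close> alone, where
    \<open>Fm\<close> vanishes.\<close>
  have S0: "S 0 = 0"
  proof -
    have "{z \<in> ball 0 r. hh z = 0} = {0}" using H_0 H_nz r by (force simp: hh_def)
    then show ?thesis
      using fibre_sum_eq_contour_integral(2)[OF hol r sph, of 0] \<mu> Fm_0 by (simp add: S_def)
  qed
  have "S holomorphic_on ball 0 \<mu>"
    unfolding S_def
  proof (intro holomorphic_intros contour_integral_Cauchy_kernel_holomorphic r sph)
    have "(\<lambda>x. Fm x * deriv hh x) holomorphic_on ball 0 R" by (intro holomorphic_intros hol) auto
    moreover have "sphere 0 r \<subseteq> ball (0::complex) R" using r by auto
    ultimately show "continuous_on (sphere 0 r) (\<lambda>x. Fm x * deriv hh x)" "continuous_on (sphere 0 r) hh"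
      using hol(1) by (meson continuous_on_subset holomorphic_on_imp_continuous_on)+
  qed auto
  then have "isCont S 0" using \<mu> holomorphic_on_imp_continuous_on continuous_on_eq_continuous_at[OF open_ball] centre_in_ball by blast
  then have Slim: "(S \<longlongrightarrow> 0) (at 0)" using S0 by (simp add: isCont_def)
  have inv_inf: "filterlim inverse (at 0) (at_infinity :: complex filter)"
    using filterlim_inverse_at_iff[of "\<lambda>x::complex. x" at_infinity] by (simp add: filterlim_ident)
  have "\<forall>\<^sub>F w in at (0::complex). w \<noteq> 0 \<and> norm w < \<mu>"
    using eventually_at_ball'[OF \<mu>, of 0 UNIV] by eventually_elim simp
  then have ev: "\<forall>\<^sub>F s::complex in at_infinity. inverse s \<noteq> 0 \<and> norm (inverse s) < \<mu>"
    using filterlim_iff[THEN iffD1, OF inv_inf] by blast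
  have strip: "finite {z. Im z > Y \<and> 0 \<le> Re z \<and> Re z < 1 \<and> fib h w z \<noteq> 0} \<and>
      (\<Sum>z | Im z > Y \<and> 0 \<le> Re z \<and> Re z < 1 \<and> fib h w z \<noteq> 0. fib h w z) =
      (\<Sum>q\<in>T w. of_int (zorder (\<lambda>x. hh x - w) q) * A q) + cnj (S w)" if w: "w \<noteq> 0" "norm w < \<mu>" for w
  proof -
    define T' where "T' = {z. Im z > Y \<and> 0 \<le> Re z \<and> Re z < 1 \<and> hh (q_inf z) = w}"
    have bij': "bij_betw q_inf T' (T w)"
    proof (rule bij_betw_subset[OF bij])
      show "T' \<subseteq> {z. Im z > Y \<and> 0 \<le> Re z \<and> Re z < 1}" by (auto simp: T'_def)
      have "q_inf ` {z. Im z > Y \<and> 0 \<le> Re z \<and> Re z < 1} = ball 0 r - {0}" using bij by (rule bij_betw_imp_surj_on)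
      moreover have "q_inf ` T' = {q \<in> q_inf ` {z. Im z > Y \<and> 0 \<le> Re z \<and> Re z < 1}. hh q = w}"
        by (auto simp: T'_def)
      ultimately show "q_inf ` T' = T w" by (simp only: T_def)
    qed
    have finT': "finite T'" using bij_betw_finite[OF bij'] finT[OF w] by simp
    have sub: "{z. Im z > Y \<and> 0 \<le> Re z \<and> Re z < 1 \<and> fib h w z \<noteq> 0} \<subseteq> T'"
    proof
      fix z assume z: "z \<in> {z. Im z > Y \<and> 0 \<le> Re z \<and> Re z < 1 \<and> fib h w z \<noteq> 0}"
      then have "zorder (\<lambda>x. h x - w) z > 0" by (intro fib_nonzero) simp
      then show "z \<in> T'" using z zorder_q_inf(2)[of z w] Y by (simp add: T'_def hh_def)
    qed
    have "(\<Sum>z | Im z > Y \<and> 0 \<le> Re z \<and> Re z < 1 \<and> fib h w z \<noteq> 0. fib h w z) = (\<Sum>z\<in>T'. fib h w z)"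
      by (rule sum.mono_neutral_left[OF finT' sub]) (auto simp: T'_def)
    also have "\<dots> = (\<Sum>z\<in>T'. of_int (zorder (\<lambda>x. hh x - w) (q_inf z)) * A (q_inf z) +
        cnj (of_int (zorder (\<lambda>x. hh x - w) (q_inf z)) * Fm (q_inf z)))"
    proof (rule sum.cong[OF refl])
      fix z assume z: "z \<in> T'"
      then have zY: "Im z > Y0" and iz: "Im z > 0" using Y Y0 by (auto simp: T'_def)
      have "zorder (\<lambda>x. h x - w) z > 0" using zorder_q_inf(2)[OF zY] z by (simp add: T'_def hh_def)
      then show "fib h w z = of_int (zorder (\<lambda>x. hh x - w) (q_inf z)) * A (q_inf z) +
        cnj (of_int (zorder (\<lambda>x. hh x - w) (q_inf z)) * Fm (q_inf z))"
        using zorder_q_inf(1)[OF zY, of w]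
        by (simp add: fib_def F_eq[OF iz] FA_eq[OF iz] FB_eq[OF iz] hh_def A_def distrib_left)
    qed
    also have "\<dots> = (\<Sum>q\<in>T w. of_int (zorder (\<lambda>x. hh x - w) q) * A q + cnj (of_int (zorder (\<lambda>x. hh x - w) q) * Fm q))"
      by (rule sum.reindex_bij_betw[OF bij'])
    also have "\<dots> = (\<Sum>q\<in>T w. of_int (zorder (\<lambda>x. hh x - w) q) * A q) + cnj (S w)"
      unfolding sum.distrib cnj_sum[symmetric] ST[OF w] ..
    finally show ?thesis using finite_subset[OF sub finT'] by blast
  qed
  show "\<forall>\<^sub>F s in at_infinity. finite {z. Im z > Y \<and> 0 \<le> Re z \<and> Re z < 1 \<and> fib h (inverse s) z \<noteq> 0}"
    using ev by eventually_elim (use strip in blast)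
  have Fp_rad': "fls_conv_radius Fp \<ge> ereal R"
    using Fp_rad R(2) by (metis ereal_less_eq(3) one_ereal_def order_trans)
  have l1: "((\<lambda>s. (\<Sum>q\<in>T (inverse s). of_int (zorder (\<lambda>x. hh x - inverse s) q) * A q)
      - (\<Sum>i=1..m. cusp_res H i * s ^ i)) \<longlongrightarrow> cusp_res H 0) at_infinity"
    unfolding T_def hh_def A_def cusp_res_def
    by (rule punctured_fibre_sum_tendsto[OF H_rad Fp_rad' r H H_nz Fp_nth])
  have "((\<lambda>s. cnj (S (inverse s))) \<longlongrightarrow> cnj 0) at_infinity"
    by (intro tendsto_cnj filterlim_compose[OF Slim inv_inf])
  from tendsto_add[OF l1 this]
  have l2: "((\<lambda>s. (\<Sum>q\<in>T (inverse s). of_int (zorder (\<lambda>x. hh x - inverse s) q) * A q)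
      - (\<Sum>i=1..m. cusp_res H i * s ^ i) + cnj (S (inverse s))) \<longlongrightarrow> cusp_res H 0) at_infinity" by simp
  show "((\<lambda>s. (\<Sum>z | Im z > Y \<and> 0 \<le> Re z \<and> Re z < 1 \<and> fib h (inverse s) z \<noteq> 0. fib h (inverse s) z)
            - (\<Sum>i=1..m. cusp_res H i * s ^ i)) \<longlongrightarrow> cusp_res H 0) at_infinity"
  proof (rule Lim_transform_eventually[OF l2])
    show "\<forall>\<^sub>F s in at_infinity. (\<Sum>q\<in>T (inverse s). of_int (zorder (\<lambda>x. hh x - inverse s) q) * A q)
      - (\<Sum>i=1..m. cusp_res H i * s ^ i) + cnj (S (inverse s)) =
      (\<Sum>z | Im z > Y \<and> 0 \<le> Re z \<and> Re z < 1 \<and> fib h (inverse s) z \<noteq> 0. fib h (inverse s) z)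
            - (\<Sum>i=1..m. cusp_res H i * s ^ i)"
      using ev by eventually_elim (simp add: strip)
  qed
qed

end

section \<open>Fibre sums as polynomials\<close>

context cusp_zero_function
begin

lemma h_tendsto_cusp:
  assumes "e > 0"
  obtains Y where "Y \<ge> Y0" "\<And>z. Im z > Y \<Longrightarrow> norm (h z) < e"
proof -
  have "isCont (eval_fls H) 0"
    using holomorphic_on_imp_continuous_on[OF H_hol] R(1) by (simp add: continuous_on_eq_continuous_at)
  then obtain d where d: "d > 0" "\<And>q. norm q < d \<Longrightarrow> norm (eval_fls H q) < e"
    using assms H_0 by (auto simp: continuous_at_eps_delta dist_norm)
  define Y where "Y = max Y0 (- ln d / (2 * pi))"
  have "norm (h z) < e" if z: "Im z > Y" for z
  proof -
    have "- ln d / (2 * pi) < Im z" using z by (simp add: Y_def)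
    then have "- 2 * pi * Im z < ln d" by (simp add: field_simps)
    then have "exp (- 2 * pi * Im z) < exp (ln d)" by (subst exp_less_cancel_iff)
    then have "norm (q_inf z) < d" using d(1) by (simp add: norm_q_inf)
    then show ?thesis using d(2) h_eq[of z] z by (simp add: Y_def)
  qed
  then show ?thesis using that[of Y] by (simp add: Y_def)
qed

theorem orbit_sum_fib_inverse:
  "orbit_sum p (fib (\<lambda>z. inverse (h z)) s) =
     orbit_sum p (fib h 0) + cusp_res H 0 + (\<Sum>i=1..m. cusp_res H i * s ^ i)"
proof -
  define g where "g = (\<lambda>z. inverse (h z))"
  have g: "modular_function p g" unfolding g_def by (rule modular_function_inverse[OF h])
  \<comment> \<open>A polynomial is holomorphic, so subtracting it keeps the local form of the fibre
    sum; it also cancels the growth at infinity, so that a limit exists.\<close>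
  define v where "v = (\<lambda>s. orbit_sum p (fib g s) - (\<Sum>i=1..m. cusp_res H i * s ^ i))"
  have loc: "\<exists>e>0. \<exists>P Q. P holomorphic_on ball s0 e \<and> Q holomorphic_on ball s0 e \<and>
                  (\<forall>x\<in>ball s0 e. v x = P x + cnj (Q x))" for s0
  proof -
    define k where "k = (\<lambda>z. g z - s0)"
    have k: "modular_function p k" unfolding k_def by (rule modular_function_diff_const[OF g])
    have fib_k: "fib k w = fib g (s0 + w)" for w unfolding k_def by (rule fib_diff_const)
    have "norm s0 + 1 > 0" by (rule add_nonneg_pos) auto
    then have "1 / (norm s0 + 1) > 0" by simp
    \<comment> \<open>Above this height |1/h| > |s0| + 1, so the fibres of \<open>1 / h\<close> over
      the unit disc around \<open>s0\<close> do not reach the strip.\<close>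
    from h_tendsto_cusp[OF this] obtain Y where Y: "Y \<ge> Y0" "\<And>z. Im z > Y \<Longrightarrow> norm (h z) < 1 / (norm s0 + 1)" by blast
    have far: "zorder (\<lambda>x. k x - w) z = 0" if z: "Im z > Y" and w: "norm w < 1" for z w
    proof (rule zorder_eq_0I)
      have hz: "h analytic_on {z}" "h z \<noteq> 0" using h_analytic_nonzero[of z] z Y by auto
      then show "(\<lambda>x. k x - w) analytic_on {z}" unfolding k_def g_def by (intro analytic_intros) auto
      have "norm (g z) > norm s0 + 1"
      proof -
        have "norm (g z) = 1 / norm (h z)" by (simp add: g_def norm_inverse divide_inverse)
        moreover have "norm s0 + 1 < 1 / norm (h z)"
          using Y(2)[OF z] hz(2) \<open>norm s0 + 1 > 0\<close> by (simp add: less_divide_eq mult.commute)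
        ultimately show ?thesis by simp
      qed
      moreover have "norm (s0 + w) < norm s0 + 1" using norm_triangle_ineq[of s0 w] w by linarith
      ultimately have "g z \<noteq> s0 + w" by auto
      then show "k z - w \<noteq> 0" by (auto simp: k_def algebra_simps)
    qed
    have Y1: "Y \<ge> 1" using Y(1) Y0(1) by simp
    have nz: "zorder k z \<le> 0" if "Im z > Y" for z using far[OF that, of 0] by simp
    obtain \<epsilon> P Q Y' where *: "\<epsilon> > 0" "Y' \<ge> Y"
      "P holomorphic_on ball 0 \<epsilon>" "Q holomorphic_on ball 0 \<epsilon>"
      "\<And>w. w \<in> ball 0 \<epsilon> \<Longrightarrow> finite {z. Im z > Y' \<and> 0 \<le> Re z \<and> Re z < 1 \<and> fib k w z \<noteq> 0} \<Longrightarrow>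
       finite {a \<in> X0star p - {cusp p}. fib k w (rep a) \<noteq> 0} \<and>
       orbit_sum p (fib k w) = P w + cnj (Q w) +
          (\<Sum>z | Im z > Y' \<and> 0 \<le> Re z \<and> Re z < 1 \<and> fib k w z \<noteq> 0. fib k w z)" by (rule orbit_sum_fib_local[OF k Y1 nz], assumption, rule that, assumption+)
    define e where "e = min \<epsilon> 1"
    have e: "e > 0" using *(1) by (simp add: e_def)
    have val: "orbit_sum p (fib g x) = P (x - s0) + cnj (Q (x - s0))" if x: "x \<in> ball s0 e" for x
    proof -
      have w: "norm (x - s0) < \<epsilon>" "norm (x - s0) < 1" using x by (auto simp: e_def dist_norm norm_minus_commute)
      have empty: "{z. Im z > Y' \<and> 0 \<le> Re z \<and> Re z < 1 \<and> fib k (x - s0) z \<noteq> 0} = {}"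
        using far[OF _ w(2)] *(2) by (auto simp: fib_def)
      show ?thesis using *(5)[of "x - s0"] w(1) unfolding empty by (simp add: fib_k)
    qed
    have sub: "(\<lambda>x. x - s0) ` ball s0 e \<subseteq> ball 0 \<epsilon>" by (auto simp: e_def dist_norm norm_minus_commute)
    have PQ: "(\<lambda>x. P (x - s0)) holomorphic_on ball s0 e" "(\<lambda>x. Q (x - s0)) holomorphic_on ball s0 e"
      by (rule holomorphic_on_compose_gen[OF _ *(3) sub, unfolded o_def]
            holomorphic_on_compose_gen[OF _ *(4) sub, unfolded o_def];
          intro holomorphic_intros)+
    show ?thesis
      by (intro exI[of _ e] conjI e exI[of _ "\<lambda>x. P (x - s0) - (\<Sum>i=1..m. cusp_res H i * x ^ i)"]
           exI[of _ "\<lambda>x. Q (x - s0)"] PQ(2) holomorphic_intros PQ(1)) (auto simp: v_def val)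
  qed
  have lim: "(v \<longlongrightarrow> orbit_sum p (fib h 0) + cusp_res H 0) at_infinity"
  proof -
    obtain \<epsilon> P Q Y' where *: "\<epsilon> > 0" "Y' \<ge> Y0"
      "P holomorphic_on ball 0 \<epsilon>" "Q holomorphic_on ball 0 \<epsilon>"
      "\<And>w. w \<in> ball 0 \<epsilon> \<Longrightarrow> finite {z. Im z > Y' \<and> 0 \<le> Re z \<and> Re z < 1 \<and> fib h w z \<noteq> 0} \<Longrightarrow>
       finite {a \<in> X0star p - {cusp p}. fib h w (rep a) \<noteq> 0} \<and>
       orbit_sum p (fib h w) = P w + cnj (Q w) +
          (\<Sum>z | Im z > Y' \<and> 0 \<le> Re z \<and> Re z < 1 \<and> fib h w z \<noteq> 0. fib h w z)" by (rule orbit_sum_fib_local[OF h Y0(1) zorder_h_le_0], assumption, rule that, assumption+)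
    have empty: "{z. Im z > Y' \<and> 0 \<le> Re z \<and> Re z < 1 \<and> fib h 0 z \<noteq> 0} = {}"
      using zorder_h_le_0 *(2) by (auto simp: fib_def)
    have at0: "orbit_sum p (fib h 0) = P 0 + cnj (Q 0)"
      using *(5)[of 0] *(1) unfolding empty by simp
    have inv_inf: "filterlim inverse (at 0) (at_infinity :: complex filter)"
      using filterlim_inverse_at_iff[of "\<lambda>x::complex. x" at_infinity] by (simp add: filterlim_ident)
    have "(P \<longlongrightarrow> P 0) (at 0)" "(Q \<longlongrightarrow> Q 0) (at 0)"
      using holomorphic_on_imp_continuous_on[OF *(3)] holomorphic_on_imp_continuous_on[OF *(4)] *(1)
      by (simp_all add: continuous_on_eq_continuous_at isCont_def)
    then have "((\<lambda>s. P (inverse s)) \<longlongrightarrow> P 0) at_infinity" "((\<lambda>s. Q (inverse s)) \<longlongrightarrow> Q 0) at_infinity"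
      using filterlim_compose[OF _ inv_inf] by blast+
    then have l: "((\<lambda>s. P (inverse s) + cnj (Q (inverse s)) +
        ((\<Sum>z | Im z > Y' \<and> 0 \<le> Re z \<and> Re z < 1 \<and> fib h (inverse s) z \<noteq> 0. fib h (inverse s) z)
            - (\<Sum>i=1..m. cusp_res H i * s ^ i))) \<longlongrightarrow> P 0 + cnj (Q 0) + cusp_res H 0) at_infinity"
      by (intro tendsto_intros cusp_sum(2)[OF *(2)])
    have "\<forall>\<^sub>F w in at (0::complex). w \<noteq> 0 \<and> norm w < \<epsilon>"
      using eventually_at_ball'[OF *(1), of 0 UNIV] by eventually_elim simp
    then have "\<forall>\<^sub>F s::complex in at_infinity. inverse s \<noteq> 0 \<and> norm (inverse s) < \<epsilon>"
      using filterlim_iff[THEN iffD1, OF inv_inf] by blast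
    then have "\<forall>\<^sub>F s in at_infinity. P (inverse s) + cnj (Q (inverse s)) +
        ((\<Sum>z | Im z > Y' \<and> 0 \<le> Re z \<and> Re z < 1 \<and> fib h (inverse s) z \<noteq> 0. fib h (inverse s) z)
            - (\<Sum>i=1..m. cusp_res H i * s ^ i)) = v s"
      using cusp_sum(1)[OF *(2)]
    proof eventually_elim
      case (elim s)
      \<comment> \<open>Large \<open>s\<close> is thus governed by the local description of the
        fibres of \<open>h\<close> at \<open>w = 0\<close>, where the strip is no longer
        empty.\<close>
      have "orbit_sum p (fib g s) = orbit_sum p (fib h (inverse s))"
        unfolding g_def by (rule orbit_sum_cong) (use elim fib_inverse[OF h] in simp)
      then show ?case using *(5)[of "inverse s"] elim by (simp add: v_def)
    qed
    from Lim_transform_eventually[OF l this] show ?thesis by (simp add: at0)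
  qed
  have "v s = orbit_sum p (fib h 0) + cusp_res H 0" by (rule locally_harmonic_eq_limit[OF loc lim])
  then show ?thesis by (simp add: v_def g_def algebra_simps)
qed

end

section \<open>Finiteness and integrality of the divisor of a modular function\<close>

text \<open>Reduction moves every orbit either above \<open>Y\<close>, where the orders are 0, or
  into a compact rectangle, which contains finitely many zeros and poles.\<close>

lemma finite_divisor_support:
  assumes p: "prime p \<or> p = 1" and f: "modular_function p f" and Y: "\<And>z. Im z > Y \<Longrightarrow> zorder f z = 0"
  shows "finite {a \<in> X0star p - {cusp p}. zorder f (rep a) \<noteq> 0}"
proof -
  have p0: "p > 0" using p by (auto intro: prime_gt_0_nat)
  define K where "K = cbox (Complex 0 (1 / (5 * real p))) (Complex 1 Y)"
  have K: "K \<subseteq> upper_half_plane"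
  proof
    fix x assume "x \<in> K"
    then have "Im x \<ge> 1 / (5 * real p)" by (simp add: K_def in_cbox_complex_iff)
    moreover have "1 / (5 * real p) > 0" using p0 by simp
    ultimately have "Im x > 0" by linarith
    then show "x \<in> upper_half_plane" by simp
  qed
  have "{a \<in> X0star p - {cusp p}. zorder f (rep a) \<noteq> 0} \<subseteq> (\<lambda>z. orbit p (Aff z)) ` {z \<in> K. zorder f z \<noteq> 0}"
  proof
    fix a assume a: "a \<in> {a \<in> X0star p - {cusp p}. zorder f (rep a) \<noteq> 0}"
    then obtain z where z: "Im z > 0" "a = orbit p (Aff z)" using X0star_noncuspidal[OF p, of a] by auto
    define r where "r = rep a"
    have r: "Im r > 0" "orbit p (Aff r) = a" using rep_orbit[OF p0 z(1)] z(2) by (auto simp: r_def)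
    obtain A where A: "A \<in> Gamma0star p" "Im (mob A r) \<ge> 1 / (5 * real p)" "0 \<le> Re (mob A r)" "Re (mob A r) < 1"
      using Gamma0star_reduce[OF p r(1)] .
    have "zorder f (mob A r) = zorder f r" using zorder_mob[OF p0 f A(1) r(1), of 0] by simp
    then have nz: "zorder f (mob A r) \<noteq> 0" using a by (simp add: r_def)
    then have "Im (mob A r) \<le> Y" using Y[of "mob A r"] by (meson not_less)
    then have "mob A r \<in> K" using A by (simp add: K_def in_cbox_complex_iff)
    moreover have "Im (mob A r) > 0" using Gamma0star_det[OF p0 A(1)] r(1) by simp
    then have "orbit p (Aff (mob A r)) = a" using orbit_Aff_eq_iff[OF p0 r(1)] A(1) r(2) by metis
    ultimately show "a \<in> (\<lambda>z. orbit p (Aff z)) ` {z \<in> K. zorder f z \<noteq> 0}" using nz by blast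
  qed
  moreover have "finite {z \<in> K. zorder f z \<noteq> 0}"
    by (rule modular_function_finite_zeros[OF f _ K]) (simp add: K_def)
  ultimately show ?thesis using finite_surj by blast
qed

text \<open>
  The values \<open>c z + d\<close> on the stabilizer form a finite group of roots of unity of order \<open>2 e\<close>,
  hence contain a primitive one.
\<close>

lemma ram_index_dvd_zorder:
  assumes p: "p > 0" and f: "modular_function p f" and z: "Im z > 0"
  shows "int (ram_index p z) dvd zorder f z"
proof -
  note dt = Gamma0star_det[OF p]
  define e where "e = ram_index p z"
  have e: "e > 0" unfolding e_def by (rule ram_index_pos[OF p z])
  define n where "n = zorder f z"
  define M where "M = (\<lambda>A. mob_den A z) ` stab p z"
  have finM: "finite M" unfolding M_def using finite_stab[OF p z] by simp
  have nzM: "x \<noteq> 0" if "x \<in> M" for x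
    using that mob_den_nonzero dt z by (auto simp: M_def stab_def)
  have multM: "x * y \<in> M" if xy: "x \<in> M" "y \<in> M" for x y
  proof -
    obtain A B where AB: "A \<in> stab p z" "x = mob_den A z" "B \<in> stab p z" "y = mob_den B z" using xy unfolding M_def by blast
    have "mob_den (A ** B) z = x * y" using mob_den_mult[of B z A] AB dt z by (simp add: stab_def)
    moreover have "A ** B \<in> stab p z"
      using AB Gamma0star_mult[OF p] mob_mult[of A B z] dt z by (simp add: stab_def)
    ultimately show ?thesis unfolding M_def by (metis imageI)
  qed
  \<comment> \<open>\<open>A\<close> is recovered from \<open>cz + d\<close>: as \<open>z\<close> is
    fixed, \<open>az + b = z (cz + d)\<close>, and real coefficients are determined by the value at
    a nonreal point.\<close>
  have inj: "inj_on (\<lambda>A. mob_den A z) (stab p z)"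
  proof (rule inj_onI)
    fix A B assume A: "A \<in> stab p z" and B: "B \<in> stab p z" and eq: "mob_den A z = mob_den B z"
    then have dA: "det A = 1" and dB: "det B = 1" and mA: "mob A z = z" and mB: "mob B z = z"
      using dt by (auto simp: stab_def)
    have row: "a = a' \<and> b = b'" if "of_real a * z + of_real b = of_real a' * z + of_real b'" for a b a' b'
    proof -
      have "Im (of_real a * z + of_real b) = Im (of_real a' * z + of_real b')" using that by simp
      then have "a = a'" using z by simp
      then show ?thesis using that by simp
    qed
    have "of_real (A$1$1) * z + of_real (A$1$2) = z * mob_den A z"
      using mA mob_den_nonzero[OF dA z] unfolding mob_altdef by (simp add: field_simps)
    also have "\<dots> = of_real (B$1$1) * z + of_real (B$1$2)"
      using mB mob_den_nonzero[OF dB z] unfolding mob_altdef eq by (simp add: field_simps)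
    finally show "A = B" using row eq unfolding matrix_eq_2_iff mob_den_def by blast
  qed
  have cM: "card M = 2 * e" unfolding M_def card_image[OF inj] e_def by (rule card_stab[OF p z])
  \<comment> \<open>Multiplication by \<open>x\<close> permutes \<open>M\<close>; comparing the
    products over \<open>M\<close> gives the exponent \<open>card M\<close>.\<close>
  have root: "x ^ (2 * e) = 1" if x: "x \<in> M" for x
  proof -
    have "bij_betw (\<lambda>y. x * y) M M"
      by (rule bij_betw_imageI[OF _ endo_inj_surj[OF finM]]) (use nzM[OF x] multM[OF x] in \<open>auto simp: inj_on_def\<close>)
    then have "(\<Prod>y\<in>M. x * y) = (\<Prod>y\<in>M. y)" by (rule prod.reindex_bij_betw)
    moreover have "(\<Prod>y\<in>M. y) \<noteq> 0" using finM nzM by simp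
    ultimately show ?thesis by (simp add: prod.distrib cM)
  qed
  have "M = {x. x ^ (2 * e) = 1}"
    by (rule card_subset_eq[OF finite_roots_unity]) (use root e card_roots_unity_eq[of "2 * e"] cM in auto)
  moreover define \<zeta> where "\<zeta> = cis (2 * pi / real (2 * e))"
  moreover have "\<zeta> ^ (2 * e) = 1"
  proof -
    have "\<zeta> ^ (2 * e) = cis (real (2 * e) * (2 * pi / real (2 * e)))" unfolding \<zeta>_def by (rule Complex.DeMoivre)
    also have "real (2 * e) * (2 * pi / real (2 * e)) = 2 * pi" using e by simp
    finally show ?thesis by simp
  qed
  ultimately have "\<zeta> \<in> M" by simp
  then obtain A where A: "A \<in> stab p z" "mob_den A z = \<zeta>" unfolding M_def by blast
  have dA: "det A = 1" and AG: "A \<in> Gamma0star p" and mA: "mob A z = z" using A dt by (auto simp: stab_def)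
  text \<open>Comparing leading coefficients at the fixed point, where the derivative of \<open>A\<close> is \<open>\<zeta>\<^sup>-\<^sup>2\<close>.\<close>
  have me: "f meromorphic_on {z}" using modular_function_meromorphic_at[OF f z, of 0] by simp
  have nz: "\<forall>\<^sub>F x in at z. f x \<noteq> 0" using modular_function_nonconst[OF f z, of 0] by simp
  obtain r where r: "zor_poly f z z \<noteq> 0" "r > 0" "zor_poly f z holomorphic_on cball z r"
    "\<And>w. w \<in> cball z r - {z} \<Longrightarrow> f w = zor_poly f z w * (w - z) powi n"
    using zorder_exist[of f z] me nz eventually_frequently[OF trivial_limit_at nz]
    unfolding n_def by (auto simp: meromorphic_at_iff)
  define k where "k = zor_poly f z"
  have kc: "(k \<longlongrightarrow> k z) (at z)"
    using holomorphic_on_imp_continuous_on[OF r(3)] r(2) unfolding k_def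
    by (metis centre_in_ball continuous_on_interior interior_cball isCont_def)
  have der: "(mob A has_field_derivative 1 / \<zeta>\<^sup>2) (at z)" using mob_has_field_derivative[OF dA z] A(2) by simp
  have Acont: "((\<lambda>w. mob A w) \<longlongrightarrow> z) (at z)" using DERIV_isCont[OF der] mA by (simp add: isCont_def)
  have quot: "((\<lambda>w. (mob A w - z) / (w - z)) \<longlongrightarrow> 1 / \<zeta>\<^sup>2) (at z)"
    using der mA by (simp add: has_field_derivative_iff)
  have \<zeta>0: "\<zeta> \<noteq> 0" by (simp add: \<zeta>_def)
  have ev_ne: "\<forall>\<^sub>F w in at z. mob A w \<noteq> z"
  proof -
    have "\<forall>\<^sub>F w in at z. w \<in> upper_half_plane - {z}" by (rule eventually_at_in_open) (use z in auto)
    then show ?thesis by eventually_elim (use mob_eq_iff[OF dA] mA z in \<open>metis Diff_iff singletonI upper_half_plane_iff\<close>)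
  qed
  have limAt: "filterlim (mob A) (at z) (at z)" by (rule filterlim_atI[OF Acont ev_ne])
  have "((\<lambda>w. k (mob A w) / k w * ((mob A w - z) / (w - z)) powi n) \<longlongrightarrow> k z / k z * (1 / \<zeta>\<^sup>2) powi n) (at z)"
    by (intro tendsto_intros kc quot filterlim_compose[OF kc limAt]) (use r(1) \<zeta>0 in \<open>auto simp: k_def\<close>)
  moreover have "\<forall>\<^sub>F w in at z. k (mob A w) / k w * ((mob A w - z) / (w - z)) powi n = 1"
  proof -
    have e1: "\<forall>\<^sub>F w in at z. w \<in> ball z r - {z}" using r(2) by (intro eventually_at_in_open) auto
    then have e2: "\<forall>\<^sub>F w in at z. mob A w \<in> ball z r - {z}" using filterlim_iff[THEN iffD1, OF limAt] by blast
    have e3: "\<forall>\<^sub>F w in at z. w \<in> upper_half_plane" by (rule eventually_at_in_open') (use z in auto)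
    show ?thesis using e1 e2 e3 nz
    proof eventually_elim
      case (elim w)
      have "f (mob A w) = f w" using f AG elim(3) by (auto simp: modular_function_def Gamma_invariant_def)
      moreover have "f w = k w * (w - z) powi n" unfolding k_def by (rule r(4)) (use elim in auto)
      moreover have "f (mob A w) = k (mob A w) * (mob A w - z) powi n" unfolding k_def by (rule r(4)) (use elim in auto)
      ultimately have "k (mob A w) * (mob A w - z) powi n = k w * (w - z) powi n" "k w * (w - z) powi n \<noteq> 0"
        using elim(4) by auto
      then show ?case by (simp add: power_int_divide_distrib field_simps)
    qed
  qed
  ultimately have "((\<lambda>_. 1) \<longlongrightarrow> k z / k z * (1 / \<zeta>\<^sup>2) powi n) (at z)" by (rule Lim_transform_eventually)
  then have "(1 / \<zeta>\<^sup>2) powi n = 1" using r(1) tendsto_const_iff[of "at z" "1::complex"] by (simp add: k_def trivial_limit_at)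
  then have z1: "(\<zeta>\<^sup>2) powi n = 1" by (simp add: power_int_divide_distrib field_simps)
  \<comment> \<open>The square has exact order \<open>e\<close>, so its \<open>n\<close>-th power
    being 1 means that \<open>e\<close> divides \<open>n\<close>. The factor 2 in the order of the
    stabilizer disappears here.\<close>
  have "\<zeta>\<^sup>2 = cis (2 * pi / real e)" unfolding \<zeta>_def by (simp add: Complex.DeMoivre)
  then have "(\<zeta>\<^sup>2) powi n = cis (of_int n * (2 * pi / real e))" by (simp add: cis_power_int)
  then have "cis (of_int n * (2 * pi / real e)) = 1" using z1 by simp
  then have "cos (of_int n * (2 * pi / real e)) = 1" by (simp add: complex_eq_iff)
  then obtain j :: int where "of_int n * (2 * pi / real e) = of_int j * 2 * pi" by (auto simp: cos_one_2pi_int)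
  then have "real_of_int n = of_int j * real e" using e by (simp add: field_simps)
  then have "n = j * int e" by (metis of_int_eq_iff of_int_mult of_int_of_nat_eq)
  then show ?thesis by (simp add: e_def n_def)
qed

section \<open>Principal divisors\<close>

lemma eventually_at_i_inf_q_inf:
  "(\<forall>\<^sub>F \<tau> in at_i_inf. P (q_inf \<tau>)) \<longleftrightarrow> (\<forall>\<^sub>F q in at 0. P q)"
proof
  assume "\<forall>\<^sub>F \<tau> in at_i_inf. P (q_inf \<tau>)"
  then obtain Y where Y: "\<And>\<tau>. Im \<tau> \<ge> Y \<Longrightarrow> P (q_inf \<tau>)"
    by (auto simp: eventually_filtercomap_at_top_linorder)
  have "\<forall>\<^sub>F q in at 0. q \<in> ball 0 (exp (- 2 * pi * Y)) - {0 :: complex}"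
    by (rule eventually_at_in_open) auto
  then show "\<forall>\<^sub>F q in at 0. P q"
  proof eventually_elim
    case (elim q)
    then obtain \<tau> where "Im \<tau> > Y" "q = q_inf \<tau>"
      using bij_betw_imp_surj_on[OF bij_betw_q_inf[of Y]] by blast
    then show ?case using Y by simp
  qed
next
  assume "\<forall>\<^sub>F q in at 0. P q"
  then obtain d where d: "d > 0" "\<And>q. q \<noteq> 0 \<Longrightarrow> norm q < d \<Longrightarrow> P q"
    by (auto simp: eventually_at)
  have "P (q_inf \<tau>)" if "Im \<tau> > - ln d / (2 * pi)" for \<tau>
  proof -
    have "- 2 * pi * Im \<tau> < ln d" using that by (simp add: field_simps)
    then have "exp (- 2 * pi * Im \<tau>) < exp (ln d)" by (subst exp_less_cancel_iff)
    then show ?thesis using d by (simp add: norm_q_inf)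
  qed
  then show "\<forall>\<^sub>F \<tau> in at_i_inf. P (q_inf \<tau>)"
    unfolding eventually_filtercomap_at_top_dense by blast
qed

text \<open>\<open>q_inf\<close> turns neighbourhoods of the cusp into punctured neighbourhoods of
  0, so uniqueness, inverses and differences of \<open>q\<close>-expansions are inherited from
  Laurent expansions.\<close>

lemma has_q_expansion_iff_laurent:
  assumes "\<forall>\<^sub>F \<tau> in at_i_inf. f \<tau> = \<phi> (q_inf \<tau>)"
  shows "has_q_expansion f L \<longleftrightarrow> \<phi> has_laurent_expansion L"
proof -
  have "(\<forall>\<^sub>F \<tau> in at_i_inf. f \<tau> = eval_fls L (q_inf \<tau>)) \<longleftrightarrow> (\<forall>\<^sub>F \<tau> in at_i_inf. \<phi> (q_inf \<tau>) = eval_fls L (q_inf \<tau>))"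
    by (rule eventually_cong[OF assms]) simp
  also have "\<dots> \<longleftrightarrow> (\<forall>\<^sub>F q in at 0. \<phi> q = eval_fls L q)" by (rule eventually_at_i_inf_q_inf)
  finally show ?thesis by (simp add: has_q_expansion_def has_laurent_expansion_def eq_commute)
qed

lemma has_q_expansionD:
  assumes "has_q_expansion f L"
  shows "\<forall>\<^sub>F \<tau> in at_i_inf. f \<tau> = eval_fls L (q_inf \<tau>)" "eval_fls L has_laurent_expansion L"
  using assms by (auto simp: has_q_expansion_def intro: eval_fls_has_laurent_expansion)

lemma q_expansion_eqI:
  assumes "has_q_expansion f L"
  shows "q_expansion f = L"
  unfolding q_expansion_def
proof (rule the_equality)
  show "has_q_expansion f L" by fact
next
  fix L' assume "has_q_expansion f L'"
  then have "eval_fls L has_laurent_expansion L'"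
    using has_q_expansion_iff_laurent[OF has_q_expansionD(1)[OF assms]] by blast
  then show "L' = L" by (rule has_laurent_expansion_unique[OF _ has_q_expansionD(2)[OF assms]])
qed

lemma has_q_expansion_inverse:
  assumes "has_q_expansion f L"
  shows "has_q_expansion (\<lambda>\<tau>. inverse (f \<tau>)) (inverse L)"
proof -
  have "\<forall>\<^sub>F \<tau> in at_i_inf. inverse (f \<tau>) = inverse (eval_fls L (q_inf \<tau>))"
    using has_q_expansionD(1)[OF assms] by eventually_elim simp
  then show ?thesis
    using has_q_expansion_iff_laurent[of "\<lambda>\<tau>. inverse (f \<tau>)" "\<lambda>q. inverse (eval_fls L q)" "inverse L"]
      has_laurent_expansion_inverse[OF has_q_expansionD(2)[OF assms]] by blast
qed

lemma has_q_expansion_diff_const: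
  assumes "has_q_expansion f L"
  shows "has_q_expansion (\<lambda>\<tau>. f \<tau> - c) (L - fls_const c)"
proof -
  have "\<forall>\<^sub>F \<tau> in at_i_inf. f \<tau> - c = eval_fls L (q_inf \<tau>) - c"
    using has_q_expansionD(1)[OF assms] by eventually_elim simp
  then show ?thesis
    using has_q_expansion_iff_laurent[of "\<lambda>\<tau>. f \<tau> - c" "\<lambda>q. eval_fls L q - c" "L - fls_const c"]
      has_laurent_expansion_diff[OF has_q_expansionD(2)[OF assms] has_laurent_expansion_const[of c]] by blast
qed

lemma has_q_expansion_const: "has_q_expansion (\<lambda>_. c) (fls_const c)"
  by (simp add: has_q_expansion_def)

lemma q_expansion_nonzero:
  assumes f: "modular_function p f" and L: "has_q_expansion f L"
  shows "L \<noteq> 0"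
proof
  assume "L = 0"
  then obtain Y where Y: "\<And>\<tau>. Im \<tau> > Y \<Longrightarrow> f \<tau> = 0"
    using L by (auto simp: has_q_expansion_def eventually_filtercomap_at_top_dense)
  define z where "z = Complex 0 (max 0 Y + 1)"
  have z: "Im z > 0" "Im z > Y" by (auto simp: z_def)
  have "\<forall>\<^sub>F x in at z. x \<in> {z. Im z > Y}"
    by (rule eventually_at_in_open') (use z open_halfspace_Im_gt in auto)
  moreover have "\<forall>\<^sub>F x in at z. f x \<noteq> 0" using modular_function_nonconst[OF f z(1), of 0] by simp
  ultimately have "\<forall>\<^sub>F x in at z. False" by eventually_elim (use Y in auto)
  then show False by (simp add: trivial_limit_at)
qed

text \<open>By the identity theorem on the connected half plane, a nonconstant function takes each
  value only on a sparse set.\<close>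

lemma nicely_meromorphic_nonconst_modular_function:
  assumes "f nicely_meromorphic_on upper_half_plane" "Gamma_invariant p f"
    and "\<not> (\<exists>c. \<forall>z\<in>upper_half_plane. f z = c)"
  shows "modular_function p f"
  unfolding modular_function_def
proof (intro conjI allI impI)
  show "f meromorphic_on upper_half_plane" using assms by (simp add: nicely_meromorphic_on_def)
  show "Gamma_invariant p f" by fact
  fix w z :: complex assume z: "Im z > 0"
  have "\<forall>\<^sub>\<approx>x\<in>upper_half_plane. f x \<noteq> w"
    using nicely_meromorphic_imp_constant_or_avoid[OF assms(1) open_upper_half_plane connected_upper_half_plane] assms(3) by metis
  then show "\<forall>\<^sub>F x in at z. f x \<noteq> w"
    by (rule eventually_cosparse_imp_eventually_at) (use z in simp)
qed

text \<open>Were one of these coefficients nonzero, \<open>W\<close>, the expansion of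
  \<open>(q^(-k) f - 1) / q^m\<close>, would have a pole at 0, while the growth condition bounds it.
  Subtracting 1 changes only the coefficient at 0, hence none with \<open>j > 0\<close>.\<close>

lemma coeff_gap_of_bigo:
  assumes L: "has_q_expansion f L" and L0: "L \<noteq> 0"
    and O: "(\<lambda>\<tau>. q_inf \<tau> powi (- fls_subdegree L) * f \<tau> - 1) \<in> O[at_i_inf](\<lambda>\<tau>. q_inf \<tau> ^ m)"
    and j: "0 < j" "j < int m"
  shows "fls_nth L (fls_subdegree L + j) = 0"
proof (rule ccontr)
  assume nz: "fls_nth L (fls_subdegree L + j) \<noteq> 0"
  define k where "k = fls_subdegree L"
  define V where "V = fls_shift k L - 1"
  define W where "W = fls_shift (int m) V"
  have radL: "fls_conv_radius L > 0" using L by (simp add: has_q_expansion_def)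
  have "eval_fls (fls_shift k L) has_laurent_expansion fls_shift k L"
    using radL by (intro eval_fls_has_laurent_expansion) simp
  then have "(\<lambda>q. eval_fls (fls_shift k L) q - 1) has_laurent_expansion V"
    unfolding V_def by (rule has_laurent_expansion_diff[OF _ has_laurent_expansion_1])
  then have radV: "fls_conv_radius V > 0" by (simp add: has_laurent_expansion_def)
  have evV: "\<forall>\<^sub>F q in at 0. eval_fls V q = eval_fls (fls_shift k L) q - 1"
    using \<open>_ has_laurent_expansion V\<close> by (simp add: has_laurent_expansion_def)
  have W: "eval_fls W has_laurent_expansion W"
    using radV unfolding W_def by (intro eval_fls_has_laurent_expansion) simp
  have "fls_nth W (j - int m) = fls_nth L (k + j)" using j by (simp add: W_def V_def add.commute)
  then have "fls_nth W (j - int m) \<noteq> 0" using nz by (simp add: k_def)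
  then have "fls_subdegree W \<le> j - int m" by (rule fls_subdegree_leI)
  then have "filterlim (eval_fls W) at_infinity (at 0)"
    using j by (intro has_laurent_expansion_imp_filterlim_infinity_0[OF W]) simp
  from O obtain c where c: "c > 0"
    "\<forall>\<^sub>F \<tau> in at_i_inf. norm (q_inf \<tau> powi (- k) * f \<tau> - 1) \<le> c * norm (q_inf \<tau> ^ m)"
    unfolding k_def by (elim landau_o.bigE)
  from c(2) have "\<forall>\<^sub>F \<tau> in at_i_inf. norm (q_inf \<tau> powi (- k) * eval_fls L (q_inf \<tau>) - 1) \<le> c * norm (q_inf \<tau> ^ m)"
    using has_q_expansionD(1)[OF L] by eventually_elim simp
  then have "\<forall>\<^sub>F q in at 0. norm (q powi (- k) * eval_fls L q - 1) \<le> c * norm (q ^ m)"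
    by (subst (asm) eventually_at_i_inf_q_inf)
  moreover have "\<forall>\<^sub>F q in at 0. q \<noteq> (0::complex)" by (rule eventually_neq_at_within)
  ultimately have "\<forall>\<^sub>F q in at 0. norm (eval_fls W q) \<le> c"
    using evV
  proof eventually_elim
    case (elim q)
    have "eval_fls W q = eval_fls V q * q powi (- int m)" unfolding W_def using elim(2) by (rule eval_fls_shift)
    also have "eval_fls V q = q powi (- k) * eval_fls L q - 1"
      using elim(3) eval_fls_shift[OF elim(2), of k L] by simp
    finally have "norm (eval_fls W q) = norm (q powi (- k) * eval_fls L q - 1) / norm (q ^ m)"
      by (simp add: norm_mult norm_power norm_inverse power_int_minus divide_inverse norm_power_int)
    also have "\<dots> \<le> c" using elim(1,2) by (simp add: divide_le_eq)
    finally show ?case .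
  qed
  moreover have "\<forall>\<^sub>F q in at 0. norm (eval_fls W q) > c"
    using \<open>filterlim (eval_fls W) at_infinity (at 0)\<close> c(1)
    by (auto simp: filterlim_at_infinity[of 0] dest!: spec[of _ "c + 1"] elim!: eventually_mono)
  ultimately have "\<forall>\<^sub>F q in at (0::complex). False" by eventually_elim simp
  then show False by (simp add: trivial_limit_at)
qed

section \<open>Sums of \<open>F\<close> over the divisor of a modular function\<close>

context cusp_expansion
begin

lemma cusp_zero_function_exI:
  assumes h: "modular_function p h" and L: "has_q_expansion h H" and H: "fls_subdegree H \<ge> 1"
  obtains R Y0 where "cusp_zero_function p F FA FB Fp Fm m h H R Y0"
proof -
  have H0: "H \<noteq> 0" using H by auto
  note HL = has_q_expansionD[OF L]
  have "fls_conv_radius H > 0" using L by (simp add: has_q_expansion_def)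
  then obtain R1 where R1: "0 < ereal R1" "ereal R1 < fls_conv_radius H"
    using ereal_dense2 by blast
  from has_laurent_expansion_nonzero_imp_eventually_nonzero[OF HL(2) H0]
  obtain R2 where R2: "R2 > 0" "\<And>q. q \<noteq> 0 \<Longrightarrow> norm q < R2 \<Longrightarrow> eval_fls H q \<noteq> 0"
    by (auto simp: eventually_at)
  define R where "R = min 1 (min R1 R2)"
  have R: "0 < R" "R \<le> 1" "R \<le> R1" "R \<le> R2" using R1 R2 by (auto simp: R_def)
  obtain Y where Y: "\<And>\<tau>. Im \<tau> > Y \<Longrightarrow> h \<tau> = eval_fls H (q_inf \<tau>)"
    using HL(1) by (auto simp: eventually_filtercomap_at_top_dense)
  \<comment> \<open>The summand 1 makes \<open>Y0\<close> strictly larger than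
    \<open>- ln R / (2 * pi)\<close>, whence \<open>exp (- 2 * pi * Y0) < R\<close>.\<close>
  define Y0 where "Y0 = max (max 1 Y) (1 - ln R / (2 * pi))"
  have "- ln R / (2 * pi) < Y0" by (simp add: Y0_def)
  then have "- 2 * pi * Y0 < ln R" by (simp add: field_simps)
  then have "exp (- 2 * pi * Y0) < exp (ln R)" by (subst exp_less_cancel_iff)
  then have "exp (- 2 * pi * Y0) < R" using R(1) by simp
  moreover have "ereal R \<le> fls_conv_radius H" using R(3) R1(2) by (meson ereal_less_eq(3) less_imp_le order_trans)
  ultimately have "cusp_zero_function p F FA FB Fp Fm m h H R Y0"
    by unfold_locales (use h H R R2 Y in \<open>auto simp: Y0_def\<close>)
  then show ?thesis by (rule that)
qed

text \<open>The trace of the divisor of \<open>f\<close>, with a complex quotient in place of the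
  integral division of \<open>ord_at\<close>; exactness of that division identifies the two.\<close>

definition degree_pairing :: "(complex \<Rightarrow> complex) \<Rightarrow> complex" where
  "degree_pairing f = (\<Sum>a | a \<in> X0star p - {cusp p} \<and> zorder f (rep a) \<noteq> 0.
      of_int (zorder f (rep a)) / of_nat (ram_index p (rep a)) * F (rep a))"

lemma zorder_inverse_modular:
  assumes f: "modular_function p f" and z: "Im z > 0"
  shows "zorder (\<lambda>x. inverse (f x)) z = - zorder f z"
proof -
  have me: "f meromorphic_on {z}" using modular_function_meromorphic_at[OF f z, of 0] by simp
  have "\<forall>\<^sub>F x in at z. f x \<noteq> 0" using modular_function_nonconst[OF f z, of 0] by simp
  then have nz: "\<exists>\<^sub>F x in at z. f x \<noteq> 0" by (rule eventually_frequently[OF trivial_limit_at])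
  have "zorder (\<lambda>x. 1 / f x) z = zorder (\<lambda>_. 1::complex) z - zorder f z"
    by (rule zorder_divide) (use me nz in \<open>auto simp: frequently_const trivial_limit_at\<close>)
  then show ?thesis by (simp add: inverse_eq_divide)
qed

text \<open>An order is the difference of its positive and negative part, and the poles of
  \<open>f\<close> are the zeros of \<open>1 / f\<close>.\<close>

lemma degree_pairing_eq:
  assumes f: "modular_function p f" and fin: "finite {a \<in> X0star p - {cusp p}. zorder f (rep a) \<noteq> 0}"
  shows "degree_pairing f = orbit_sum p (fib f 0) - orbit_sum p (fib (\<lambda>x. inverse (f x)) 0)"
proof -
  define T where "T = {a. a \<in> X0star p - {cusp p} \<and> zorder f (rep a) \<noteq> 0}"
  have finT: "finite T" using fin by (simp add: T_def)
  have zi: "zorder (\<lambda>x. inverse (f x)) (rep a) = - zorder f (rep a)" if "a \<in> X0star p - {cusp p}" for a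
    by (rule zorder_inverse_modular[OF f Im_rep_pos[OF that]])
  have 1: "orbit_sum p (fib f 0) = (\<Sum>a\<in>T. fib f 0 (rep a) / of_nat (ram_index p (rep a)))"
    unfolding orbit_sum_def
    by (rule sum.mono_neutral_left[OF finT]) (auto simp: T_def fib_def)
  have 2: "orbit_sum p (fib (\<lambda>x. inverse (f x)) 0) = (\<Sum>a\<in>T. fib (\<lambda>x. inverse (f x)) 0 (rep a) / of_nat (ram_index p (rep a)))"
    unfolding orbit_sum_def
    by (rule sum.mono_neutral_left[OF finT]) (use zi in \<open>force simp: T_def fib_def\<close>)+
  have "degree_pairing f = (\<Sum>a\<in>T. fib f 0 (rep a) / of_nat (ram_index p (rep a)) -
      fib (\<lambda>x. inverse (f x)) 0 (rep a) / of_nat (ram_index p (rep a)))"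
    unfolding degree_pairing_def T_def[symmetric]
  proof (rule sum.cong[OF refl])
    fix a assume "a \<in> T"
    then have a: "a \<in> X0star p - {cusp p}" by (simp add: T_def)
    show "of_int (zorder f (rep a)) / of_nat (ram_index p (rep a)) * F (rep a) =
       fib f 0 (rep a) / of_nat (ram_index p (rep a)) - fib (\<lambda>x. inverse (f x)) 0 (rep a) / of_nat (ram_index p (rep a))"
      using zi[OF a] by (cases "zorder f (rep a) \<ge> 0") (auto simp: fib_def)
  qed
  then show ?thesis unfolding 1 2 by (simp add: sum_subtractf)
qed

text \<open>Subtracting a constant does not change the poles. The inequality \<open>one\<close> is
  applied to \<open>f\<close> with \<open>c\<close> and to \<open>f - c\<close> with
  \<open>- c\<close>.\<close>

lemma fib_inverse_diff_const:
  assumes f: "modular_function p f" and z: "Im z > 0"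
  shows "fib (\<lambda>x. inverse (f x - c)) 0 z = fib (\<lambda>x. inverse (f x)) 0 z"
proof -
  have one: "max 0 (- zorder (\<lambda>x. g x - c) z) \<ge> max 0 (- zorder g z)" if g: "modular_function p g" for g c
  proof (cases "c \<noteq> 0 \<and> zorder g z < 0")
    case True
    have me: "g meromorphic_on {z}" using modular_function_meromorphic_at[OF g z, of 0] by simp
    have "\<forall>\<^sub>F x in at z. g x \<noteq> 0" using modular_function_nonconst[OF g z, of 0] by simp
    then have nz: "\<exists>\<^sub>F x in at z. g x \<noteq> 0" by (rule eventually_frequently[OF trivial_limit_at])
    have "zorder (\<lambda>x. g x - c) z = zorder g z"
      by (rule zorder_diff1[OF me nz]) (use True in \<open>auto simp: frequently_const trivial_limit_at\<close>)
    then show ?thesis by simp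
  qed auto
  have "zorder (\<lambda>x. (f x - c) - (- c)) z = zorder f z" by simp
  then have "max 0 (- zorder (\<lambda>x. f x - c) z) = max 0 (- zorder f z)"
    using one[OF f, of c] one[OF modular_function_diff_const[OF f], of c "- c"] by simp
  then show ?thesis
    unfolding fib_def using zorder_inverse_modular[OF f z] zorder_inverse_modular[OF modular_function_diff_const[OF f] z]
    by simp
qed

lemma degree_pairing_eq_0:
  assumes f: "modular_function p f" and L: "has_q_expansion f L" and Fp0: "fls_nth Fp 0 = 0"
    and gap: "\<And>j. 0 < j \<Longrightarrow> j < int m \<Longrightarrow> fls_nth L (fls_subdegree L + j) = 0"
    and fin: "finite {a \<in> X0star p - {cusp p}. zorder f (rep a) \<noteq> 0}"
  shows "degree_pairing f = 0"
proof -
  have L0: "L \<noteq> 0" by (rule q_expansion_nonzero[OF f L])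
  have res0: "fls_residue (Fp * fls_deriv L / L) = 0"
    by (rule fls_residue_log_deriv_eq_0[OF Fp_nth Fp0 L0 gap])
  have zs: "(\<Sum>i=1..m. c i * (0::complex) ^ i) = 0" for c :: "nat \<Rightarrow> complex"
    by (rule sum.neutral) auto
  have "orbit_sum p (fib f 0) = orbit_sum p (fib (\<lambda>x. inverse (f x)) 0)"
  proof -
    consider "fls_subdegree L \<ge> 1" | "fls_subdegree L \<le> - 1" | "fls_subdegree L = 0" by linarith
    then show ?thesis
    proof cases
      case 1
      obtain R Y0 where "cusp_zero_function p F FA FB Fp Fm m f L R Y0" using cusp_zero_function_exI[OF f L 1] .
      then interpret cusp_zero_function p F FA FB Fp Fm m f L R Y0 .
      show ?thesis using orbit_sum_fib_inverse[of 0] res0 by (simp add: zs cusp_res_def)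
    next
      case 2
      have "fls_subdegree (inverse L) \<ge> 1" using 2 L0 by simp
      from cusp_zero_function_exI[OF modular_function_inverse[OF f] has_q_expansion_inverse[OF L] this]
      obtain R Y0 where "cusp_zero_function p F FA FB Fp Fm m (\<lambda>x. inverse (f x)) (inverse L) R Y0" .
      then interpret cusp_zero_function p F FA FB Fp Fm m "\<lambda>x. inverse (f x)" "inverse L" R Y0 .
      \<comment> \<open>Inversion changes the sign of the logarithmic derivative, so the residue
        computed for \<open>L\<close> also settles \<open>inverse L\<close>.\<close>
      have "fls_deriv (L * inverse L) = 0" using L0 by simp
      then have "L * fls_deriv (inverse L) = - (fls_deriv L * inverse L)"
        by (simp add: eq_neg_iff_add_eq_0 del: right_inverse)
      moreover have "Fp * fls_deriv (inverse L) / inverse L = Fp * (L * fls_deriv (inverse L))"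
        unfolding divide_inverse[of _ "inverse L"] inverse_inverse_eq by (simp only: mult_ac)
      ultimately have "Fp * fls_deriv (inverse L) / inverse L = - (Fp * fls_deriv L / L)"
        by (simp add: divide_inverse)
      then have "cusp_res (inverse L) 0 = 0"
        using res0 by (simp add: cusp_res_def)
      then show ?thesis using orbit_sum_fib_inverse[of 0] by (simp add: zs)
    next
      case 3
      define c where "c = fls_nth L 0"
      have c: "c \<noteq> 0" using 3 L0 nth_fls_subdegree_nonzero[of L] by (simp add: c_def)
      define H where "H = L - fls_const c"
      have h: "modular_function p (\<lambda>x. f x - c)" by (rule modular_function_diff_const[OF f])
      have LH: "has_q_expansion (\<lambda>x. f x - c) H" unfolding H_def by (rule has_q_expansion_diff_const[OF L])
      have H0: "H \<noteq> 0" by (rule q_expansion_nonzero[OF h LH])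
      \<comment> \<open>Subtracting \<open>c\<close> removes the constant coefficient and the gap
        those below \<open>m\<close>, so \<open>H\<close> vanishes to order at least
        \<open>m\<close>.\<close>
      have low: "fls_nth H j = 0" if "j < max 1 (int m)" for j
      proof (cases "j \<le> 0")
        case True
        then show ?thesis using 3 by (cases "j = 0") (auto simp: H_def c_def)
      next
        case False
        then show ?thesis using gap[of j] 3 that by (auto simp: H_def)
      qed
      have sd: "fls_subdegree H \<ge> max 1 (int m)" by (rule fls_subdegree_geI[OF H0 low])
      then have sd1: "fls_subdegree H \<ge> 1" "fls_subdegree H \<ge> int m" by simp_all
      obtain R Y0 where "cusp_zero_function p F FA FB Fp Fm m (\<lambda>x. f x - c) H R Y0"
        using cusp_zero_function_exI[OF h LH sd1(1)] .
      then interpret cusp_zero_function p F FA FB Fp Fm m "\<lambda>x. f x - c" H R Y0 .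
      have "cusp_res H i = 0" if "i \<ge> 1" for i
        unfolding cusp_res_def by (rule fls_residue_power_deriv_eq_0[OF Fp_nth sd1 that])
      then have sm: "(\<Sum>i=1..m. cusp_res H i * s ^ i) = 0" for s by (intro sum.neutral) auto
      \<comment> \<open>\<open>cusp_res H 0\<close> is not claimed to vanish; it is the same for
        both values of \<open>s\<close> and cancels.\<close>
      have "orbit_sum p (fib (\<lambda>x. inverse (f x - c)) 0) = orbit_sum p (fib (\<lambda>x. inverse (f x - c)) (- inverse c))"
        using orbit_sum_fib_inverse[of 0] orbit_sum_fib_inverse[of "- inverse c"] by (simp only: sm)
      also have "orbit_sum p (fib (\<lambda>x. inverse (f x - c)) 0) = orbit_sum p (fib (\<lambda>x. inverse (f x)) 0)"
        by (rule orbit_sum_cong) (rule fib_inverse_diff_const[OF f])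
      \<comment> \<open>\<open>1 / (f - c) = - 1 / c\<close> amounts to
        \<open>f = 0\<close>.\<close>
      also have "orbit_sum p (fib (\<lambda>x. inverse (f x - c)) (- inverse c)) = orbit_sum p (fib f 0)"
      proof (rule orbit_sum_cong)
        fix z :: complex assume z: "Im z > 0"
        have "fib (\<lambda>x. inverse (f x - c)) (- inverse c) z = fib (\<lambda>x. f x - c) (- c) z"
          using fib_inverse[OF h z, of "- inverse c"] c by simp
        then show "fib (\<lambda>x. inverse (f x - c)) (- inverse c) z = fib f 0 z" by (simp add: fib_diff_const)
      qed
      finally show ?thesis by simp
    qed
  qed
  then show ?thesis using degree_pairing_eq[OF f fin] by simp
qed

end

section \<open>The trace of principal divisors and its descent to classes\<close>

lemma divisor_trace_add: "divisor_trace p F (D + E) = divisor_trace p F D + divisor_trace p F E"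
proof -
  define K where "K = Poly_Mapping.keys D \<union> Poly_Mapping.keys E - {cusp p}"
  have finK: "finite K" by (simp add: K_def)
  have eq: "divisor_trace p F C = (\<Sum>a\<in>K. of_int (Poly_Mapping.lookup C a) * F (rep a))"
    if "Poly_Mapping.keys C \<subseteq> Poly_Mapping.keys D \<union> Poly_Mapping.keys E" for C
    unfolding divisor_trace_def
    by (rule sum.mono_neutral_left[OF finK]) (use that in \<open>auto simp: K_def in_keys_iff\<close>)
  show ?thesis
    using eq[of "D + E"] eq[of D] eq[of E] keys_add[of D E]
    by (simp add: lookup_add distrib_right sum.distrib)
qed

lemma divisor_trace_principal_divisor:
  fixes p m :: nat and F f :: "complex \<Rightarrow> complex" and Fp :: "complex fls"
  assumes p: "prime p \<or> p = 1" and F: "Gamma_invariant p F" and hol: "is_holomorphic_part F Fp"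
    and Fp_nth: "\<And>n :: int. n \<le> - int m \<Longrightarrow> fls_nth Fp n = 0" and Fp_0: "fls_nth Fp 0 = 0"
    and f: "f \<in> function_field_units p"
    and O: "(\<lambda>\<tau>. q_inf \<tau> powi (- ord_cusp f) * f \<tau> - 1) \<in> O[at_i_inf](\<lambda>\<tau>. q_inf \<tau> ^ m)"
  shows "divisor_trace p F (principal_divisor p f) = 0"
proof -
  have p0: "p > 0" using p by (auto intro: prime_gt_0_nat)
  obtain L where fm: "f nicely_meromorphic_on upper_half_plane" "Gamma_invariant p f" and L: "has_q_expansion f L"
    and fnz: "\<exists>\<tau>\<in>upper_half_plane. f \<tau> \<noteq> 0"
    using f by (auto simp: function_field_units_def function_field_def)
  have repX: "Im (rep a) > 0" if "a \<in> X0star p" "a \<noteq> cusp p" for a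
    using X0star_noncuspidal[OF p that] rep_orbit(1)[OF p0] by metis
  show ?thesis
  proof (cases "\<exists>c. \<forall>z\<in>upper_half_plane. f z = c")
    \<comment> \<open>\<open>modular_function\<close> excludes constants, so they are treated apart:
      a nonzero constant has divisor 0.\<close>
    case True
    then obtain c where c: "\<And>z. Im z > 0 \<Longrightarrow> f z = c" by auto
    have c0: "c \<noteq> 0" using fnz c by auto
    have zo: "zorder f z = 0" if z: "Im z > 0" for z
    proof -
      have "\<forall>\<^sub>F x in at z. x \<in> upper_half_plane" by (rule eventually_at_in_open') (use z in auto)
      then have "\<forall>\<^sub>F x in at z. f x = c" by eventually_elim (simp add: c)
      then have "zorder f z = zorder (\<lambda>_. c) z" by (rule zorder_cong) simp
      then show ?thesis using c0 by simp
    qed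
    have "\<forall>\<^sub>F \<tau> in at_i_inf. f \<tau> = c"
      unfolding eventually_filtercomap_at_top_dense using c by blast
    then have "has_q_expansion f (fls_const c)"
      using has_q_expansion_iff_laurent[of f "\<lambda>_. c" "fls_const c"] has_laurent_expansion_const[of c] by simp
    then have oc: "ord_cusp f = 0" by (simp add: ord_cusp_def q_expansion_eqI)
    have "ord_at p f a = 0" if "a \<in> X0star p" for a
      using that oc zo repX by (simp add: ord_at_def)
    then have "(\<lambda>a. if a \<in> X0star p then ord_at p f a else 0) = (\<lambda>_. 0)"
      by (intro ext) (metis (mono_tags))
    moreover have "Abs_poly_mapping (\<lambda>_ :: point. 0 :: int) = 0" by simp
    ultimately have "principal_divisor p f = 0" unfolding principal_divisor_def by (simp only:)
    then show ?thesis by (simp add: divisor_trace_def)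
  next
    case False
    have fmod: "modular_function p f" by (rule nicely_meromorphic_nonconst_modular_function[OF fm False])
    have L0: "L \<noteq> 0" by (rule q_expansion_nonzero[OF fmod L])
    have oc: "ord_cusp f = fls_subdegree L" by (simp add: ord_cusp_def q_expansion_eqI[OF L])
    obtain Fm where Fm: "fls_conv_radius Fp \<ge> 1" "fps_conv_radius Fm \<ge> 1" "fps_nth Fm 0 = 0"
      "\<And>\<tau>. Im \<tau> > 0 \<Longrightarrow> F \<tau> = eval_fls Fp (q_inf \<tau>) + eval_fps Fm (cnj (q_inf \<tau>))"
      using hol by (auto simp: is_holomorphic_part_def maass_expansion_def)
    \<comment> \<open>Conjugating on both sides gives a holomorphic function of \<open>q\<close>
      whose conjugate is the antiholomorphic part: \<open>F^- = cnj (k (q))\<close>.\<close>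
    define k where "k = cnj \<circ> eval_fps Fm \<circ> cnj"
    have cb: "cnj ` ball 0 1 \<subseteq> eball 0 (fps_conv_radius Fm)"
    proof
      fix x assume "x \<in> cnj ` ball 0 1"
      then have "ereal (norm x) < ereal 1" by auto
      from less_le_trans[OF this Fm(2)[unfolded one_ereal_def]]
      show "x \<in> eball 0 (fps_conv_radius Fm)" by simp
    qed
    have khol: "k holomorphic_on ball 0 1"
      unfolding k_def by (rule holomorphic_on_compose_cnj_cnj[OF holomorphic_on_eval_fps[OF cb] open_ball])
    have q1: "q_inf ` upper_half_plane \<subseteq> ball 0 1 - {0}"
      by (auto simp: norm_q_inf)
    have Ahol: "eval_fls Fp holomorphic_on ball 0 1 - {0}"
    proof (rule holomorphic_on_eval_fls)
      show "ball 0 1 - {0} \<subseteq> eball 0 (fls_conv_radius Fp) - (if 0 \<le> fls_subdegree Fp then {} else {0})"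
        by (auto intro!: less_le_trans[OF _ Fm(1)[unfolded one_ereal_def]])
    qed
    interpret cusp_expansion p F "eval_fls Fp \<circ> q_inf" "k \<circ> q_inf" Fp k m
    proof unfold_locales
      show "eval_fls Fp \<circ> q_inf holomorphic_on upper_half_plane"
        by (rule holomorphic_on_compose_gen[OF q_inf_holomorphic Ahol q1])
      show "k \<circ> q_inf holomorphic_on upper_half_plane"
        by (rule holomorphic_on_compose_gen[OF q_inf_holomorphic khol]) (use q1 in blast)
      show "k 0 = 0" using Fm(3) by (simp add: k_def eval_fps_at_0)
    qed (use p F Fm khol Fp_nth in \<open>auto simp: k_def\<close>)
    have gap: "fls_nth L (fls_subdegree L + j) = 0" if "0 < j" "j < int m" for j
      by (rule coeff_gap_of_bigo[OF L L0 _ that]) (use O oc in simp)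
    have fin: "finite {a \<in> X0star p - {cusp p}. zorder f (rep a) \<noteq> 0}"
    proof -
      have "\<forall>\<^sub>F q in at 0. eval_fls L q \<noteq> 0"
        by (rule has_laurent_expansion_nonzero_imp_eventually_nonzero[OF has_q_expansionD(2)[OF L] L0])
      then obtain d where d: "d > 0" "\<And>q. q \<noteq> 0 \<Longrightarrow> norm q < d \<Longrightarrow> eval_fls L q \<noteq> 0"
        by (auto simp: eventually_at)
      have "fls_conv_radius L > 0" using L by (simp add: has_q_expansion_def)
      then obtain d' where d': "0 < ereal d'" "ereal d' < fls_conv_radius L" using ereal_dense2 by blast
      have "\<forall>\<^sub>F q in at 0. q \<in> ball 0 (min d d') - {0 :: complex}"
        by (rule eventually_at_in_open) (use d d' in auto)
      then have "\<forall>\<^sub>F \<tau> in at_i_inf. q_inf \<tau> \<in> ball 0 (min d d') - {0}" by (subst eventually_at_i_inf_q_inf)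
      with has_q_expansionD(1)[OF L]
      have "\<forall>\<^sub>F \<tau> in at_i_inf. f \<tau> = eval_fls L (q_inf \<tau>) \<and> q_inf \<tau> \<in> ball 0 (min d d') - {0}"
        by eventually_elim simp
      then obtain Y where Y: "\<And>\<tau>. Im \<tau> > Y \<Longrightarrow> f \<tau> = eval_fls L (q_inf \<tau>) \<and> q_inf \<tau> \<in> ball 0 (min d d') - {0}"
        unfolding eventually_filtercomap_at_top_dense by blast
      have hol: "eval_fls L holomorphic_on ball 0 (min d d') - {0}"
      proof (rule holomorphic_on_eval_fls)
        show "ball 0 (min d d') - {0} \<subseteq> eball 0 (fls_conv_radius L) - (if 0 \<le> fls_subdegree L then {} else {0})"
          by (auto intro!: less_trans[OF _ d'(2)])
      qed
      have "eval_fls L \<circ> q_inf holomorphic_on {\<tau>. Im \<tau> > Y}"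
        by (rule holomorphic_on_compose_gen[OF q_inf_holomorphic hol]) (use Y in auto)
      then have fhol: "f holomorphic_on {\<tau>. Im \<tau> > Y}" by (rule holomorphic_transform) (use Y in auto)
      have "zorder f z = 0" if z: "Im z > Y" for z
      proof (rule zorder_eq_0I)
        show "f analytic_on {z}" using fhol z open_halfspace_Im_gt[of Y] by (auto simp: analytic_at)
        show "f z \<noteq> 0" using Y[OF z] d(2)[of "q_inf z"] by auto
      qed
      then show ?thesis by (rule finite_divisor_support[OF p fmod])
    qed
    \<comment> \<open>Divisibility by the ramification index makes the integer division in
      \<open>ord_at\<close> a true quotient.\<close>
    have exact: "of_int (zorder f (rep a) div int (ram_index p (rep a))) =
        (of_int (zorder f (rep a)) / of_nat (ram_index p (rep a)) :: complex)"
      if a: "a \<in> X0star p" "a \<noteq> cusp p" for a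
    proof -
      obtain j where j: "zorder f (rep a) = int (ram_index p (rep a)) * j"
        using ram_index_dvd_zorder[OF p0 fmod repX[OF a]] by blast
      then show ?thesis using ram_index_pos[OF p0 repX[OF a]] by simp
    qed
    have ordz: "ord_at p f a = 0 \<longleftrightarrow> zorder f (rep a) = 0" if "a \<in> X0star p" "a \<noteq> cusp p" for a
    proof -
      have "ord_at p f a = 0 \<longleftrightarrow> (of_int (ord_at p f a) :: complex) = 0" by simp
      also have "\<dots> \<longleftrightarrow> zorder f (rep a) = 0"
        using exact[OF that] that ram_index_pos[OF p0 repX[OF that]] by (simp add: ord_at_def)
      finally show ?thesis .
    qed
    \<comment> \<open>\<open>Abs_poly_mapping\<close> has the intended coefficients only once the
      support is known to be finite.\<close>
    have "{a. (if a \<in> X0star p then ord_at p f a else 0) \<noteq> 0} \<subseteq>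
        insert (cusp p) {a \<in> X0star p - {cusp p}. zorder f (rep a) \<noteq> 0}"
    proof
      fix a assume "a \<in> {a. (if a \<in> X0star p then ord_at p f a else 0) \<noteq> 0}"
      then have "a \<in> X0star p" "ord_at p f a \<noteq> 0" by (auto split: if_splits)
      then show "a \<in> insert (cusp p) {a \<in> X0star p - {cusp p}. zorder f (rep a) \<noteq> 0}"
        using ordz[of a] by blast
    qed
    then have "finite {a. (if a \<in> X0star p then ord_at p f a else 0) \<noteq> 0}"
      by (rule finite_subset) (use fin in simp)
    then have look: "Poly_Mapping.lookup (principal_divisor p f) = (\<lambda>a. if a \<in> X0star p then ord_at p f a else 0)"
      unfolding principal_divisor_def by (rule lookup_Abs_poly_mapping)
    have keys: "Poly_Mapping.keys (principal_divisor p f) - {cusp p} = {a. a \<in> X0star p - {cusp p} \<and> zorder f (rep a) \<noteq> 0}"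
    proof (intro equalityI subsetI)
      fix a assume a: "a \<in> Poly_Mapping.keys (principal_divisor p f) - {cusp p}"
      have ne: "a \<noteq> cusp p" using DiffD2[OF a] by (metis singletonI)
      have "(if a \<in> X0star p then ord_at p f a else 0) \<noteq> 0"
        using DiffD1[OF a] in_keys_iff[of a "principal_divisor p f"] look by metis
      then have "a \<in> X0star p" "ord_at p f a \<noteq> 0" by metis+
      with ne show "a \<in> {a. a \<in> X0star p - {cusp p} \<and> zorder f (rep a) \<noteq> 0}" using ordz[of a] by blast
    next
      fix a assume "a \<in> {a. a \<in> X0star p - {cusp p} \<and> zorder f (rep a) \<noteq> 0}"
      then have "a \<in> X0star p" "a \<noteq> cusp p" "ord_at p f a \<noteq> 0" using ordz[of a] by blast+
      then show "a \<in> Poly_Mapping.keys (principal_divisor p f) - {cusp p}" by (simp add: in_keys_iff look)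
    qed
    have "divisor_trace p F (principal_divisor p f) = degree_pairing f"
      unfolding divisor_trace_def degree_pairing_def keys
      by (rule sum.cong[OF refl]) (simp add: look ord_at_def exact)
    also have "\<dots> = 0" by (rule degree_pairing_eq_0[OF fmod L Fp_0 gap fin])
    finally show ?thesis .
  qed
qed

lemma Div0_mult: "D \<otimes>\<^bsub>Div0 p\<^esub> E = D + E"
  by (simp add: Div0_def free_Abelian_group_def)

text \<open>Supplies a member of every coset, namely \<open>D\<close> shifted by the divisor of 1,
  so that choosing a representative is meaningful.\<close>

lemma principal_divisor_1_mem: "principal_divisor p (\<lambda>_. 1) \<in> principal_mod p m"
proof -
  have q: "has_q_expansion (\<lambda>_. 1) 1" using has_q_expansion_const[of 1] by simp
  have "\<forall>n. fls_nth (1 :: complex fls) n \<in> \<rat>" by simp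
  then have "(\<lambda>_. 1) \<in> function_field p"
    unfolding function_field_def Gamma_invariant_def using q by auto
  then have "(\<lambda>_. 1) \<in> function_field_units p"
    unfolding function_field_units_def by (auto intro!: exI[of _ \<i>])
  moreover have "ord_cusp (\<lambda>_. 1) = 0" by (simp add: ord_cusp_def q_expansion_eqI[OF q])
  ultimately show ?thesis unfolding principal_mod_def by auto
qed

theorem proposition1p3:
  fixes p m :: nat and F :: "complex \<Rightarrow> complex" and Fp :: "complex fls"
  assumes "prime p \<or> p = 1"
    and "F \<in> harmonic_maass_forms p"
    and "is_holomorphic_part F Fp"
    and "\<And>n :: int. n \<le> - int m \<Longrightarrow> fls_nth Fp n = 0"
    and "fls_nth Fp 0 = 0"
  shows "\<exists>tr \<in> hom (generalized_jacobian p m) complex_add_group.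
           \<forall>D \<in> carrier (Div0 p). tr (divisor_class p m D) = divisor_trace p F D"
proof -
  define T where "T = divisor_trace p F"
  \<comment> \<open>The trace of an arbitrary representative. It is constant on each class because
    \<open>T\<close> is additive and zero on \<open>principal_mod p m\<close>.\<close>
  define tr where "tr = (\<lambda>C. T (SOME D. D \<in> C))"
  have inv: "Gamma_invariant p F" using assms(2) by (simp add: harmonic_maass_forms_def)
  have zero: "T h = 0" if "h \<in> principal_mod p m" for h
    using that divisor_trace_principal_divisor[OF assms(1) inv assms(3-5)]
    by (auto simp: T_def principal_mod_def)
  have tr_eq: "tr C = c" if "D \<in> C" "\<And>E. E \<in> C \<Longrightarrow> T E = c" for C D c
    unfolding tr_def using someI[of "\<lambda>D. D \<in> C", OF that(1)] that(2) by blast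
  have coset: "E \<in> divisor_class p m D \<longleftrightarrow> (\<exists>h\<in>principal_mod p m. E = h + D)" for D E
    by (auto simp: divisor_class_def r_coset_def Div0_mult)
  have class_T: "T E = T D" if "E \<in> divisor_class p m D" for D E
    using that zero by (auto simp: coset T_def divisor_trace_add)
  have class_ne: "principal_divisor p (\<lambda>_. 1) + D \<in> divisor_class p m D" for D
    using principal_divisor_1_mem[of p m] by (auto simp: coset)
  have tr_class: "tr (divisor_class p m D) = T D" for D
    by (rule tr_eq[OF class_ne class_T])
  have "tr \<in> hom (generalized_jacobian p m) complex_add_group"
  proof (rule homI)
    fix C C' assume "C \<in> carrier (generalized_jacobian p m)" "C' \<in> carrier (generalized_jacobian p m)"
    then obtain D D' where D: "C = divisor_class p m D" "C' = divisor_class p m D'"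
      by (auto simp: generalized_jacobian_def FactGroup_def RCOSETS_def divisor_class_def)
    \<comment> \<open>The product of two classes is the set of all sums of their members, on which
      \<open>T\<close> is again constant.\<close>
    have prod: "E \<in> C \<otimes>\<^bsub>generalized_jacobian p m\<^esub> C' \<longleftrightarrow> (\<exists>x\<in>C. \<exists>y\<in>C'. E = x + y)" for E
      by (auto simp: generalized_jacobian_def FactGroup_def set_mult_def Div0_mult)
    have "tr (C \<otimes>\<^bsub>generalized_jacobian p m\<^esub> C') = T D + T D'"
    proof (rule tr_eq)
      show "(principal_divisor p (\<lambda>_. 1) + D) + (principal_divisor p (\<lambda>_. 1) + D')
          \<in> C \<otimes>\<^bsub>generalized_jacobian p m\<^esub> C'"
        using prod[THEN iffD2] class_ne[of D] class_ne[of D'] D by blast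
      fix E assume "E \<in> C \<otimes>\<^bsub>generalized_jacobian p m\<^esub> C'"
      then obtain x y where "x \<in> divisor_class p m D" "y \<in> divisor_class p m D'" "E = x + y"
        using prod[THEN iffD1] D by blast
      then show "T E = T D + T D'"
        using class_T[of x D] class_T[of y D'] by (simp add: T_def divisor_trace_add)
    qed
    then show "tr (C \<otimes>\<^bsub>generalized_jacobian p m\<^esub> C') = tr C \<otimes>\<^bsub>complex_add_group\<^esub> tr C'"
      by (simp add: D tr_class complex_add_group_def)
  qed (simp add: complex_add_group_def)
  then show ?thesis using tr_class by (auto simp: T_def)
qed

end
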